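(* Let $n\geq 1$ be an integer, let $\alpha>0$ and $1<q\leq 1+\frac{\alpha}{n}$ be real numbers. Let $\mathcal L=\sum_{i,j=1}^n\frac{\partial}{\partial x_i}\left[a_{ij}(t,x)\frac{\partial}{\partial x_j}\right]$ be a differential operator on $\mathbb E=\mathbb R\times\mathbb R^n$ whose coefficients satisfy the standing assumptions given in the context, with bounding function $A(t,x)$, and suppose that for this $\alpha$ and some constant $c>0$ one has $$\mathcal A(R):=\operatorname*{ess\,sup}_{(t,x)\in(-\infty,+\infty)\times\{R/2<|x|<R\}}A(t,x)\leq cR^{2-\alpha}\quad\text{for all } R>1.$$ Let $u=u(t,x)$ be a weak solution in $\mathbb E$ of the inequality $u_t\geq\mathcal L u+|u|^{q-1}u$ and let $v=v(t,x)$ be a weak solution in $\mathbb E$ of the inequality $v_t\leq\mathcal L v+|v|^{q-1}v$, such that $u\geq v$ (almost everywhere) in $\mathbb E$. Then $u=v$ (almost everywhere) in $\mathbb E$.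
   Context: Setting: $\mathbb E=\mathbb R\times\mathbb R^n$ with points $(t,x)$, $t\in\mathbb R$, $x\in\mathbb R^n$. Standing assumptions on $\mathcal L=\sum_{i,j=1}^n\frac{\partial}{\partial x_i}\left[a_{ij}(t,x)\frac{\partial}{\partial x_j}\right]$: the real-valued coefficients $a_{ij}$, $i,j=1,\dots,n$, are defined, measurable and locally bounded in $\mathbb E$; $a_{ij}(t,x)=a_{ji}(t,x)$ for almost all $(t,x)\in\mathbb E$; and $$0\leq\sum_{i,j=1}^n a_{ij}(t,x)\xi_i\xi_j\leq A(t,x)|\xi|^2$$ for all $\xi\in\mathbb R^n$ and almost all $(t,x)\in\mathbb E$, where $A$ is a measurable, non-negative, locally bounded function on $\mathbb E$. (No positive lower ellipticity bound is assumed.) Function spaces: let $\hat q=\max\{1,q\}$. For a domain $\Omega\subset\mathbb E$, $W^{\mathcal L,q}(\Omega)$ is the completion of the space $C^\infty(\Omega)$ of infinitely differentiable functions on $\Omega$ (those with finite norm) with respect to the norm $$\|w\|_{W^{\mathcal L,q}(\Omega)}=\int_\Omega|w_t|\,dt\,dx+\left[\int_\Omega\sum_{i,j=1}^n a_{ij}(t,x)\frac{\partial w}{\partial x_i}\frac{\partial w}{\partial x_j}\,dt\,dx\right]^{1/2}+\left[\int_\Omega|w|^{\hat q}\,dt\,dx\right]^{1/\hat q}.$$ A function $w$ belongs to $W^{\mathcal L,q}_{\mathrm{loc}}(\mathbb E)$ if it belongs to $W^{\mathcal L,q}(\Omega)$ for every bounded domain $\Omega\subset\mathbb E$. Weak solutions: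 a measurable function $u$ on $\mathbb E$ is a weak solution in $\mathbb E$ of $u_t\geq\mathcal L u+|u|^{q-1}u$ if $u\in W^{\mathcal L,q}_{\mathrm{loc}}(\mathbb E)$ and $$\int_{\mathbb E}\left[u_t\varphi+\sum_{i,j=1}^n a_{ij}\frac{\partial\varphi}{\partial x_i}\frac{\partial u}{\partial x_j}-|u|^{q-1}u\,\varphi\right]dt\,dx\geq 0$$ for every non-negative $\varphi\in C^\infty(\mathbb E)$ with compact support in $\mathbb E$. A measurable function $v$ on $\mathbb E$ is a weak solution in $\mathbb E$ of $v_t\leq\mathcal L v+|v|^{q-1}v$ if $v\in W^{\mathcal L,q}_{\mathrm{loc}}(\mathbb E)$ and the same integral with $v$ in place of $u$ is $\leq 0$ for every such $\varphi$. For elements of the completion, $w_t$ and the integral of $\sum_{i,j}a_{ij}\frac{\partial\varphi}{\partial x_i}\frac{\partial w}{\partial x_j}$ are understood as limits along the sequences of smooth functions, Cauchy in the norm $\|\cdot\|_{W^{\mathcal L,q}(\Omega)}$ on a bounded domain $\Omega\subset\mathbb E$ containing the support of $\varphi$, that represent the element $w$ of the completion. *)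

theory Defs
  imports "HOL-Analysis.Analysis" "HOL-Probability.Essential_Supremum"
begin

text \<open>The space \<open>\<real> \<times> \<real>\<^sup>n\<close> is the type \<^typ>\<open>real \<times> (real ^ 'n)\<close> with \<open>n = CARD('n)\<close>; almost
  everywhere, measurable and integrals refer to Lebesgue measure on it.\<close>

type_synonym 'n spacetime = "real \<times> (real ^ 'n)"

text \<open>\<open>Ck_on k S f\<close> is meant for open \<open>S\<close>: it says that all partial derivatives of \<open>f\<close> of order
  at most \<open>k\<close> exist and are continuous on \<open>S\<close>; values of \<open>f\<close> outside \<open>S\<close> play no role.\<close>

primrec Ck_on :: "nat \<Rightarrow> 'a::euclidean_space set \<Rightarrow> ('a \<Rightarrow> real) \<Rightarrow> bool" where
  "Ck_on 0 S f \<longleftrightarrow> continuous_on S f"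
| "Ck_on (Suc k) S f \<longleftrightarrow>
     (\<forall>z\<in>S. f differentiable (at z)) \<and>
     (\<forall>b\<in>Basis. Ck_on k S (\<lambda>z. frechet_derivative f (at z) b))"

definition Cinf_on :: "'a::euclidean_space set \<Rightarrow> ('a \<Rightarrow> real) \<Rightarrow> bool" where
  "Cinf_on S f \<longleftrightarrow> (\<forall>k. Ck_on k S f)"

definition dt :: "(('n::finite) spacetime \<Rightarrow> real) \<Rightarrow> 'n spacetime \<Rightarrow> real" where
  "dt w z = frechet_derivative w (at z) (1, 0)"

definition dx :: "'n::finite \<Rightarrow> ('n spacetime \<Rightarrow> real) \<Rightarrow> 'n spacetime \<Rightarrow> real" where
  "dx i w z = frechet_derivative w (at z) (0, axis i 1)"

definition locally_bounded :: "('a::topological_space \<Rightarrow> real) \<Rightarrow> bool" where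
  "locally_bounded f \<longleftrightarrow> (\<forall>z. \<exists>U. open U \<and> z \<in> U \<and> bounded (f ` U))"

definition admissible_coefficients ::
    "('n::finite \<Rightarrow> 'n \<Rightarrow> 'n spacetime \<Rightarrow> real) \<Rightarrow> ('n spacetime \<Rightarrow> real) \<Rightarrow> bool" where
  "admissible_coefficients a A \<longleftrightarrow>
     (\<forall>i j. a i j \<in> borel_measurable lebesgue \<and> locally_bounded (a i j)) \<and>
     (\<forall>i j. AE z in lebesgue. a i j z = a j i z) \<and>
     A \<in> borel_measurable lebesgue \<and> (\<forall>z. 0 \<le> A z) \<and> locally_bounded A \<and>
     (AE z in lebesgue. \<forall>\<xi> :: real ^ 'n.
        0 \<le> (\<Sum>i\<in>UNIV. \<Sum>j\<in>UNIV. a i j z * \<xi> $ i * \<xi> $ j) \<and>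
        (\<Sum>i\<in>UNIV. \<Sum>j\<in>UNIV. a i j z * \<xi> $ i * \<xi> $ j) \<le> A z * (norm \<xi>)\<^sup>2)"

definition domain_set :: "'a::topological_space set \<Rightarrow> bool" where
  "domain_set \<Omega> \<longleftrightarrow> open \<Omega> \<and> connected \<Omega> \<and> \<Omega> \<noteq> {}"

definition grad_form ::
    "('n::finite \<Rightarrow> 'n \<Rightarrow> 'n spacetime \<Rightarrow> real) \<Rightarrow> ('n spacetime \<Rightarrow> real) \<Rightarrow> ('n spacetime \<Rightarrow> real)
      \<Rightarrow> 'n spacetime \<Rightarrow> real" where
  "grad_form a f g z = (\<Sum>i\<in>UNIV. \<Sum>j\<in>UNIV. a i j z * dx i f z * dx j g z)"

definition qhat :: "real \<Rightarrow> real" where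
  "qhat q = max 1 q"

definition W_smooth ::
    "('n::finite \<Rightarrow> 'n \<Rightarrow> 'n spacetime \<Rightarrow> real) \<Rightarrow> real \<Rightarrow> 'n spacetime set \<Rightarrow> ('n spacetime \<Rightarrow> real) set"
  where
  "W_smooth a q \<Omega> = {w. Cinf_on \<Omega> w \<and>
     set_integrable lebesgue \<Omega> (\<lambda>z. \<bar>dt w z\<bar>) \<and>
     set_integrable lebesgue \<Omega> (grad_form a w w) \<and>
     set_integrable lebesgue \<Omega> (\<lambda>z. \<bar>w z\<bar> powr qhat q)}"

definition W_norm ::
    "('n::finite \<Rightarrow> 'n \<Rightarrow> 'n spacetime \<Rightarrow> real) \<Rightarrow> real \<Rightarrow> 'n spacetime set \<Rightarrow> ('n spacetime \<Rightarrow> real) \<Rightarrow> real"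
  where
  "W_norm a q \<Omega> w =
     (LINT z:\<Omega>|lebesgue. \<bar>dt w z\<bar>)
     + sqrt (LINT z:\<Omega>|lebesgue. grad_form a w w z)
     + (LINT z:\<Omega>|lebesgue. \<bar>w z\<bar> powr qhat q) powr (1 / qhat q)"

definition W_Cauchy ::
    "('n::finite \<Rightarrow> 'n \<Rightarrow> 'n spacetime \<Rightarrow> real) \<Rightarrow> real \<Rightarrow> 'n spacetime set
      \<Rightarrow> (nat \<Rightarrow> 'n spacetime \<Rightarrow> real) set" where
  "W_Cauchy a q \<Omega> = {w. (\<forall>k. w k \<in> W_smooth a q \<Omega>) \<and>
     (\<forall>\<epsilon>>0. \<exists>N. \<forall>k\<ge>N. \<forall>m\<ge>N. W_norm a q \<Omega> (\<lambda>z. w k z - w m z) < \<epsilon>)}"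

definition W_equiv ::
    "('n::finite \<Rightarrow> 'n \<Rightarrow> 'n spacetime \<Rightarrow> real) \<Rightarrow> real \<Rightarrow> 'n spacetime set
      \<Rightarrow> ((nat \<Rightarrow> 'n spacetime \<Rightarrow> real) \<times> (nat \<Rightarrow> 'n spacetime \<Rightarrow> real)) set" where
  "W_equiv a q \<Omega> = {(v, w). v \<in> W_Cauchy a q \<Omega> \<and> w \<in> W_Cauchy a q \<Omega> \<and>
     (\<lambda>k. W_norm a q \<Omega> (\<lambda>z. v k z - w k z)) \<longlonglongrightarrow> 0}"

text \<open>The completion: its elements are equivalence classes of Cauchy sequences. Since \<open>a\<close> may
  degenerate, an element need not be determined by the function it represents.\<close>

definition W_space ::
    "('n::finite \<Rightarrow> 'n \<Rightarrow> 'n spacetime \<Rightarrow> real) \<Rightarrow> real \<Rightarrow> 'n spacetime set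
      \<Rightarrow> (nat \<Rightarrow> 'n spacetime \<Rightarrow> real) set set" where
  "W_space a q \<Omega> = W_Cauchy a q \<Omega> // W_equiv a q \<Omega>"

text \<open>\<open>W_function q \<Omega> X u\<close>: the function \<open>u\<close> is the limit in \<open>L\<close> to the power \<open>qhat q\<close> on \<open>\<Omega>\<close> of the
  sequences in the class \<open>X\<close>. Similarly \<open>W_dt \<Omega> X g\<close>: \<open>g\<close> is the \<open>L\<^sup>1\<close> limit of their time
  derivatives.\<close>

definition W_function ::
    "real \<Rightarrow> ('n::finite) spacetime set \<Rightarrow> (nat \<Rightarrow> 'n spacetime \<Rightarrow> real) set
      \<Rightarrow> ('n spacetime \<Rightarrow> real) \<Rightarrow> bool" where
  "W_function q \<Omega> X u \<longleftrightarrow>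
     set_integrable lebesgue \<Omega> (\<lambda>z. \<bar>u z\<bar> powr qhat q) \<and>
     (\<forall>w\<in>X. (\<lambda>k. LINT z:\<Omega>|lebesgue. \<bar>w k z - u z\<bar> powr qhat q) \<longlonglongrightarrow> 0)"

definition W_dt ::
    "('n::finite) spacetime set \<Rightarrow> (nat \<Rightarrow> 'n spacetime \<Rightarrow> real) set \<Rightarrow> ('n spacetime \<Rightarrow> real) \<Rightarrow> bool"
  where
  "W_dt \<Omega> X g \<longleftrightarrow>
     set_integrable lebesgue \<Omega> g \<and>
     (\<forall>w\<in>X. (\<lambda>k. LINT z:\<Omega>|lebesgue. \<bar>dt (w k) z - g z\<bar>) \<longlonglongrightarrow> 0)"

definition W_flux ::
    "('n::finite \<Rightarrow> 'n \<Rightarrow> 'n spacetime \<Rightarrow> real) \<Rightarrow> 'n spacetime set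
      \<Rightarrow> (nat \<Rightarrow> 'n spacetime \<Rightarrow> real) set \<Rightarrow> ('n spacetime \<Rightarrow> real) \<Rightarrow> real \<Rightarrow> bool" where
  "W_flux a \<Omega> X \<phi> l \<longleftrightarrow>
     (\<forall>w\<in>X. (\<lambda>k. LINT z:\<Omega>|lebesgue. grad_form a \<phi> (w k) z) \<longlonglongrightarrow> l)"

text \<open>A function belongs to the local space if it is represented by an element of \<open>W_space a q \<Omega>\<close>
  for every bounded domain \<open>\<Omega>\<close>; the family \<open>X\<close> records these elements, so that the
  time derivative and the gradient term make sense. The elements for different domains are not
  required to be restrictions of each other.\<close>

definition W_loc_by ::
    "('n::finite \<Rightarrow> 'n \<Rightarrow> 'n spacetime \<Rightarrow> real) \<Rightarrow> real
      \<Rightarrow> ('n spacetime set \<Rightarrow> (nat \<Rightarrow> 'n spacetime \<Rightarrow> real) set) \<Rightarrow> ('n spacetime \<Rightarrow> real) \<Rightarrow> bool" where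
  "W_loc_by a q X u \<longleftrightarrow>
     (\<forall>\<Omega>. domain_set \<Omega> \<and> bounded \<Omega> \<longrightarrow> X \<Omega> \<in> W_space a q \<Omega> \<and> W_function q \<Omega> (X \<Omega>) u)"

definition test_function :: "(('n::finite) spacetime \<Rightarrow> real) \<Rightarrow> bool" where
  "test_function \<phi> \<longleftrightarrow> Cinf_on UNIV \<phi> \<and> (\<forall>z. 0 \<le> \<phi> z) \<and> compact (closure {z. \<phi> z \<noteq> 0})"

text \<open>\<open>weak_integral a q \<Omega> X u \<phi> I\<close>: the integral in the weak form of the inequality, tested with
  \<open>\<phi>\<close> supported in \<open>\<Omega>\<close> and evaluated along the element \<open>X\<close> representing \<open>u\<close>, has the value \<open>I\<close>.\<close>

definition weak_integral ::
    "('n::finite \<Rightarrow> 'n \<Rightarrow> 'n spacetime \<Rightarrow> real) \<Rightarrow> real \<Rightarrow> 'n spacetime set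
      \<Rightarrow> (nat \<Rightarrow> 'n spacetime \<Rightarrow> real) set \<Rightarrow> ('n spacetime \<Rightarrow> real) \<Rightarrow> ('n spacetime \<Rightarrow> real)
      \<Rightarrow> real \<Rightarrow> bool" where
  "weak_integral a q \<Omega> X u \<phi> I \<longleftrightarrow>
     (\<exists>g l. W_dt \<Omega> X g \<and> W_flux a \<Omega> X \<phi> l \<and>
        I = (LINT z:\<Omega>|lebesgue. g z * \<phi> z) + l
            - (LINT z:\<Omega>|lebesgue. \<bar>u z\<bar> powr (q - 1) * u z * \<phi> z))"

definition weak_supersolution ::
    "('n::finite \<Rightarrow> 'n \<Rightarrow> 'n spacetime \<Rightarrow> real) \<Rightarrow> real \<Rightarrow> ('n spacetime \<Rightarrow> real) \<Rightarrow> bool" where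
  "weak_supersolution a q u \<longleftrightarrow>
     u \<in> borel_measurable lebesgue \<and>
     (\<exists>X. W_loc_by a q X u \<and>
       (\<forall>\<phi> \<Omega>. test_function \<phi> \<and> domain_set \<Omega> \<and> bounded \<Omega> \<and> closure {z. \<phi> z \<noteq> 0} \<subseteq> \<Omega> \<longrightarrow>
         (\<exists>I. weak_integral a q \<Omega> (X \<Omega>) u \<phi> I \<and> I \<ge> 0)))"

definition weak_subsolution ::
    "('n::finite \<Rightarrow> 'n \<Rightarrow> 'n spacetime \<Rightarrow> real) \<Rightarrow> real \<Rightarrow> ('n spacetime \<Rightarrow> real) \<Rightarrow> bool" where
  "weak_subsolution a q v \<longleftrightarrow>
     v \<in> borel_measurable lebesgue \<and>
     (\<exists>X. W_loc_by a q X v \<and>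
       (\<forall>\<phi> \<Omega>. test_function \<phi> \<and> domain_set \<Omega> \<and> bounded \<Omega> \<and> closure {z. \<phi> z \<noteq> 0} \<subseteq> \<Omega> \<longrightarrow>
         (\<exists>I. weak_integral a q \<Omega> (X \<Omega>) v \<phi> I \<and> I \<le> 0)))"

definition ess_bound :: "(('n::finite) spacetime \<Rightarrow> real) \<Rightarrow> real \<Rightarrow> ereal" where
  "ess_bound A R =
     esssup (restrict_space lebesgue (UNIV \<times> {x. R / 2 < norm x \<and> norm x < R})) (\<lambda>z. ereal (A z))"

end

theory Submission
  imports Defs
begin

text \<open>
  Put \<open>w = u - v\<close>, which is nonnegative. Since \<open>\<bar>u\<bar>\<^bsup>q-1\<^esup>u - \<bar>v\<bar>\<^bsup>q-1\<^esup>v \<ge> 2\<^bsup>-q\<^esup> w\<^sup>q\<close> (\<open>source_diff_ge\<close>), \<open>w\<close> satisfies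
  formally \<open>w\<^sub>t \<ge> L w + 2\<^bsup>-q\<^esup> w\<^sup>q\<close> on all of space-time, and up to a critical exponent of Fujita type such a \<open>w\<close> must
  vanish. The operator may degenerate and its coefficients are only measurable, so that no fundamental
  solution and no second integration by parts is at hand; everything comes from one family of test functions.

  Let \<open>\<zeta>\<close> be a cutoff and \<open>h\<close> a smooth decreasing function with values between 1 and 2. The test function
  \<open>h(w/\<omega>) \<zeta>\<^sup>s\<close> leaves on the good side both \<open>\<integral> w\<^sup>q \<zeta>\<^sup>s\<close> and the energy of \<open>w\<close> with weight \<open>- h'(w/\<omega>) \<zeta>\<^sup>s / \<omega>\<close>. The
  energy absorbs the product of the gradients of \<open>w\<close> and \<open>\<zeta>\<close>, and only \<open>h\<^sup>2 / \<bar>h'\<bar>\<close> times the form at the gradient of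
  \<open>\<zeta>\<close> remains (\<open>damped_form_le\<close>). Now \<open>h\<close> can be chosen with \<open>\<bar>h'\<bar>\<close> decaying like \<open>\<bar>y\<bar>\<^bsup>-p\<^esup>\<close> for a given \<open>p > 1\<close>
  (\<open>exists_slowly_decreasing_weight\<close>), and with \<open>p < q\<close> the remainder is of lower order than the source term. The functions \<open>u\<close>
  and \<open>v\<close> are only represented by elements of a completion. Therefore \<open>w\<close> in the test function is the difference of two
  smooth approximations; the test functions so obtained have bounded energy, and this is enough to replace the
  solution in the weak inequality by its approximation with a small error (\<open>weak_lhs_limit_error\<close>). The outcome is
  \<open>comparison_inequality\<close>.

  Take for \<open>\<zeta>\<close> a cutoff that is 1 for \<open>\<bar>t\<bar> \<le> R\<^sup>\<alpha>\<close>, \<open>\<bar>x\<bar> \<le> R/2\<close> and 0 for \<open>\<bar>t\<bar> \<ge> 2 R\<^sup>\<alpha>\<close> or \<open>\<bar>x\<bar> \<ge> R\<close>. The growth condition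
  on the coefficients makes derivatives in time and in space equally expensive, and \<open>cylinder_estimate\<close> states
  that \<open>\<integral> w\<^sup>q \<zeta>\<^sup>s \<le> E R\<^bsup>-\<alpha>\<^esup> \<omega> \<integral> (1 + (w/\<omega>)\<^sup>p) \<zeta>\<^bsup>s-2\<^esup>\<close>, where the integral on the right extends over the region in which \<open>\<zeta>\<close>
  varies. The parameter \<open>\<omega>\<close> is still free. Let \<open>W = R\<^bsup>-\<alpha>/(q-1)\<^esup>\<close>, so that \<open>R\<^bsup>-\<alpha>\<^esup> W = W\<^sup>q\<close>; the condition \<open>q \<le> 1 + \<alpha>/n\<close>
  says that \<open>W\<^sup>q\<close> times the volume \<open>R\<^bsup>\<alpha>+n\<^esup>\<close> is bounded. With \<open>\<omega> = W\<close>, absorbing the power \<open>p\<close> by Young's inequality gives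
  a bound for \<open>\<integral> w\<^sup>q \<zeta>\<^sup>s\<close> that does not depend on \<open>R\<close>, hence \<open>w\<^sup>q\<close> is integrable. With \<open>\<omega> = \<eta> W\<close> the right-hand side is
  at most a constant times \<open>\<eta>\<close>, plus a constant depending on \<open>\<eta>\<close> times the integral of \<open>w\<^sup>q\<close> over the region where
  \<open>\<zeta>\<close> varies. The latter tends to 0 as \<open>R\<close> grows, by integrability; as \<open>\<eta>\<close> is arbitrary, \<open>w\<^sup>q\<close> has integral 0
  (\<open>scale_estimates_imp_zero\<close>).
\<close>

section \<open>Calculus of smooth functions\<close>

lemma Ck_on_cong:
  assumes "open S" "\<And>z. z \<in> S \<Longrightarrow> f z = g z" "Ck_on k S f"
  shows "Ck_on k S g"
  using assms(2,3)
proof (induction k arbitrary: f g)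
  case 0
  then show ?case by (simp cong: continuous_on_cong)
next
  case (Suc k)
  have ev: "\<forall>\<^sub>F x in nhds z. f x = g x" if "z \<in> S" for z
    using Suc.prems(1) \<open>open S\<close> that eventually_nhds by blast
  have der: "(g has_derivative frechet_derivative f (at z)) (at z)" if "z \<in> S" for z
  proof -
    have "(f has_derivative frechet_derivative f (at z)) (at z)"
      using Suc.prems(2) that frechet_derivative_works by auto
    then show ?thesis
      using has_derivative_transform_within_open[OF _ \<open>open S\<close> that] Suc.prems(1) by blast
  qed
  then have eq: "frechet_derivative g (at z) = frechet_derivative f (at z)" if "z \<in> S" for z
    using frechet_derivative_at that by metis
  show ?case
    using der eq Suc.prems(2) Suc.IH[of "\<lambda>z. frechet_derivative f (at z) b" "\<lambda>z. frechet_derivative g (at z) b" for b]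
    by (auto simp: differentiable_def)
qed

text \<open>Every closure property below is an induction on \<open>k\<close> whose step needs a formula for the derivative;
  this rule accepts any such formula in place of \<open>frechet_derivative\<close>.\<close>

lemma Ck_on_SucI:
  assumes "open S" "\<And>z. z \<in> S \<Longrightarrow> (f has_derivative f' z) (at z)"
    "\<And>b. b \<in> Basis \<Longrightarrow> Ck_on k S (\<lambda>z. f' z b)"
  shows "Ck_on (Suc k) S f"
proof -
  have "frechet_derivative f (at z) = f' z" if "z \<in> S" for z
    using assms(2)[OF that] frechet_derivative_at by metis
  then show ?thesis
    using assms(2,3) Ck_on_cong[OF assms(1), of "\<lambda>z. f' z b" "\<lambda>z. frechet_derivative f (at z) b" k for b]
    by (auto simp: differentiable_def)
qed

lemma Ck_on_SucD_has_derivative: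
  assumes "Ck_on (Suc k) S f" "z \<in> S"
  shows "(f has_derivative frechet_derivative f (at z)) (at z)"
  using assms frechet_derivative_works by auto

lemma Ck_on_mono: "Ck_on k S f \<Longrightarrow> T \<subseteq> S \<Longrightarrow> Ck_on k T f"
  by (induction k arbitrary: f) (auto intro: continuous_on_subset)

text \<open>The hypothesis of order \<open>k + 1\<close> speaks only of the first derivatives, so that order \<open>k\<close> for the
  function itself has to come from an induction in which differentiability supplies the case of order 0.\<close>

lemma Ck_on_Suc_imp: "Ck_on (Suc k) S f \<Longrightarrow> Ck_on k S f"
proof (induction k arbitrary: f)
  case 0
  then show ?case
    by (auto intro!: continuous_at_imp_continuous_on differentiable_imp_continuous_within)
next
  case (Suc k)
  then show ?case unfolding Ck_on.simps(2)[of _ S f] by blast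
qed

lemma Ck_on_Un:
  assumes "open S" "open T" "Ck_on k S f" "Ck_on k T f"
  shows "Ck_on k (S \<union> T) f"
  using assms(3,4) by (induction k arbitrary: f) (auto intro: continuous_on_open_Un assms)

lemma Ck_on_const: "Ck_on k S (\<lambda>z. c)"
  by (induction k arbitrary: c) auto

lemma Ck_on_bounded_linear:
  assumes "open S" "bounded_linear f"
  shows "Ck_on k S f"
proof (cases k)
  case 0
  then show ?thesis using assms linear_continuous_on by auto
next
  case (Suc j)
  show ?thesis unfolding Suc
    by (rule Ck_on_SucI[where f' = "\<lambda>_. f"])
       (auto intro: assms bounded_linear_imp_has_derivative Ck_on_const)
qed

lemma Ck_on_SucD: "Ck_on (Suc k) S f \<Longrightarrow> b \<in> Basis \<Longrightarrow> Ck_on k S (\<lambda>z. frechet_derivative f (at z) b)"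
  by simp

lemma Ck_on_add:
  assumes "open S" "Ck_on k S f" "Ck_on k S g"
  shows "Ck_on k S (\<lambda>z. f z + g z)"
  using assms(2,3)
proof (induction k arbitrary: f g)
  case 0
  then show ?case by (auto intro: continuous_intros)
next
  case (Suc k)
  note f = Suc.prems(1) and g = Suc.prems(2)
  show ?case
  proof (rule Ck_on_SucI[OF assms(1)])
    show "((\<lambda>z. f z + g z) has_derivative
        (\<lambda>b. frechet_derivative f (at z) b + frechet_derivative g (at z) b)) (at z)" if "z \<in> S" for z
      by (rule has_derivative_add[OF Ck_on_SucD_has_derivative[OF f that] Ck_on_SucD_has_derivative[OF g that]])
    show "Ck_on k S (\<lambda>z. frechet_derivative f (at z) b + frechet_derivative g (at z) b)"
      if "b \<in> Basis" for b
      by (rule Suc.IH[OF Ck_on_SucD[OF f that] Ck_on_SucD[OF g that]])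
  qed
qed

lemma Ck_on_mult:
  assumes "open S" "Ck_on k S f" "Ck_on k S g"
  shows "Ck_on k S (\<lambda>z. f z * g z)"
  using assms(2,3)
proof (induction k arbitrary: f g)
  case 0
  then show ?case by (auto intro: continuous_intros)
next
  case (Suc k)
  note f = Suc.prems(1) and g = Suc.prems(2)
  show ?case
  proof (rule Ck_on_SucI[OF assms(1)])
    show "((\<lambda>z. f z * g z) has_derivative
        (\<lambda>b. f z * frechet_derivative g (at z) b + frechet_derivative f (at z) b * g z)) (at z)"
      if "z \<in> S" for z
      using has_derivative_mult[OF Ck_on_SucD_has_derivative[OF f that] Ck_on_SucD_has_derivative[OF g that]]
      by simp
    show "Ck_on k S (\<lambda>z. f z * frechet_derivative g (at z) b + frechet_derivative f (at z) b * g z)"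
      if "b \<in> Basis" for b
      by (rule Ck_on_add[OF assms(1) Suc.IH[OF Ck_on_Suc_imp[OF f] Ck_on_SucD[OF g that]]
            Suc.IH[OF Ck_on_SucD[OF f that] Ck_on_Suc_imp[OF g]]])
  qed
qed

lemma Ck_on_compose:
  fixes g :: "real \<Rightarrow> real"
  assumes "open S" "open T" "f ` S \<subseteq> T" "Ck_on k T g" "Ck_on k S f"
  shows "Ck_on k S (\<lambda>z. g (f z))"
  using assms(3-5)
proof (induction k arbitrary: g)
  case 0
  then show ?case using continuous_on_compose2[of T g S f] by simp
next
  case (Suc k)
  note g = Suc.prems(2) and f = Suc.prems(3)
  show ?case
  proof (rule Ck_on_SucI[OF assms(1)])
    show "((\<lambda>z. g (f z)) has_derivative
        (\<lambda>b. frechet_derivative g (at (f z)) 1 * frechet_derivative f (at z) b)) (at z)"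
      if "z \<in> S" for z
    proof -
      have "f z \<in> T" using that assms(3) by auto
      note dg = Ck_on_SucD_has_derivative[OF g this]
      have "frechet_derivative g (at (f z)) y = frechet_derivative g (at (f z)) 1 * y" for y
        using linear_scale[OF has_derivative_linear[OF dg], of y 1] by simp
      then have "frechet_derivative g (at (f z)) \<circ> frechet_derivative f (at z) =
          (\<lambda>b. frechet_derivative g (at (f z)) 1 * frechet_derivative f (at z) b)"
        unfolding o_def by (intro ext)
      from diff_chain_at[OF Ck_on_SucD_has_derivative[OF f that] dg, unfolded this]
      show ?thesis unfolding o_def .
    qed
    show "Ck_on k S (\<lambda>z. frechet_derivative g (at (f z)) 1 * frechet_derivative f (at z) b)"
      if "b \<in> Basis" for b
    proof (rule Ck_on_mult[OF assms(1)])
      show "Ck_on k S (\<lambda>z. frechet_derivative g (at (f z)) 1)"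
        by (rule Suc.IH[OF assms(3) Ck_on_SucD[OF g] Ck_on_Suc_imp[OF f]]) simp
      show "Ck_on k S (\<lambda>z. frechet_derivative f (at z) b)"
        by (rule Ck_on_SucD[OF f that])
    qed
  qed
qed

lemma Cinf_on_antiderivative:
  fixes f :: "real \<Rightarrow> real"
  assumes "open S" "\<And>x. x \<in> S \<Longrightarrow> (f has_real_derivative f' x) (at x)" "Cinf_on S f'"
  shows "Cinf_on S f"
proof -
  have "Ck_on (Suc k) S f" for k
  proof (rule Ck_on_SucI[OF assms(1)])
    show "(f has_derivative (*) (f' x)) (at x)" if "x \<in> S" for x
      using assms(2)[OF that] by (simp add: has_field_derivative_def)
    show "Ck_on k S (\<lambda>x. f' x * b)" for b :: real
      using assms by (auto simp: Cinf_on_def intro!: Ck_on_mult Ck_on_const)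
  qed
  then show ?thesis
    using Ck_on_Suc_imp unfolding Cinf_on_def by blast
qed

lemma Cinf_on_cong: "open S \<Longrightarrow> (\<And>z. z \<in> S \<Longrightarrow> f z = g z) \<Longrightarrow> Cinf_on S f \<Longrightarrow> Cinf_on S g"
  unfolding Cinf_on_def using Ck_on_cong by blast

lemma Cinf_on_mono: "Cinf_on S f \<Longrightarrow> T \<subseteq> S \<Longrightarrow> Cinf_on T f"
  unfolding Cinf_on_def using Ck_on_mono by blast

lemma Cinf_on_Un: "open S \<Longrightarrow> open T \<Longrightarrow> Cinf_on S f \<Longrightarrow> Cinf_on T f \<Longrightarrow> Cinf_on (S \<union> T) f"
  unfolding Cinf_on_def using Ck_on_Un by blast

lemma Cinf_on_const: "Cinf_on S (\<lambda>z. c)"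
  unfolding Cinf_on_def using Ck_on_const by blast

lemma Cinf_on_bounded_linear: "open S \<Longrightarrow> bounded_linear f \<Longrightarrow> Cinf_on S f"
  unfolding Cinf_on_def using Ck_on_bounded_linear by blast

lemma Cinf_on_add: "open S \<Longrightarrow> Cinf_on S f \<Longrightarrow> Cinf_on S g \<Longrightarrow> Cinf_on S (\<lambda>z. f z + g z)"
  unfolding Cinf_on_def using Ck_on_add by blast

lemma Cinf_on_mult: "open S \<Longrightarrow> Cinf_on S f \<Longrightarrow> Cinf_on S g \<Longrightarrow> Cinf_on S (\<lambda>z. f z * g z)"
  unfolding Cinf_on_def using Ck_on_mult by blast

lemma Cinf_on_diff:
  assumes "open S" "Cinf_on S f" "Cinf_on S g" shows "Cinf_on S (\<lambda>z. f z - g z)"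
  using Cinf_on_add[OF assms(1,2) Cinf_on_mult[OF assms(1) Cinf_on_const[of _ "-1"] assms(3)]] by simp

lemma Cinf_on_power: "open S \<Longrightarrow> Cinf_on S f \<Longrightarrow> Cinf_on S (\<lambda>z. f z ^ m)"
  by (induction m) (auto intro: Cinf_on_const Cinf_on_mult)

lemma Cinf_on_sum: "open S \<Longrightarrow> (\<And>i. i \<in> I \<Longrightarrow> Cinf_on S (f i)) \<Longrightarrow> Cinf_on S (\<lambda>z. \<Sum>i\<in>I. f i z)"
  by (induction I rule: infinite_finite_induct) (auto intro: Cinf_on_const Cinf_on_add)

lemma Cinf_on_compose:
  fixes g :: "real \<Rightarrow> real"
  shows "open S \<Longrightarrow> open T \<Longrightarrow> f ` S \<subseteq> T \<Longrightarrow> Cinf_on T g \<Longrightarrow> Cinf_on S f \<Longrightarrow> Cinf_on S (\<lambda>z. g (f z))"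
  unfolding Cinf_on_def using Ck_on_compose by blast

lemma Cinf_on_has_derivative:
  assumes "Cinf_on S f" "z \<in> S"
  shows "(f has_derivative frechet_derivative f (at z)) (at z)"
  using assms Ck_on_SucD_has_derivative unfolding Cinf_on_def by blast

lemma Cinf_on_continuous: "Cinf_on S f \<Longrightarrow> continuous_on S f"
  unfolding Cinf_on_def using Ck_on.simps(1) by blast

lemma Cinf_on_continuous_derivative:
  assumes "Cinf_on S f"
  shows "continuous_on S (\<lambda>z. frechet_derivative f (at z) b)"
proof -
  have c: "continuous_on S (\<lambda>z. frechet_derivative f (at z) i)" if "i \<in> Basis" for i
    using Ck_on_SucD[of 0 S f i] assms that by (simp add: Cinf_on_def del: Ck_on.simps(2))
  have "frechet_derivative f (at z) b = (\<Sum>i\<in>Basis. (b \<bullet> i) * frechet_derivative f (at z) i)" if "z \<in> S" for z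
  proof -
    have "linear (frechet_derivative f (at z))"
      using has_derivative_linear[OF Cinf_on_has_derivative[OF assms that]] .
    then have "frechet_derivative f (at z) (\<Sum>i\<in>Basis. (b \<bullet> i) *\<^sub>R i) = (\<Sum>i\<in>Basis. (b \<bullet> i) * frechet_derivative f (at z) i)"
      by (simp add: linear_sum linear_scale)
    then show ?thesis by (simp add: euclidean_representation)
  qed
  then have "continuous_on S (\<lambda>z. frechet_derivative f (at z) b) \<longleftrightarrow>
     continuous_on S (\<lambda>z. \<Sum>i\<in>Basis. (b \<bullet> i) * frechet_derivative f (at z) i)"
    by (intro continuous_on_cong) auto
  then show ?thesis by (auto intro!: continuous_intros c)
qed

lemma Cinf_on_powr: "Cinf_on {0<..} (\<lambda>x. x powr r)"
proof -
  have "Ck_on k {0<..} (\<lambda>x. x powr r)" for k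
  proof (induction k arbitrary: r)
    case 0
    then show ?case by (auto intro!: continuous_intros)
  next
    case (Suc k)
    show ?case
    proof (rule Ck_on_SucI[where f' = "\<lambda>x b. (r * x powr (r - 1)) * b"])
      show "((\<lambda>x. x powr r) has_derivative (\<lambda>b. r * x powr (r - 1) * b)) (at x)" if "x \<in> {0<..}" for x :: real
        using has_real_derivative_powr[of x r] that by (auto simp: has_field_derivative_def)
    qed (auto intro!: Ck_on_mult Ck_on_const Suc)
  qed
  then show ?thesis by (simp add: Cinf_on_def)
qed

lemma Cinf_on_powr_compose:
  assumes "open S" "Cinf_on S f" "\<And>z. z \<in> S \<Longrightarrow> 0 < f z"
  shows "Cinf_on S (\<lambda>z. f z powr r)"
  by (rule Cinf_on_compose[OF assms(1) _ _ Cinf_on_powr assms(2)]) (use assms in auto)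

lemma Cinf_on_inverse:
  fixes f :: "_ \<Rightarrow> real"
  assumes "open S" "Cinf_on S f" "\<And>z. z \<in> S \<Longrightarrow> 0 < f z"
  shows "Cinf_on S (\<lambda>z. inverse (f z))"
  by (rule Cinf_on_cong[OF assms(1) _ Cinf_on_powr_compose[OF assms, of "-1"]])
     (use assms in \<open>auto simp: powr_minus less_imp_le powr_one\<close>)

section \<open>A slowly decreasing weight and a smooth step\<close>

lemma powr_one_plus_le:
  fixes x p :: real
  assumes "0 \<le> x" "0 \<le> p"
  shows "(1 + x) powr p \<le> 2 powr p * (1 + x powr p)"
proof -
  have "(1 + x) powr p \<le> (2 * max 1 x) powr p"
    using assms by (intro powr_mono2) auto
  also have "\<dots> = 2 powr p * max 1 x powr p"
    using assms by (simp add: powr_mult)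
  also have "max 1 x powr p \<le> 1 + x powr p"
    by (simp add: max_def)
  finally show ?thesis by simp
qed

lemma exists_antiderivative_with_bound:
  fixes h :: "real \<Rightarrow> real"
  assumes "continuous_on UNIV h" "\<And>y. \<bar>h y\<bar> \<le> B"
  obtains H where "\<And>y. (H has_real_derivative h y) (at y)" "\<And>y. \<bar>H y\<bar> \<le> B * \<bar>y\<bar>"
proof -
  obtain F where F: "\<And>x. (F has_vector_derivative h x) (at x)"
    using einterval_antiderivative[of "-\<infinity>" \<infinity> h] assms(1)
    by (auto simp: continuous_on_eq_continuous_at)
  then have dF: "(F has_real_derivative h x) (at x)" for x
    by (simp add: has_real_derivative_iff_has_vector_derivative)
  define H where "H = (\<lambda>y. F y - F 0)"
  have dH: "(H has_real_derivative h y) (at y)" for y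
    unfolding H_def using DERIV_diff[OF dF DERIV_const] by simp
  moreover have "\<bar>H y\<bar> \<le> B * \<bar>y\<bar>" for y
  proof -
    have "norm (H y - H 0) \<le> B * norm (y - 0)"
      by (rule field_differentiable_bound[where S = UNIV and f' = h])
         (use dH assms(2) in \<open>auto intro: has_field_derivative_at_within\<close>)
    then show ?thesis by (simp add: H_def)
  qed
  ultimately show ?thesis using that by blast
qed

text \<open>The function of the solution that multiplies the cutoff in the test functions. The energy that it
  produces is weighted by \<open>k = - h'\<close>, and the price of absorbing the cross term with it is \<open>h\<^sup>2 / k\<close>. As \<open>h\<close>
  stays between two positive constants, \<open>k\<close> is integrable over the line, and \<open>\<bar>y\<bar> powr (- p)\<close> with \<open>p\<close> slightly
  above 1 is about the slowest decay that this permits; the price is then of order \<open>p\<close>, below the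
  power of the source term. The choice is \<open>h = 1 + 1 / (1 + E)\<close> with \<open>E = (y + sqrt (1 + y\<^sup>2)) powr (p - 1)\<close>:
  the base satisfies \<open>b' = b / sqrt (1 + y\<^sup>2)\<close>, and \<open>1 / b\<close> is the same function at \<open>- y\<close>, so that both tails
  decay at the same rate. The antiderivative \<open>H\<close> turns the time derivative into a total derivative.\<close>

lemma exists_slowly_decreasing_weight:
  fixes p :: real
  assumes "1 < p"
  obtains h k H :: "real \<Rightarrow> real" and K C :: real
  where "Cinf_on UNIV h" "\<And>y. (h has_real_derivative - k y) (at y)"
    "\<And>y. 1 \<le> h y" "\<And>y. h y \<le> 2" "\<And>y. 0 < k y" "\<And>y. k y \<le> K" "0 < C"
    "\<And>y. (h y)\<^sup>2 \<le> C * (1 + \<bar>y\<bar> powr p) * k y"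
    "\<And>y. (H has_real_derivative h y) (at y)" "\<And>y. \<bar>H y\<bar> \<le> 2 * \<bar>y\<bar>"
proof -
  define d where "d = p - 1"
  have d: "d > 0" using assms by (simp add: d_def)
  define S where "S = (\<lambda>y::real. (1 + y\<^sup>2) powr (1/2))"
  define b where "b = (\<lambda>y. y + S y)"
  define E where "E = (\<lambda>y. b y powr d)"
  define h where "h = (\<lambda>y. 1 + inverse (1 + E y))"
  define k where "k = (\<lambda>y. d * E y / ((1 + E y)\<^sup>2 * S y))"
  have pos1: "0 < 1 + y\<^sup>2" for y :: real by (simp add: add_pos_nonneg)
  have S_sqrt: "S y = sqrt (1 + y\<^sup>2)" for y
    unfolding S_def using powr_half_sqrt[of "1 + y\<^sup>2"] by simp
  have S1: "S y \<ge> 1" for y unfolding S_sqrt by simp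
  have Sabs: "\<bar>y\<bar> < S y" for y
    unfolding S_sqrt by (rule real_less_rsqrt) simp
  have Ssq: "S y * S y = 1 + y\<^sup>2" for y
    unfolding S_sqrt using pos1[of y] by simp
  have Sle: "S y \<le> 1 + \<bar>y\<bar>" for y
    unfolding S_sqrt by (rule real_le_lsqrt) (auto simp: power2_eq_square algebra_simps)
  have bpos: "b y > 0" for y using Sabs[of y] unfolding b_def by linarith
  have ble: "b y \<le> 2 * S y" for y using Sabs[of y] unfolding b_def by linarith
  have binv: "inverse (b y) = S y - y" for y
  proof -
    have "b y * (S y - y) = 1"
      using Ssq[of y] unfolding b_def by (simp add: algebra_simps power2_eq_square)
    then show ?thesis by (metis inverse_unique)
  qed
  have binvle: "inverse (b y) \<le> 2 * S y" for y
    using Sabs[of y] unfolding binv by linarith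
  have Epos: "E y > 0" for y unfolding E_def using bpos[of y] by simp
  have cont: "continuous_on UNIV h" and Ch: "Cinf_on UNIV h"
  proof -
    have id: "Cinf_on UNIV (\<lambda>y::real. y)"
      by (rule Cinf_on_bounded_linear) (auto simp: bounded_linear_ident)
    have "Cinf_on UNIV S" unfolding S_def
      by (intro Cinf_on_powr_compose Cinf_on_add Cinf_on_power Cinf_on_const id) (auto simp: pos1)
    then have "Cinf_on UNIV E" unfolding E_def b_def
      using bpos by (intro Cinf_on_powr_compose Cinf_on_add id) (auto simp: b_def)
    then show "Cinf_on UNIV h" unfolding h_def
      by (intro Cinf_on_inverse Cinf_on_add Cinf_on_const) (use Epos in \<open>auto simp: add_pos_pos\<close>)
    then show "continuous_on UNIV h" by (rule Cinf_on_continuous)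
  qed
  have dh: "(h has_real_derivative - k y) (at y)" for y
  proof -
    have "(S has_real_derivative y / S y) (at y)"
      unfolding S_sqrt[abs_def] using pos1[of y]
      by (auto intro!: derivative_eq_intros simp: field_simps)
    then have db: "(b has_real_derivative 1 + y / S y) (at y)"
      unfolding b_def by (auto intro!: derivative_eq_intros)
    have e: "1 + y / S y = b y / S y" using S1[of y] by (simp add: b_def field_simps)
    have dE0: "(E has_real_derivative d * b y powr (d - 1) * (b y / S y)) (at y)"
      unfolding E_def using DERIV_chain2[OF has_real_derivative_powr[OF bpos] db[unfolded e]] .
    have dE: "(E has_real_derivative d * E y / S y) (at y)"
      by (rule DERIV_cong[OF dE0]) (use bpos[of y] in \<open>simp add: E_def powr_diff\<close>)
    have "1 + E y \<noteq> 0" using Epos[of y] by linarith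
    then have "(h has_real_derivative - (inverse (1 + E y) * (d * E y / S y) * inverse (1 + E y))) (at y)"
      unfolding h_def using dE by (auto intro!: derivative_eq_intros)
    then show ?thesis
      by (rule DERIV_cong) (simp add: k_def divide_simps power2_eq_square)
  qed
  have h12: "1 \<le> h y" "h y \<le> 2" for y
    using Epos[of y] by (auto simp: h_def inverse_le_1_iff less_imp_le add_nonneg_nonneg)
  have kpos: "0 < k y" for y
    unfolding k_def using Epos[of y] S1[of y] d by (intro divide_pos_pos mult_pos_pos) (auto simp: zero_less_power)
  have kle: "k y \<le> d" for y
  proof -
    have "E y \<le> (1 + E y)\<^sup>2" using Epos[of y] by (simp add: power2_eq_square algebra_simps)
    also have "\<dots> \<le> (1 + E y)\<^sup>2 * S y" using S1[of y] by (simp add: mult_le_cancel_left1)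
    finally have "d * E y \<le> d * ((1 + E y)\<^sup>2 * S y)" using d by simp
    then show ?thesis unfolding k_def using Epos[of y] S1[of y]
      by (subst pos_divide_le_eq) (auto intro!: mult_pos_pos zero_less_power)
  qed
  define C where "C = 4 * (4 * 2 powr d / d * 2 powr p)"
  have main: "(h y)\<^sup>2 \<le> C * (1 + \<bar>y\<bar> powr p) * k y" for y
  proof -
    have T: "1 \<le> (2 * S y) powr d" using S1[of y] d by (intro ge_one_powr_ge_zero) auto
    have E1: "E y \<le> (2 * S y) powr d"
      unfolding E_def using ble[of y] bpos[of y] d by (intro powr_mono2) auto
    have "inverse (E y) = inverse (b y) powr d"
      unfolding E_def using bpos[of y] by (simp add: inverse_powr)
    also have "\<dots> \<le> (2 * S y) powr d"
      using binvle[of y] bpos[of y] d by (intro powr_mono2) auto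
    finally have E2: "inverse (E y) \<le> (2 * S y) powr d" .
    have "S y powr p \<le> (1 + \<bar>y\<bar>) powr p"
      using Sle[of y] S1[of y] assms by (intro powr_mono2) auto
    also have "\<dots> \<le> 2 powr p * (1 + \<bar>y\<bar> powr p)"
      using assms by (intro powr_one_plus_le) auto
    finally have Sp: "S y powr p \<le> 2 powr p * (1 + \<bar>y\<bar> powr p)" .
    have "1 / k y = (E y + 2 + inverse (E y)) * S y / d"
      unfolding k_def using Epos[of y] S1[of y] d by (simp add: field_simps power2_eq_square)
    also have "\<dots> \<le> (4 * (2 * S y) powr d) * S y / d"
      using E1 E2 T S1[of y] d by (intro divide_right_mono mult_right_mono) auto
    also have "\<dots> = 4 * 2 powr d / d * (S y powr d * S y powr 1)"
      using S1[of y] by (simp add: powr_mult)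
    also have "\<dots> = 4 * 2 powr d / d * S y powr p"
      unfolding powr_add[symmetric] by (simp add: d_def)
    also have "\<dots> \<le> 4 * 2 powr d / d * (2 powr p * (1 + \<bar>y\<bar> powr p))"
      using d Sp by (intro mult_left_mono) auto
    finally have "1 / k y \<le> 4 * 2 powr d / d * (2 powr p * (1 + \<bar>y\<bar> powr p))" .
    then have k1: "1 \<le> 4 * 2 powr d / d * (2 powr p * (1 + \<bar>y\<bar> powr p)) * k y"
      using kpos[of y] by (simp add: divide_le_eq)
    have "(h y)\<^sup>2 \<le> 2\<^sup>2" using h12[of y] by (intro power_mono) auto
    also have "\<dots> \<le> 4 * (4 * 2 powr d / d * (2 powr p * (1 + \<bar>y\<bar> powr p)) * k y)"
      using mult_left_mono[OF k1, of 4] by (simp only: power2_eq_square) simp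
    also have "\<dots> = C * (1 + \<bar>y\<bar> powr p) * k y" by (simp add: C_def)
    finally show ?thesis .
  qed
  have C: "0 < C" using d by (simp add: C_def)
  obtain H where H: "\<And>y. (H has_real_derivative h y) (at y)" "\<And>y. \<bar>H y\<bar> \<le> 2 * \<bar>y\<bar>"
    using exists_antiderivative_with_bound[OF cont, of 2] h12 by (smt (verit, best))
  show ?thesis by (rule that[OF Ch dh h12 kpos kle C main H])
qed

text \<open>The family is closed under differentiation up to linear combinations, so that the smoothness of
  \<open>exp (- 1 / x)\<close> at 0 follows by one induction over all its members.\<close>

definition flat_exp :: "nat \<Rightarrow> real \<Rightarrow> real" where
  "flat_exp j x = (if 0 < x then inverse x ^ j / exp (inverse x) else 0)"

lemma has_derivative_flat_exp:
  "(flat_exp j has_real_derivative flat_exp (j + 2) x - real j * flat_exp (j + 1) x) (at x)"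
proof -
  consider "x > 0" | "x < 0" | "x = 0" by linarith
  then show ?thesis
  proof cases
    case 1
    let ?u = "inverse x"
    have di: "(inverse has_real_derivative - (?u ^ 2)) (at x)"
      using 1 DERIV_inverse[of x UNIV] by (simp add: power2_eq_square)
    have "((\<lambda>u. u ^ j / exp u) has_real_derivative (real j * ?u ^ (j - 1) - ?u ^ j) / exp ?u) (at ?u)"
      by (auto intro!: derivative_eq_intros simp: field_simps)
    from DERIV_chain2[OF this di]
    have "((\<lambda>x. inverse x ^ j / exp (inverse x)) has_real_derivative
        flat_exp (j + 2) x - real j * flat_exp (j + 1) x) (at x)"
      by (rule DERIV_cong)
         (use 1 in \<open>cases j; simp add: flat_exp_def field_simps power2_eq_square\<close>)
    then show ?thesis
      by (rule has_field_derivative_transform_within_open[of _ _ _ "{0<..}"])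
         (use 1 in \<open>auto simp: flat_exp_def\<close>)
  next
    case 2
    have "((\<lambda>x. 0) has_real_derivative flat_exp (j + 2) x - real j * flat_exp (j + 1) x) (at x)"
      using 2 by (simp add: flat_exp_def)
    then show ?thesis
      by (rule has_field_derivative_transform_within_open[of _ _ _ "{..<0}"])
         (use 2 in \<open>auto simp: flat_exp_def\<close>)
  next
    case 3
    have "((\<lambda>y. inverse y ^ Suc j / exp (inverse y)) \<longlongrightarrow> 0) (at_right (0::real))"
      by (rule filterlim_compose[OF tendsto_power_div_exp_0 filterlim_inverse_at_top_right])
    then have r: "((\<lambda>y. (flat_exp j y - flat_exp j 0) / (y - 0)) \<longlongrightarrow> 0) (at_right 0)"
      by (rule Lim_transform_eventually)
         (auto simp: eventually_at_right_less flat_exp_def field_simps intro!: eventually_at_rightI[of 0 1])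
    have l: "((\<lambda>y. (flat_exp j y - flat_exp j 0) / (y - 0)) \<longlongrightarrow> 0) (at_left 0)"
      by (rule Lim_transform_eventually[OF tendsto_const])
         (auto simp: flat_exp_def intro!: eventually_at_leftI[of "-1"])
    show ?thesis
      unfolding 3 has_field_derivative_iff using filterlim_split_at[OF l r]
      by (simp add: flat_exp_def)
  qed
qed

lemma Cinf_on_flat_exp: "Cinf_on UNIV (flat_exp j)"
proof -
  have "Ck_on k UNIV (flat_exp j)" for k
  proof (induction k arbitrary: j)
    case 0
    show ?case
      using DERIV_isCont[OF has_derivative_flat_exp]
      by (simp add: continuous_at_imp_continuous_on)
  next
    case (Suc k)
    show ?case
    proof (rule Ck_on_SucI[where f' = "\<lambda>x b. (flat_exp (j + 2) x + (- real j) * flat_exp (j + 1) x) * b"])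
      show "(flat_exp j has_derivative (\<lambda>b. (flat_exp (j + 2) x + (- real j) * flat_exp (j + 1) x) * b)) (at x)" for x
        using has_derivative_flat_exp[of j x] unfolding has_field_derivative_def by simp
      show "Ck_on k UNIV (\<lambda>x. (flat_exp (j + 2) x + (- real j) * flat_exp (j + 1) x) * b)" for b
        by (intro Ck_on_mult Ck_on_add Ck_on_const Suc) auto
    qed auto
  qed
  then show ?thesis by (simp add: Cinf_on_def)
qed

text \<open>The quotient of \<open>flat_exp 0 x\<close> by \<open>flat_exp 0 x + flat_exp 0 (1 - x)\<close>. The derivative vanishes also at the
  points 0 and 1, because they are extrema; this is why the gradient of the cutoffs below lives in an
  open annulus.\<close>

lemma exists_smooth_step:
  obtains \<theta> \<theta>' :: "real \<Rightarrow> real" and B :: real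
  where "Cinf_on UNIV \<theta>" "\<And>x. (\<theta> has_real_derivative \<theta>' x) (at x)"
    "\<And>x. \<bar>\<theta>' x\<bar> \<le> B" "\<And>x. 0 \<le> \<theta> x" "\<And>x. \<theta> x \<le> 1"
    "\<And>x. x \<le> 0 \<Longrightarrow> \<theta> x = 0" "\<And>x. 1 \<le> x \<Longrightarrow> \<theta> x = 1"
    "\<And>x. x \<le> 0 \<or> 1 \<le> x \<Longrightarrow> \<theta>' x = 0"
proof -
  define D where "D = (\<lambda>x. flat_exp 0 x + flat_exp 0 (1 - x))"
  define \<theta> where "\<theta> = (\<lambda>x. flat_exp 0 x * inverse (D x))"
  define \<theta>' where "\<theta>' = (\<lambda>x. frechet_derivative \<theta> (at x) 1)"
  have nn: "0 \<le> flat_exp 0 x" for x by (simp add: flat_exp_def)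
  have Dpos: "D x > 0" for x
    unfolding D_def flat_exp_def by (auto intro!: add_pos_pos)
  have id: "Cinf_on UNIV (\<lambda>y::real. y)"
    by (rule Cinf_on_bounded_linear) (auto simp: bounded_linear_ident)
  have "Cinf_on UNIV (\<lambda>x. flat_exp 0 (1 - x))"
    by (rule Cinf_on_compose[where T = UNIV and f = "\<lambda>x. 1 - x"])
       (auto intro: Cinf_on_diff Cinf_on_const id Cinf_on_flat_exp)
  then have C: "Cinf_on UNIV \<theta>"
    unfolding \<theta>_def D_def
    by (intro Cinf_on_mult Cinf_on_inverse Cinf_on_add Cinf_on_flat_exp) (use Dpos in \<open>auto simp: D_def\<close>)
  have d: "(\<theta> has_real_derivative \<theta>' x) (at x)" for x
  proof -
    have hd: "(\<theta> has_derivative frechet_derivative \<theta> (at x)) (at x)"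
      by (rule Cinf_on_has_derivative[OF C]) simp
    have "frechet_derivative \<theta> (at x) y = \<theta>' x * y" for y
      unfolding \<theta>'_def using linear_scale[OF has_derivative_linear[OF hd], of y 1] by simp
    then have "frechet_derivative \<theta> (at x) = (*) (\<theta>' x)" by (intro ext)
    from hd[unfolded this] show ?thesis unfolding has_field_derivative_def .
  qed
  have ge0: "0 \<le> \<theta> x" for x
    unfolding \<theta>_def using nn[of x] Dpos[of x] by (intro mult_nonneg_nonneg) auto
  have le1: "\<theta> x \<le> 1" for x
  proof -
    have "flat_exp 0 x \<le> D x" unfolding D_def using nn[of "1 - x"] by linarith
    then show ?thesis unfolding \<theta>_def using Dpos[of x]
      by (simp add: divide_inverse[symmetric])
  qed
  have z: "\<theta> x = 0" if "x \<le> 0" for x using that by (simp add: \<theta>_def flat_exp_def)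
  have o: "\<theta> x = 1" if "1 \<le> x" for x
  proof -
    have "D x = flat_exp 0 x" using that by (simp add: D_def flat_exp_def)
    with Dpos[of x] show ?thesis by (simp add: \<theta>_def)
  qed
  have d0: "\<theta>' x = 0" if "x \<le> 0 \<or> 1 \<le> x" for x
    using that
  proof
    assume "x \<le> 0"
    then show ?thesis
      using DERIV_local_min[OF d, of 1 x] z[of x] ge0 by simp
  next
    assume "1 \<le> x"
    then show ?thesis
      using DERIV_local_max[OF d, of 1 x] o[of x] le1 by simp
  qed
  have "continuous_on {0..1} \<theta>'"
    unfolding \<theta>'_def using continuous_on_subset[OF Cinf_on_continuous_derivative[OF C]] by auto
  then have "bounded (\<theta>' ` {0..1})"
    by (intro compact_imp_bounded compact_continuous_image) auto
  then obtain B where B: "0 < B" "\<And>x. x \<in> {0..1} \<Longrightarrow> \<bar>\<theta>' x\<bar> \<le> B"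
    unfolding bounded_pos by auto
  have "\<bar>\<theta>' x\<bar> \<le> B" for x
    using B d0[of x] by (cases "x \<in> {0..1}") auto
  then show ?thesis using that[OF C d _ ge0 le1 z o d0] by blast
qed

section \<open>Integrals over space-time\<close>

text \<open>Fubini and the fundamental theorem of calculus on each line parallel to the time axis.\<close>

lemma integral_time_derivative_eq_0:
  fixes G g :: "('n::finite) spacetime \<Rightarrow> real"
  assumes der: "\<And>t x. ((\<lambda>t. G (t, x)) has_real_derivative g (t, x)) (at t)"
    and cont: "continuous_on UNIV g"
    and K: "bounded K" "\<And>z. z \<notin> K \<Longrightarrow> G z = 0" "\<And>z. z \<notin> K \<Longrightarrow> g z = 0"
  shows "integrable lebesgue g" "integral\<^sup>L lebesgue g = 0"
proof -
  obtain r where r: "r > 0" "\<And>z. z \<in> K \<Longrightarrow> norm z \<le> r"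
    using K(1) bounded_pos by blast
  have out: "g z = 0" "G z = 0" if "norm z > r" for z
    using r(2)[of z] K(2,3)[of z] that by force+
  have [measurable]: "g \<in> borel_measurable borel"
    using cont by (rule borel_measurable_continuous_onI)
  have "integrable lborel (\<lambda>z. indicator (cball 0 r) z *\<^sub>R g z)"
    using continuous_on_subset[OF cont] by (intro borel_integrable_compact) auto
  also have "(\<lambda>z. indicator (cball 0 r) z *\<^sub>R g z) = g"
    using out by (force simp: indicator_def fun_eq_iff)
  finally have int: "integrable lborel g" .
  then show "integrable lebesgue g" by (simp add: integrable_completion)
  have int2: "integrable (lborel \<Otimes>\<^sub>M lborel) (case_prod (\<lambda>t x. g (t, x)))"
    using int by (simp add: lborel_prod)
  have inner: "(\<integral>t. g (t, x) \<partial>lborel) = 0" for x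
  proof -
    have ge: "norm (t, x) > r" if "\<bar>t\<bar> > r" for t
      using norm_fst_le[of t x] that by simp
    have "(\<integral>t. g (t, x) \<partial>lborel) = (\<integral>t. indicator {-r-1..r+1} t *\<^sub>R g (t, x) \<partial>lborel)"
    proof (intro Bochner_Integration.integral_cong refl)
      show "g (t, x) = indicator {-r-1..r+1} t *\<^sub>R g (t, x)" for t
        using out(1)[OF ge[of t]] by (cases "t \<in> {-r-1..r+1}") auto
    qed
    also have "\<dots> = G (r+1, x) - G (-r-1, x)"
    proof (rule integral_FTC_Icc)
      show "((\<lambda>t. G (t, x)) has_vector_derivative g (t, x)) (at t within {-r-1..r+1})" for t
        using der[of x t]
        by (auto simp: has_real_derivative_iff_has_vector_derivative intro: has_vector_derivative_at_within)
      show "continuous_on {-r-1..r+1} (\<lambda>t. g (t, x))"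
        by (rule continuous_on_compose2[OF cont]) (auto intro!: continuous_intros)
    qed (use r in auto)
    also have "\<dots> = 0" using out(2)[OF ge] r(1) by simp
    finally show ?thesis .
  qed
  have "integral\<^sup>L lebesgue g = integral\<^sup>L lborel g"
    by (simp add: integral_completion)
  also have "\<dots> = integral\<^sup>L (lborel \<Otimes>\<^sub>M lborel) (case_prod (\<lambda>t x. g (t, x)))"
    by (simp add: lborel_prod)
  also have "\<dots> = (\<integral>x. (\<integral>t. g (t, x) \<partial>lborel) \<partial>lborel)"
    using lborel_pair.integral_snd[OF int2] by simp
  also have "\<dots> = 0" by (simp add: inner)
  finally show "integral\<^sup>L lebesgue g = 0" .
qed

lemma open_in_sets_lebesgue: "open \<Omega> \<Longrightarrow> \<Omega> \<in> sets lebesgue"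
  by (simp add: sets_completionI_sets)

lemma set_integrable_lebesgue_on_iff:
  fixes f :: "'a::euclidean_space \<Rightarrow> real"
  shows "open \<Omega> \<Longrightarrow> set_integrable lebesgue \<Omega> f \<longleftrightarrow> integrable (lebesgue_on \<Omega>) f"
  using integrable_restrict_space[of \<Omega> lebesgue f]
  by (simp add: set_integrable_def open_in_sets_lebesgue)

lemma set_integral_lebesgue_on_eq:
  fixes f :: "'a::euclidean_space \<Rightarrow> real"
  shows "open \<Omega> \<Longrightarrow> (LINT z:\<Omega>|lebesgue. f z) = integral\<^sup>L (lebesgue_on \<Omega>) f"
  using integral_restrict_space[of \<Omega> lebesgue f]
  by (simp add: set_lebesgue_integral_def open_in_sets_lebesgue)

lemma finite_measure_lebesgue_on:
  fixes \<Omega> :: "'a::euclidean_space set"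
  assumes "open \<Omega>" "bounded \<Omega>" shows "finite_measure (lebesgue_on \<Omega>)"
proof
  have "\<Omega> \<in> lmeasurable" using assms by (simp add: lmeasurable_open)
  then show "emeasure (lebesgue_on \<Omega>) (space (lebesgue_on \<Omega>)) \<noteq> \<infinity>"
    using assms by (simp add: emeasure_restrict_space fmeasurable_def open_in_sets_lebesgue)
qed

lemma continuous_on_measurable_lebesgue_on:
  fixes f :: "'a::euclidean_space \<Rightarrow> real"
  shows "open \<Omega> \<Longrightarrow> continuous_on \<Omega> f \<Longrightarrow> f \<in> borel_measurable (lebesgue_on \<Omega>)"
  by (intro continuous_imp_measurable_on_sets_lebesgue) (auto simp: open_in_sets_lebesgue)

lemma AE_lebesgue_on:
  "open \<Omega> \<Longrightarrow> AE z in lebesgue. P z \<Longrightarrow> AE z in lebesgue_on \<Omega>. P z"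
  by (subst AE_restrict_space_iff) (auto simp: open_in_sets_lebesgue)

lemma powr_le_eps_plus_powr:
  fixes r q \<epsilon> :: real
  assumes "0 < r" "r \<le> q" "0 < \<epsilon>"
  obtains C where "0 < C" "\<And>x. 0 \<le> x \<Longrightarrow> x powr r \<le> \<epsilon> + C * x powr q"
proof
  show "0 < \<epsilon> powr ((r - q) / r)" using assms by simp
  fix x :: real assume x: "0 \<le> x"
  show "x powr r \<le> \<epsilon> + \<epsilon> powr ((r - q) / r) * x powr q"
  proof (cases "x powr r \<le> \<epsilon>")
    case True
    then show ?thesis by (simp add: add_increasing2)
  next
    case False
    then have "x \<noteq> 0" using assms by auto
    then have xp: "x > 0" using x by simp
    have "x powr (r - q) = (x powr r) powr ((r - q) / r)"
      using assms by (simp add: powr_powr)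
    also have "\<dots> \<le> \<epsilon> powr ((r - q) / r)"
      using False assms by (intro powr_mono2') (auto simp: divide_nonpos_pos)
    finally have "x powr (r - q) * x powr q \<le> \<epsilon> powr ((r - q) / r) * x powr q"
      by (intro mult_right_mono) auto
    then show ?thesis using assms by (simp add: powr_add[symmetric])
  qed
qed

text \<open>Young's inequality in the form that absorbs a sublinear quantity into a small multiple of itself.\<close>

lemma powr_le_eps_times_plus_const:
  fixes r \<epsilon> :: real
  assumes "0 < r" "r < 1" "0 < \<epsilon>"
  obtains C where "0 < C" "\<And>x. 0 \<le> x \<Longrightarrow> x powr r \<le> \<epsilon> * x + C"
proof
  define c where "c = \<epsilon> powr (1 / (r - 1))"
  have c: "c > 0" using assms by (simp add: c_def)
  show "0 < c powr r" using c by simp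
  fix x :: real assume x: "0 \<le> x"
  show "x powr r \<le> \<epsilon> * x + c powr r"
  proof (cases "x \<le> c")
    case True
    then have "x powr r \<le> c powr r" using x assms by (intro powr_mono2) auto
    then show ?thesis using x assms by (simp add: add_increasing)
  next
    case False
    then have "x powr (r - 1) \<le> c powr (r - 1)"
      using c assms by (intro powr_mono2') auto
    also have "\<dots> = \<epsilon>" using assms by (simp add: c_def powr_powr)
    finally have "x powr (r - 1) * x \<le> \<epsilon> * x" using x by (intro mult_right_mono)
    moreover have "x powr (r - 1) * x = x powr r"
      using False c by (simp add: powr_diff)
    ultimately show ?thesis by (smt (verit) powr_ge_zero)
  qed
qed

lemma powr_sum_le:
  fixes x y q :: real
  assumes "0 \<le> q"
  shows "\<bar>x + y\<bar> powr q \<le> 2 powr q * (\<bar>x\<bar> powr q + \<bar>y\<bar> powr q)"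
proof -
  have "\<bar>x + y\<bar> powr q \<le> (2 * max \<bar>x\<bar> \<bar>y\<bar>) powr q"
    using assms by (intro powr_mono2) auto
  also have "\<dots> = 2 powr q * max \<bar>x\<bar> \<bar>y\<bar> powr q"
    by (simp add: powr_mult)
  also have "max \<bar>x\<bar> \<bar>y\<bar> powr q \<le> \<bar>x\<bar> powr q + \<bar>y\<bar> powr q"
    by (simp add: max_def)
  finally show ?thesis by simp
qed

lemma integrable_powr_diff:
  fixes f g :: "'a \<Rightarrow> real"
  assumes "0 \<le> q" "f \<in> borel_measurable M" "g \<in> borel_measurable M"
    "integrable M (\<lambda>z. \<bar>f z\<bar> powr q)" "integrable M (\<lambda>z. \<bar>g z\<bar> powr q)"
  shows "integrable M (\<lambda>z. \<bar>f z - g z\<bar> powr q)"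
proof (rule Bochner_Integration.integrable_bound)
  show "integrable M (\<lambda>z. 2 powr q * (\<bar>f z\<bar> powr q + \<bar>g z\<bar> powr q))"
    using assms by auto
  show "(\<lambda>z. \<bar>f z - g z\<bar> powr q) \<in> borel_measurable M" using assms by measurable
  show "AE z in M. norm (\<bar>f z - g z\<bar> powr q) \<le> norm (2 powr q * (\<bar>f z\<bar> powr q + \<bar>g z\<bar> powr q))"
    using powr_sum_le[of q "f _" "- g _"] assms by auto
qed

lemma integrable_lower_powr:
  fixes f :: "'a \<Rightarrow> real"
  assumes "finite_measure M" "0 < r" "r \<le> q" "f \<in> borel_measurable M"
    "integrable M (\<lambda>z. \<bar>f z\<bar> powr q)"
  shows "integrable M (\<lambda>z. \<bar>f z\<bar> powr r)"
proof -
  interpret finite_measure M by fact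
  obtain C where C: "0 < C" "\<And>x. 0 \<le> x \<Longrightarrow> x powr r \<le> 1 + C * x powr q"
    using powr_le_eps_plus_powr[OF assms(2,3), of 1] by auto
  show ?thesis
  proof (rule Bochner_Integration.integrable_bound)
    show "integrable M (\<lambda>z. 1 + C * \<bar>f z\<bar> powr q)" using assms by auto
    show "AE z in M. norm (\<bar>f z\<bar> powr r) \<le> norm (1 + C * \<bar>f z\<bar> powr q)"
      using C by (auto simp: abs_of_nonneg add_nonneg_nonneg)
  qed (use assms in measurable)
qed

text \<open>The approximations converge in the power \<open>q\<close>, while the errors in the tested inequality are measured
  in the powers 1 and \<open>p\<close>; on a bounded domain the former controls the latter.\<close>

lemma integral_lower_powr_tendsto_0:
  fixes f :: "nat \<Rightarrow> 'a \<Rightarrow> real"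
  assumes M: "finite_measure M" and r: "0 < r" "r \<le> q"
    and meas: "\<And>k. f k \<in> borel_measurable M"
    and int: "\<And>k. integrable M (\<lambda>z. \<bar>f k z\<bar> powr q)"
    and lim: "(\<lambda>k. \<integral>z. \<bar>f k z\<bar> powr q \<partial>M) \<longlonglongrightarrow> 0"
  shows "(\<lambda>k. \<integral>z. \<bar>f k z\<bar> powr r \<partial>M) \<longlonglongrightarrow> 0"
proof (rule LIMSEQ_I)
  interpret finite_measure M by fact
  fix e :: real assume e: "0 < e"
  define m where "m = measure M (space M)"
  have m: "m \<ge> 0" by (simp add: m_def)
  define \<epsilon> where "\<epsilon> = e / (2 * (m + 1))"
  have \<epsilon>: "0 < \<epsilon>" using e m by (simp add: \<epsilon>_def)
  have em: "\<epsilon> * m < e / 2" using e m by (simp add: \<epsilon>_def field_simps)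
  obtain C where C: "0 < C" "\<And>x. 0 \<le> x \<Longrightarrow> x powr r \<le> \<epsilon> + C * x powr q"
    using powr_le_eps_plus_powr[OF r \<epsilon>] by auto
  have "0 < e / 2 / C" using e C by simp
  from LIMSEQ_D[OF lim this] obtain N where
    N: "\<And>k. k \<ge> N \<Longrightarrow> norm ((\<integral>z. \<bar>f k z\<bar> powr q \<partial>M) - 0) < e / 2 / C" by blast
  have "norm ((\<integral>z. \<bar>f k z\<bar> powr r \<partial>M) - 0) < e" if "k \<ge> N" for k
  proof -
    have "(\<integral>z. \<bar>f k z\<bar> powr r \<partial>M) \<le> (\<integral>z. \<epsilon> + C * \<bar>f k z\<bar> powr q \<partial>M)"
      using C int by (intro integral_mono integrable_lower_powr[OF M r meas int]) auto
    also have "\<dots> = \<epsilon> * m + C * (\<integral>z. \<bar>f k z\<bar> powr q \<partial>M)"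
      using int by (simp add: m_def)
    also have "C * (\<integral>z. \<bar>f k z\<bar> powr q \<partial>M) < e / 2"
      using N[OF that] C by (simp add: field_simps)
    finally have "(\<integral>z. \<bar>f k z\<bar> powr r \<partial>M) < e" using em by linarith
    then show ?thesis by (simp add: abs_of_nonneg)
  qed
  then show "\<exists>N. \<forall>k\<ge>N. norm ((\<integral>z. \<bar>f k z\<bar> powr r \<partial>M) - 0) < e" by blast
qed

section \<open>The degenerate quadratic form\<close>

text \<open>The form is separated from the gradients that \<open>grad_form\<close> inserts, so that its bilinearity can be used
  with the gradients of products and compositions.\<close>

definition coef_form ::
    "('n::finite \<Rightarrow> 'n \<Rightarrow> 'n spacetime \<Rightarrow> real) \<Rightarrow> 'n spacetime \<Rightarrow> real ^ 'n \<Rightarrow> real ^ 'n \<Rightarrow> real" where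
  "coef_form a z X Y = (\<Sum>i\<in>UNIV. \<Sum>j\<in>UNIV. a i j z * X $ i * Y $ j)"

definition xgrad :: "(('n::finite) spacetime \<Rightarrow> real) \<Rightarrow> 'n spacetime \<Rightarrow> real ^ 'n" where
  "xgrad f z = (\<chi> i. dx i f z)"

definition sym_psd ::
    "('n::finite \<Rightarrow> 'n \<Rightarrow> 'n spacetime \<Rightarrow> real) \<Rightarrow> ('n spacetime \<Rightarrow> real) \<Rightarrow> 'n spacetime \<Rightarrow> bool" where
  "sym_psd a A z \<longleftrightarrow> (\<forall>i j. a i j z = a j i z) \<and>
     (\<forall>\<xi>. 0 \<le> coef_form a z \<xi> \<xi> \<and> coef_form a z \<xi> \<xi> \<le> A z * (norm \<xi>)\<^sup>2)"

lemma grad_form_eq: "grad_form a f g z = coef_form a z (xgrad f z) (xgrad g z)"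
  by (simp add: grad_form_def coef_form_def xgrad_def)

lemma coef_form_add_left: "coef_form a z (X + Y) Z = coef_form a z X Z + coef_form a z Y Z"
  by (simp add: coef_form_def algebra_simps sum.distrib)

lemma coef_form_add_right: "coef_form a z Z (X + Y) = coef_form a z Z X + coef_form a z Z Y"
  by (simp add: coef_form_def algebra_simps sum.distrib)

lemma coef_form_scale_left: "coef_form a z (c *\<^sub>R X) Z = c * coef_form a z X Z"
  by (simp add: coef_form_def sum_distrib_left algebra_simps)

lemma coef_form_scale_right: "coef_form a z Z (c *\<^sub>R X) = c * coef_form a z Z X"
  by (simp add: coef_form_def sum_distrib_left algebra_simps)

lemma coef_form_diff_left: "coef_form a z (X - Y) Z = coef_form a z X Z - coef_form a z Y Z"
  using coef_form_add_left[of a z X "(-1) *\<^sub>R Y" Z] coef_form_scale_left[of a z "-1" Y Z] by simp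

lemma coef_form_diff_right: "coef_form a z Z (X - Y) = coef_form a z Z X - coef_form a z Z Y"
  using coef_form_add_right[of a z Z X "(-1) *\<^sub>R Y"] coef_form_scale_right[of a z Z "-1" Y] by simp

lemmas coef_form_bilinear = coef_form_add_left coef_form_add_right coef_form_scale_left
  coef_form_scale_right coef_form_diff_left coef_form_diff_right

lemma coef_form_sym:
  assumes "sym_psd a A z" shows "coef_form a z X Y = coef_form a z Y X"
proof -
  have "coef_form a z X Y = (\<Sum>j\<in>UNIV. \<Sum>i\<in>UNIV. a i j z * X $ i * Y $ j)"
    unfolding coef_form_def by (rule sum.swap)
  also have "\<dots> = coef_form a z Y X"
    unfolding coef_form_def using assms
    by (intro sum.cong refl) (auto simp: sym_psd_def mult_ac)
  finally show ?thesis .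
qed

lemma coef_form_nonneg: "sym_psd a A z \<Longrightarrow> 0 \<le> coef_form a z X X"
  by (simp add: sym_psd_def)

text \<open>The discriminant argument: the form is nonnegative at \<open>\<tau> X - Y\<close>. Only semi-definiteness enters,
  which is all that a degenerate operator provides.\<close>

lemma coef_form_Young_le:
  assumes z: "sym_psd a A z" and \<tau>: "0 < \<tau>"
  shows "coef_form a z X Y \<le> \<tau> / 2 * coef_form a z X X + coef_form a z Y Y / (2 * \<tau>)"
proof -
  have "0 \<le> coef_form a z (\<tau> *\<^sub>R X - Y) (\<tau> *\<^sub>R X - Y)" by (rule coef_form_nonneg[OF z])
  also have "\<dots> = \<tau> * \<tau> * coef_form a z X X - 2 * \<tau> * coef_form a z X Y + coef_form a z Y Y"
    by (simp add: coef_form_bilinear coef_form_sym[OF z, of Y X] algebra_simps)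
  finally show ?thesis using \<tau> by (simp add: field_simps)
qed

lemma coef_form_Young:
  assumes "sym_psd a A z" "0 < \<tau>"
  shows "\<bar>coef_form a z X Y\<bar> \<le> \<tau> / 2 * coef_form a z X X + coef_form a z Y Y / (2 * \<tau>)"
  using coef_form_Young_le[OF assms, of X Y] coef_form_Young_le[OF assms, of X "(-1) *\<^sub>R Y"]
  unfolding coef_form_scale_left coef_form_scale_right by simp

lemma coef_form_diff_le:
  assumes z: "sym_psd a A z"
  shows "coef_form a z (X - Y) (X - Y) \<le> 2 * coef_form a z X X + 2 * coef_form a z Y Y"
  using coef_form_nonneg[OF z, of "X + Y"] by (simp add: coef_form_bilinear)

lemma AE_sym_psd:
  assumes "admissible_coefficients a A"
  shows "AE z in lebesgue. sym_psd a A z"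
proof -
  have "AE z in lebesgue. \<forall>i j. a i j z = a j i z"
    using assms unfolding admissible_coefficients_def AE_all_countable by blast
  moreover have "AE z in lebesgue. \<forall>\<xi>. 0 \<le> coef_form a z \<xi> \<xi> \<and> coef_form a z \<xi> \<xi> \<le> A z * (norm \<xi>)\<^sup>2"
    using assms unfolding admissible_coefficients_def coef_form_def by blast
  ultimately show ?thesis by eventually_elim (simp add: sym_psd_def)
qed

lemma xgrad_eqI: "(f has_derivative f') (at z) \<Longrightarrow> xgrad f z = (\<chi> i. f' (0, axis i 1))"
  unfolding xgrad_def dx_def using frechet_derivative_at by (metis (no_types))

lemma dt_eqI: "(f has_derivative f') (at z) \<Longrightarrow> dt f z = f' (1, 0)"
  unfolding dt_def using frechet_derivative_at by (metis (no_types))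

lemma xgrad_dt_diff:
  assumes "Cinf_on S f" "Cinf_on S g" "z \<in> S"
  shows "xgrad (\<lambda>z. f z - g z) z = xgrad f z - xgrad g z" "dt (\<lambda>z. f z - g z) z = dt f z - dt g z"
proof -
  note d = has_derivative_diff[OF Cinf_on_has_derivative[OF assms(1,3)] Cinf_on_has_derivative[OF assms(2,3)]]
  show "xgrad (\<lambda>z. f z - g z) z = xgrad f z - xgrad g z"
    unfolding xgrad_eqI[OF d] by (simp add: xgrad_def dx_def vec_eq_iff)
  show "dt (\<lambda>z. f z - g z) z = dt f z - dt g z"
    unfolding dt_eqI[OF d] by (simp add: dt_def)
qed

lemma xgrad_dt_chain:
  assumes "(f has_derivative f') (at z)" "(g has_real_derivative g') (at (f z))"
  shows "xgrad (\<lambda>z. g (f z)) z = g' *\<^sub>R xgrad f z" "dt (\<lambda>z. g (f z)) z = g' * dt f z"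
proof -
  have "((\<lambda>z. g (f z)) has_derivative (\<lambda>b. g' * f' b)) (at z)"
    using diff_chain_at[OF assms(1) assms(2)[unfolded has_field_derivative_def]] unfolding o_def .
  then show "xgrad (\<lambda>z. g (f z)) z = g' *\<^sub>R xgrad f z" "dt (\<lambda>z. g (f z)) z = g' * dt f z"
    by (simp_all add: xgrad_eqI[OF assms(1)] dt_eqI[OF assms(1)] xgrad_eqI dt_eqI vec_eq_iff)
qed

lemma xgrad_dt_mult:
  assumes "(f has_derivative f') (at z)" "(g has_derivative g') (at z)"
  shows "xgrad (\<lambda>z. f z * g z) z = f z *\<^sub>R xgrad g z + g z *\<^sub>R xgrad f z"
    "dt (\<lambda>z. f z * g z) z = f z * dt g z + g z * dt f z"
  by (simp_all add: xgrad_eqI[OF assms(1)] dt_eqI[OF assms(1)] xgrad_eqI[OF assms(2)] dt_eqI[OF assms(2)]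
      xgrad_eqI[OF has_derivative_mult[OF assms]] dt_eqI[OF has_derivative_mult[OF assms]] vec_eq_iff)

lemma Cinf_on_continuous_dt: "Cinf_on S f \<Longrightarrow> continuous_on S (dt f)"
  unfolding dt_def[abs_def] by (rule Cinf_on_continuous_derivative)

lemma Cinf_on_continuous_dx: "Cinf_on S f \<Longrightarrow> continuous_on S (dx i f)"
  unfolding dx_def[abs_def] by (rule Cinf_on_continuous_derivative)

lemma borel_measurable_grad_form:
  assumes a: "admissible_coefficients a A" and \<Omega>: "open \<Omega>" and "Cinf_on \<Omega> f" "Cinf_on \<Omega> g"
  shows "grad_form a f g \<in> borel_measurable (lebesgue_on \<Omega>)"
proof -
  have "a i j \<in> borel_measurable (lebesgue_on \<Omega>)" for i j
    using a by (intro measurable_restrict_space1) (auto simp: admissible_coefficients_def)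
  moreover have "dx i f \<in> borel_measurable (lebesgue_on \<Omega>)" "dx i g \<in> borel_measurable (lebesgue_on \<Omega>)" for i
    using assms by (auto intro!: continuous_on_measurable_lebesgue_on Cinf_on_continuous_dx)
  ultimately show ?thesis
    unfolding grad_form_def[abs_def] by (intro borel_measurable_sum borel_measurable_times)
qed

lemma AE_lebesgue_on_sym_psd:
  assumes "admissible_coefficients a A" "open \<Omega>"
  shows "AE z in lebesgue_on \<Omega>. z \<in> \<Omega> \<and> sym_psd a A z"
proof -
  have "AE z in lebesgue_on \<Omega>. z \<in> \<Omega>"
    by (rule AE_I2) (simp add: space_restrict_space)
  with AE_lebesgue_on[OF assms(2) AE_sym_psd[OF assms(1)]] show ?thesis by eventually_elim simp
qed

lemma integrable_grad_form:
  assumes a: "admissible_coefficients a A" and \<Omega>: "open \<Omega>" and f: "Cinf_on \<Omega> f" and g: "Cinf_on \<Omega> g"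
    and "integrable (lebesgue_on \<Omega>) (grad_form a f f)" "integrable (lebesgue_on \<Omega>) (grad_form a g g)"
  shows "integrable (lebesgue_on \<Omega>) (grad_form a f g)"
proof (rule Bochner_Integration.integrable_bound)
  show "integrable (lebesgue_on \<Omega>) (\<lambda>z. grad_form a f f z + grad_form a g g z)"
    using assms by auto
  show "grad_form a f g \<in> borel_measurable (lebesgue_on \<Omega>)"
    by (rule borel_measurable_grad_form[OF a \<Omega> f g])
  show "AE z in lebesgue_on \<Omega>. norm (grad_form a f g z) \<le> norm (grad_form a f f z + grad_form a g g z)"
    using AE_lebesgue_on_sym_psd[OF a \<Omega>]
  proof eventually_elim
    case (elim z)
    then have z: "sym_psd a A z" by simp
    show ?case
      unfolding grad_form_eq
      using coef_form_Young[OF z, of 1 "xgrad f z" "xgrad g z"]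
        coef_form_nonneg[OF z, of "xgrad f z"] coef_form_nonneg[OF z, of "xgrad g z"] by simp
  qed
qed

lemma integrable_grad_form_diff:
  assumes a: "admissible_coefficients a A" and \<Omega>: "open \<Omega>" and f: "Cinf_on \<Omega> f" and g: "Cinf_on \<Omega> g"
    and "integrable (lebesgue_on \<Omega>) (grad_form a f f)" "integrable (lebesgue_on \<Omega>) (grad_form a g g)"
  shows "integrable (lebesgue_on \<Omega>) (grad_form a (\<lambda>z. f z - g z) (\<lambda>z. f z - g z))"
    "(\<integral>z. grad_form a (\<lambda>z. f z - g z) (\<lambda>z. f z - g z) z \<partial>lebesgue_on \<Omega>) \<le>
       2 * (\<integral>z. grad_form a f f z \<partial>lebesgue_on \<Omega>) + 2 * (\<integral>z. grad_form a g g z \<partial>lebesgue_on \<Omega>)"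
proof -
  let ?d = "\<lambda>z. f z - g z"
  have le: "AE z in lebesgue_on \<Omega>. 0 \<le> grad_form a ?d ?d z \<and>
      grad_form a ?d ?d z \<le> 2 * grad_form a f f z + 2 * grad_form a g g z"
    using AE_lebesgue_on_sym_psd[OF a \<Omega>]
  proof eventually_elim
    case (elim z)
    then have z: "z \<in> \<Omega>" "sym_psd a A z" by auto
    show ?case
      unfolding grad_form_eq xgrad_dt_diff(1)[OF f g z(1)]
      using coef_form_diff_le[OF z(2)] coef_form_nonneg[OF z(2)] by simp
  qed
  have int: "integrable (lebesgue_on \<Omega>) (\<lambda>z. 2 * grad_form a f f z + 2 * grad_form a g g z)"
    using assms by auto
  show i: "integrable (lebesgue_on \<Omega>) (grad_form a ?d ?d)"
    by (rule Bochner_Integration.integrable_bound[OF int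
          borel_measurable_grad_form[OF a \<Omega> Cinf_on_diff[OF \<Omega> f g] Cinf_on_diff[OF \<Omega> f g]]])
       (use le in \<open>auto elim: eventually_mono\<close>)
  have "(\<integral>z. grad_form a ?d ?d z \<partial>lebesgue_on \<Omega>) \<le>
      (\<integral>z. 2 * grad_form a f f z + 2 * grad_form a g g z \<partial>lebesgue_on \<Omega>)"
    by (rule integral_mono_AE[OF i int]) (use le in \<open>auto elim: eventually_mono\<close>)
  then show "(\<integral>z. grad_form a ?d ?d z \<partial>lebesgue_on \<Omega>) \<le>
       2 * (\<integral>z. grad_form a f f z \<partial>lebesgue_on \<Omega>) + 2 * (\<integral>z. grad_form a g g z \<partial>lebesgue_on \<Omega>)"
    using assms by simp
qed

text \<open>Local boundedness is stated with neighbourhoods, of which finitely many cover a compact set.\<close>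

lemma locally_bounded_on_compact:
  fixes f :: "'a::euclidean_space \<Rightarrow> real"
  assumes "locally_bounded f" "compact K"
  obtains B where "0 < B" "\<And>z. z \<in> K \<Longrightarrow> \<bar>f z\<bar> \<le> B"
proof -
  define \<U> where "\<U> = {U. open U \<and> bounded (f ` U)}"
  have "K \<subseteq> \<Union>\<U>" using assms(1) unfolding locally_bounded_def \<U>_def by blast
  then obtain \<D> where D: "\<D> \<subseteq> \<U>" "finite \<D>" "K \<subseteq> \<Union>\<D>"
    using compactE[OF assms(2)] unfolding \<U>_def by (metis (no_types, lifting) mem_Collect_eq)
  have "bounded (\<Union>U\<in>\<D>. f ` U)"
    using D(1,2) by (intro bounded_Union) (auto simp: \<U>_def)
  then have "bounded (f ` K)" by (rule bounded_subset) (use D(3) in blast)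
  then obtain B where "0 < B" "\<And>z. z \<in> K \<Longrightarrow> \<bar>f z\<bar> \<le> B" unfolding bounded_pos by auto
  then show ?thesis using that by blast
qed

section \<open>Compactly supported test functions\<close>

text \<open>The condition \<open>test_function\<close> without the sign: the product \<open>H(w / \<omega>) \<phi>\<close> that is integrated by parts changes sign.\<close>

definition compact_smooth :: "(('n::finite) spacetime \<Rightarrow> real) \<Rightarrow> bool" where
  "compact_smooth \<phi> \<longleftrightarrow> Cinf_on UNIV \<phi> \<and> compact (closure {z. \<phi> z \<noteq> 0})"

lemma derivative_outside_support:
  assumes "z \<notin> closure {z. \<phi> z \<noteq> 0}"
  shows "frechet_derivative \<phi> (at z) b = 0"
proof -
  have "((\<lambda>_. 0) has_derivative (\<lambda>_. 0)) (at z)" by simp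
  then have "(\<phi> has_derivative (\<lambda>_. 0)) (at z)"
    by (rule has_derivative_transform_within_open[of _ _ _ _ "- closure {z. \<phi> z \<noteq> 0}"])
       (use assms closure_subset[of "{z. \<phi> z \<noteq> 0}"] in auto)
  then show ?thesis using frechet_derivative_at by metis
qed

lemma compact_smooth_bounded:
  assumes "compact_smooth \<phi>"
  obtains B where "0 < B" "\<And>z. \<bar>\<phi> z\<bar> \<le> B" "\<And>z. \<bar>dt \<phi> z\<bar> \<le> B" "\<And>z. norm (xgrad \<phi> z) \<le> B"
proof -
  let ?K = "closure {z. \<phi> z \<noteq> 0}"
  have C: "Cinf_on UNIV \<phi>" and K: "compact ?K" using assms by (auto simp: compact_smooth_def)
  have "continuous_on UNIV (\<lambda>z. \<bar>\<phi> z\<bar> + \<bar>dt \<phi> z\<bar> + norm (xgrad \<phi> z))"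
    unfolding xgrad_def[abs_def]
    by (intro continuous_intros Cinf_on_continuous[OF C] Cinf_on_continuous_dt[OF C]
        continuous_on_vec_lambda Cinf_on_continuous_dx[OF C])
  then have "bounded ((\<lambda>z. \<bar>\<phi> z\<bar> + \<bar>dt \<phi> z\<bar> + norm (xgrad \<phi> z)) ` ?K)"
    using K by (intro compact_imp_bounded compact_continuous_image) (auto intro: continuous_on_subset)
  then obtain B where B: "0 < B" "\<And>z. z \<in> ?K \<Longrightarrow> \<bar>\<bar>\<phi> z\<bar> + \<bar>dt \<phi> z\<bar> + norm (xgrad \<phi> z)\<bar> \<le> B"
    unfolding bounded_pos by auto
  have out: "\<phi> z = 0 \<and> dt \<phi> z = 0 \<and> xgrad \<phi> z = 0" if "z \<notin> ?K" for z
    using derivative_outside_support[OF that] closure_subset[of "{z. \<phi> z \<noteq> 0}"] that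
    by (auto simp: dt_def xgrad_def dx_def vec_eq_iff)
  have le: "\<bar>\<phi> z\<bar> + \<bar>dt \<phi> z\<bar> + norm (xgrad \<phi> z) \<le> B" for z
  proof (cases "z \<in> ?K")
    case True
    show ?thesis using B(2)[OF True] by linarith
  next
    case False
    show ?thesis using out[OF False] B(1) by simp
  qed
  have "\<bar>\<phi> z\<bar> \<le> B" "\<bar>dt \<phi> z\<bar> \<le> B" "norm (xgrad \<phi> z) \<le> B" for z
    using le[of z] norm_ge_zero[of "xgrad \<phi> z"] by linarith+
  then show ?thesis using that[OF B(1)] by blast
qed

text \<open>The support is compact, hence the local bound of \<open>A\<close> is a bound there, and the gradient vanishes outside.\<close>

lemma grad_form_compact_smooth_bounded:
  assumes a: "admissible_coefficients a A" and \<phi>: "compact_smooth \<phi>"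
  obtains B where "0 < B" "AE z in lebesgue. 0 \<le> grad_form a \<phi> \<phi> z \<and> grad_form a \<phi> \<phi> z \<le> B"
proof -
  obtain B where B: "0 < B" "\<And>z. norm (xgrad \<phi> z) \<le> B"
    using compact_smooth_bounded[OF \<phi>] by metis
  let ?K = "closure {z. \<phi> z \<noteq> 0}"
  have "compact ?K" "locally_bounded A" using a \<phi> by (auto simp: compact_smooth_def admissible_coefficients_def)
  then obtain D where D: "0 < D" "\<And>z. z \<in> ?K \<Longrightarrow> \<bar>A z\<bar> \<le> D"
    using locally_bounded_on_compact by blast
  have "AE z in lebesgue. 0 \<le> grad_form a \<phi> \<phi> z \<and> grad_form a \<phi> \<phi> z \<le> D * B\<^sup>2"
    using AE_sym_psd[OF a]
  proof eventually_elim
    case (elim z)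
    have "grad_form a \<phi> \<phi> z \<le> D * B\<^sup>2"
    proof (cases "z \<in> ?K")
      case True
      have "grad_form a \<phi> \<phi> z \<le> A z * (norm (xgrad \<phi> z))\<^sup>2"
        unfolding grad_form_eq using elim by (simp add: sym_psd_def)
      also have "\<dots> \<le> D * B\<^sup>2"
        using D(2)[OF True] B D(1) by (intro mult_mono power_mono) auto
      finally show ?thesis .
    next
      case False
      then have "grad_form a \<phi> \<phi> z = 0"
        unfolding grad_form_def dx_def by (simp add: derivative_outside_support)
      then show ?thesis using D B by simp
    qed
    then show ?case using coef_form_nonneg[OF elim] by (simp add: grad_form_eq)
  qed
  then show ?thesis using that[of "D * B\<^sup>2"] B D by simp
qed

lemma integrable_bounded_AE:
  fixes f :: "'a \<Rightarrow> real"
  assumes "finite_measure M" "f \<in> borel_measurable M" "AE z in M. \<bar>f z\<bar> \<le> B"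
  shows "integrable M f"
  using finite_measure.integrable_const_bound[OF assms(1), of f B] assms by simp

lemma integrable_grad_form_compact_smooth:
  assumes a: "admissible_coefficients a A" and \<Omega>: "open \<Omega>" "bounded \<Omega>" and \<phi>: "compact_smooth \<phi>"
  shows "integrable (lebesgue_on \<Omega>) (grad_form a \<phi> \<phi>)"
proof -
  obtain B where B: "AE z in lebesgue. 0 \<le> grad_form a \<phi> \<phi> z \<and> grad_form a \<phi> \<phi> z \<le> B"
    using grad_form_compact_smooth_bounded[OF a \<phi>] by metis
  have C: "Cinf_on \<Omega> \<phi>" using \<phi> Cinf_on_mono by (auto simp: compact_smooth_def)
  show ?thesis
    by (rule integrable_bounded_AE[OF finite_measure_lebesgue_on[OF \<Omega>]
          borel_measurable_grad_form[OF a \<Omega>(1) C C], of B])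
       (use AE_lebesgue_on[OF \<Omega>(1) B] in \<open>auto elim: eventually_mono\<close>)
qed

lemma damped_test_gradient:
  assumes w: "Cinf_on \<Omega> w" and \<phi>: "Cinf_on \<Omega> \<phi>" and z: "z \<in> \<Omega>" and \<omega>: "\<omega> \<noteq> 0"
    and h: "\<And>y. (h has_real_derivative - k y) (at y)"
  shows "xgrad (\<lambda>z. h (w z / \<omega>) * \<phi> z) z =
    h (w z / \<omega>) *\<^sub>R xgrad \<phi> z - (k (w z / \<omega>) * \<phi> z / \<omega>) *\<^sub>R xgrad w z"
proof -
  note dw = Cinf_on_has_derivative[OF w z]
  have dg: "((\<lambda>x. h (x / \<omega>)) has_real_derivative - k (w z / \<omega>) * (1 / \<omega>)) (at (w z))"
    using DERIV_chain2[OF h, of "\<lambda>x. x / \<omega>" "1 / \<omega>"] DERIV_cdivide[OF DERIV_ident, of \<omega>] by blast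
  have dh: "((\<lambda>z. h (w z / \<omega>)) has_derivative (\<lambda>b. (- k (w z / \<omega>) * (1 / \<omega>)) * frechet_derivative w (at z) b)) (at z)"
    using diff_chain_at[OF dw dg[unfolded has_field_derivative_def]] unfolding o_def .
  show ?thesis
    unfolding xgrad_dt_mult(1)[OF dh Cinf_on_has_derivative[OF \<phi> z]] xgrad_dt_chain(1)[OF dw dg]
    by (simp add: vec_eq_iff)
qed

lemma xgrad_dt_power:
  assumes "Cinf_on S f" "z \<in> S"
  shows "xgrad (\<lambda>z. f z ^ s) z = (real s * f z ^ (s - 1)) *\<^sub>R xgrad f z"
    "dt (\<lambda>z. f z ^ s) z = real s * f z ^ (s - 1) * dt f z"
  using xgrad_dt_chain[OF Cinf_on_has_derivative[OF assms] DERIV_pow, of s] by simp_all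

text \<open>The pointwise core of the argument. The left-hand side is the flux term of the tested inequality: the
  gradient of \<open>h(w / \<omega>) \<zeta>\<^sup>s\<close> against the gradient of \<open>w\<close>, with \<open>X\<close> and \<open>Y\<close> the gradients of \<open>\<zeta>\<close> and \<open>w\<close>. Its
  second part is a negative energy, because \<open>h\<close> decreases, and Young's inequality with the weight \<open>\<tau>\<close> of the
  proof makes the cross term cancel against this energy exactly. What remains no longer contains the gradient
  of \<open>w\<close>.\<close>

lemma damped_form_le:
  assumes z: "sym_psd a A z" and s: "2 \<le> s" and \<omega>: "0 < \<omega>" and k: "0 < k" and h: "0 < h"
    and \<zeta>: "0 \<le> \<zeta>" and le: "h\<^sup>2 \<le> D * k"
  shows "coef_form a z ((h * (real s * \<zeta> ^ (s - 1))) *\<^sub>R X - (k * \<zeta> ^ s / \<omega>) *\<^sub>R Y) Y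
     \<le> \<omega> * (real s)\<^sup>2 / 4 * D * \<zeta> ^ (s - 2) * coef_form a z X X"
proof -
  \<comment> \<open>With this weight the coefficient of the form at \<open>\<zeta> Y\<close> becomes exactly \<open>k / \<omega>\<close>.\<close>
  define \<tau> where "\<tau> = h * real s * \<omega> / (2 * k)"
  have \<tau>: "0 < \<tau>" using assms by (simp add: \<tau>_def)
  obtain m where m: "s = m + 2" using s le_Suc_ex by (metis add.commute)
  have "coef_form a z X (\<zeta> *\<^sub>R Y) \<le> \<tau> / 2 * coef_form a z X X + coef_form a z (\<zeta> *\<^sub>R Y) (\<zeta> *\<^sub>R Y) / (2 * \<tau>)"
    by (rule coef_form_Young_le[OF z \<tau>])
  then have "\<zeta> * coef_form a z X Y \<le> \<tau> / 2 * coef_form a z X X + \<zeta>\<^sup>2 * coef_form a z Y Y / (2 * \<tau>)"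
    by (simp add: coef_form_bilinear power2_eq_square mult_ac)
  then have "h * real s * (\<zeta> * coef_form a z X Y) \<le>
      h * real s * (\<tau> / 2 * coef_form a z X X + \<zeta>\<^sup>2 * coef_form a z Y Y / (2 * \<tau>))"
    using h by (intro mult_left_mono) auto
  also have "\<dots> = \<omega> * (real s)\<^sup>2 / 4 * (h\<^sup>2 / k) * coef_form a z X X + k / \<omega> * \<zeta>\<^sup>2 * coef_form a z Y Y"
  proof -
    have "h * real s * (\<tau> / 2) = \<omega> * (real s)\<^sup>2 / 4 * (h\<^sup>2 / k)"
      by (simp add: \<tau>_def power2_eq_square)
    moreover have "h * real s / (2 * \<tau>) = k / \<omega>"
      using h k \<omega> s by (simp add: \<tau>_def)
    ultimately show ?thesis
      by (metis (no_types, opaque_lifting) distrib_left mult.assoc times_divide_eq_left times_divide_eq_right)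
  qed
  also have "\<dots> \<le> \<omega> * (real s)\<^sup>2 / 4 * D * coef_form a z X X + k / \<omega> * \<zeta>\<^sup>2 * coef_form a z Y Y"
    using le k \<omega> coef_form_nonneg[OF z, of X]
    by (intro add_right_mono mult_right_mono mult_left_mono) (auto simp: divide_le_eq)
  finally have "h * real s * (\<zeta> * coef_form a z X Y) - k / \<omega> * \<zeta>\<^sup>2 * coef_form a z Y Y
      \<le> \<omega> * (real s)\<^sup>2 / 4 * D * coef_form a z X X" by simp
  then have "\<zeta> ^ m * (h * real s * (\<zeta> * coef_form a z X Y) - k / \<omega> * \<zeta>\<^sup>2 * coef_form a z Y Y)
      \<le> \<zeta> ^ m * (\<omega> * (real s)\<^sup>2 / 4 * D * coef_form a z X X)"
    using \<zeta> by (intro mult_left_mono) auto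
  then show ?thesis
    by (simp add: m coef_form_bilinear algebra_simps power_add power2_eq_square)
qed

section \<open>Weak inequalities along approximating sequences\<close>

definition source :: "real \<Rightarrow> real \<Rightarrow> real" where
  "source q y = \<bar>y\<bar> powr (q - 1) * y"

text \<open>The part of membership in the local space that the argument uses, as a statement about one sequence of
  smooth functions. The two Cauchy conditions are on the time derivatives in the mean and on the energy; the
  square is there because the norm contains the square root of the energy.\<close>

definition W_approx ::
    "('n::finite \<Rightarrow> 'n \<Rightarrow> 'n spacetime \<Rightarrow> real) \<Rightarrow> real \<Rightarrow> 'n spacetime set \<Rightarrow> ('n spacetime \<Rightarrow> real)
      \<Rightarrow> (nat \<Rightarrow> 'n spacetime \<Rightarrow> real) \<Rightarrow> bool" where
  "W_approx a q \<Omega> u U \<longleftrightarrow>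
     (\<forall>k. Cinf_on \<Omega> (U k) \<and> integrable (lebesgue_on \<Omega>) (dt (U k)) \<and>
        integrable (lebesgue_on \<Omega>) (grad_form a (U k) (U k)) \<and>
        integrable (lebesgue_on \<Omega>) (\<lambda>z. \<bar>U k z\<bar> powr q)) \<and>
     (\<forall>\<epsilon>>0. \<exists>N. \<forall>k\<ge>N. \<forall>m\<ge>N. (\<integral>z. \<bar>dt (U k) z - dt (U m) z\<bar> \<partial>lebesgue_on \<Omega>) \<le> \<epsilon> \<and>
        (\<integral>z. grad_form a (\<lambda>z. U k z - U m z) (\<lambda>z. U k z - U m z) z \<partial>lebesgue_on \<Omega>) \<le> \<epsilon>\<^sup>2) \<and>
     u \<in> borel_measurable (lebesgue_on \<Omega>) \<and> integrable (lebesgue_on \<Omega>) (\<lambda>z. \<bar>u z\<bar> powr q) \<and>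
     (\<lambda>k. \<integral>z. \<bar>U k z - u z\<bar> powr q \<partial>lebesgue_on \<Omega>) \<longlonglongrightarrow> 0"

lemma W_smooth_iff:
  assumes \<Omega>: "open \<Omega>" and q: "1 < q"
  shows "w \<in> W_smooth a q \<Omega> \<longleftrightarrow> Cinf_on \<Omega> w \<and> integrable (lebesgue_on \<Omega>) (dt w) \<and>
     integrable (lebesgue_on \<Omega>) (grad_form a w w) \<and> integrable (lebesgue_on \<Omega>) (\<lambda>z. \<bar>w z\<bar> powr q)"
proof (cases "Cinf_on \<Omega> w")
  case True
  have "integrable (lebesgue_on \<Omega>) (\<lambda>z. \<bar>dt w z\<bar>) \<longleftrightarrow> integrable (lebesgue_on \<Omega>) (dt w)"
    using continuous_on_measurable_lebesgue_on[OF \<Omega> Cinf_on_continuous_dt[OF True]]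
    by (simp add: integrable_abs_iff)
  then show ?thesis
    using q by (simp add: W_smooth_def set_integrable_lebesgue_on_iff[OF \<Omega>] qhat_def)
qed (simp add: W_smooth_def)

lemma grad_form_integral_nonneg:
  assumes "admissible_coefficients a A" "open \<Omega>"
  shows "0 \<le> (\<integral>z. grad_form a f f z \<partial>lebesgue_on \<Omega>)"
proof (rule integral_nonneg_AE)
  show "AE z in lebesgue_on \<Omega>. 0 \<le> grad_form a f f z"
    using AE_lebesgue_on_sym_psd[OF assms] by eventually_elim (auto simp: grad_form_eq intro: coef_form_nonneg)
qed

lemma W_norm_dominates:
  assumes a: "admissible_coefficients a A" and \<Omega>: "open \<Omega>"
    and f: "Cinf_on \<Omega> f" and g: "Cinf_on \<Omega> g" and less: "W_norm a q \<Omega> (\<lambda>z. f z - g z) < \<epsilon>"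
  shows "(\<integral>z. \<bar>dt f z - dt g z\<bar> \<partial>lebesgue_on \<Omega>) \<le> \<epsilon>"
    "(\<integral>z. grad_form a (\<lambda>z. f z - g z) (\<lambda>z. f z - g z) z \<partial>lebesgue_on \<Omega>) \<le> \<epsilon>\<^sup>2"
proof -
  let ?d = "\<lambda>z. f z - g z"
  let ?G = "\<integral>z. grad_form a ?d ?d z \<partial>lebesgue_on \<Omega>"
  have e1: "(\<integral>z. \<bar>dt f z - dt g z\<bar> \<partial>lebesgue_on \<Omega>) = (\<integral>z. \<bar>dt ?d z\<bar> \<partial>lebesgue_on \<Omega>)"
    by (intro Bochner_Integration.integral_cong refl)
       (simp add: space_restrict_space xgrad_dt_diff(2)[OF f g])
  have "(\<integral>z. \<bar>dt f z - dt g z\<bar> \<partial>lebesgue_on \<Omega>) + sqrt ?G \<le> W_norm a q \<Omega> ?d"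
    unfolding W_norm_def set_integral_lebesgue_on_eq[OF \<Omega>] e1 by simp
  moreover have "0 \<le> (\<integral>z. \<bar>dt f z - dt g z\<bar> \<partial>lebesgue_on \<Omega>)" by (intro integral_nonneg_AE) simp
  moreover have G: "0 \<le> ?G" by (rule grad_form_integral_nonneg[OF a \<Omega>])
  moreover have "0 \<le> sqrt ?G" using G by simp
  ultimately have 1: "(\<integral>z. \<bar>dt f z - dt g z\<bar> \<partial>lebesgue_on \<Omega>) \<le> \<epsilon>" and 2: "sqrt ?G \<le> \<epsilon>"
    using less by linarith+
  show "(\<integral>z. \<bar>dt f z - dt g z\<bar> \<partial>lebesgue_on \<Omega>) \<le> \<epsilon>" by (fact 1)
  show "?G \<le> \<epsilon>\<^sup>2" using power_mono[OF 2, of 2] G by simp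
qed

text \<open>An element of the completion is an equivalence class, and the class of \<open>U\<close> contains \<open>U\<close> because the
  zero function has norm 0.\<close>

lemma W_space_class_nonempty:
  assumes "X \<in> W_space a q \<Omega>"
  obtains U where "U \<in> X" "U \<in> W_Cauchy a q \<Omega>"
proof -
  obtain U where U: "U \<in> W_Cauchy a q \<Omega>" "X = W_equiv a q \<Omega> `` {U}"
    using assms unfolding W_space_def by (rule quotientE)
  have "W_norm a q \<Omega> (\<lambda>z. 0) = 0"
  proof -
    have "frechet_derivative (\<lambda>z. 0 :: real) (at z) = (\<lambda>_. 0)" for z :: "'a spacetime"
      by (rule frechet_derivative_at[symmetric]) simp
    then show ?thesis
      by (simp add: W_norm_def dt_def grad_form_def dx_def set_lebesgue_integral_def)
  qed
  then have "(U, U) \<in> W_equiv a q \<Omega>"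
    using U(1) by (simp add: W_equiv_def)
  then show ?thesis using that U by blast
qed

lemma W_loc_by_imp_W_approx:
  assumes a: "admissible_coefficients a A" and q: "1 < q"
    and u: "u \<in> borel_measurable lebesgue" and X: "W_loc_by a q X u"
    and \<Omega>: "domain_set \<Omega>" "bounded \<Omega>"
  obtains U where "U \<in> X \<Omega>" "W_approx a q \<Omega> u U"
proof -
  have o: "open \<Omega>" using \<Omega> by (simp add: domain_set_def)
  have XS: "X \<Omega> \<in> W_space a q \<Omega>" and XF: "W_function q \<Omega> (X \<Omega>) u"
    using X \<Omega> by (auto simp: W_loc_by_def)
  obtain U where U: "U \<in> X \<Omega>" "U \<in> W_Cauchy a q \<Omega>"
    using W_space_class_nonempty[OF XS] by blast
  have qh: "qhat q = q" using q by (simp add: qhat_def)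
  have S: "U k \<in> W_smooth a q \<Omega>" for k using U(2) by (simp add: W_Cauchy_def)
  note S' = S[unfolded W_smooth_iff[OF o q]]
  have "W_approx a q \<Omega> u U"
    unfolding W_approx_def
  proof (intro conjI allI impI)
    fix \<epsilon> :: real assume "0 < \<epsilon>"
    then obtain N where N: "\<And>k m. k \<ge> N \<Longrightarrow> m \<ge> N \<Longrightarrow> W_norm a q \<Omega> (\<lambda>z. U k z - U m z) < \<epsilon>"
      using U(2) unfolding W_Cauchy_def by blast
    show "\<exists>N. \<forall>k\<ge>N. \<forall>m\<ge>N. (\<integral>z. \<bar>dt (U k) z - dt (U m) z\<bar> \<partial>lebesgue_on \<Omega>) \<le> \<epsilon> \<and>
        (\<integral>z. grad_form a (\<lambda>z. U k z - U m z) (\<lambda>z. U k z - U m z) z \<partial>lebesgue_on \<Omega>) \<le> \<epsilon>\<^sup>2"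
      using W_norm_dominates[OF a o _ _ N] S' by blast
  next
    show "u \<in> borel_measurable (lebesgue_on \<Omega>)" using u by (rule measurable_restrict_space1)
    show "integrable (lebesgue_on \<Omega>) (\<lambda>z. \<bar>u z\<bar> powr q)"
      "(\<lambda>k. \<integral>z. \<bar>U k z - u z\<bar> powr q \<partial>lebesgue_on \<Omega>) \<longlonglongrightarrow> 0"
      using XF U(1) by (auto simp: W_function_def qh set_integrable_lebesgue_on_iff[OF o] set_integral_lebesgue_on_eq[OF o])
  qed (use S' in auto)
  then show ?thesis using that U(1) by blast
qed

text \<open>The terms of the weak inequality that contain derivatives of the solution, at a smooth function \<open>w\<close>.\<close>

definition weak_lhs ::
    "('n::finite \<Rightarrow> 'n \<Rightarrow> 'n spacetime \<Rightarrow> real) \<Rightarrow> 'n spacetime set \<Rightarrow> ('n spacetime \<Rightarrow> real)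
      \<Rightarrow> ('n spacetime \<Rightarrow> real) \<Rightarrow> real" where
  "weak_lhs a \<Omega> w \<phi> =
     (\<integral>z. dt w z * \<phi> z \<partial>lebesgue_on \<Omega>) + (\<integral>z. grad_form a \<phi> w z \<partial>lebesgue_on \<Omega>)"

lemma integral_mult_bounded_le:
  fixes f \<phi> :: "'a \<Rightarrow> real"
  assumes "integrable M f" "\<phi> \<in> borel_measurable M" "\<And>z. \<bar>\<phi> z\<bar> \<le> B"
  shows "integrable M (\<lambda>z. f z * \<phi> z)" "\<bar>\<integral>z. f z * \<phi> z \<partial>M\<bar> \<le> B * (\<integral>z. \<bar>f z\<bar> \<partial>M)"
proof -
  have B: "integrable M (\<lambda>z. B * \<bar>f z\<bar>)" using assms by auto
  have le: "\<bar>f z * \<phi> z\<bar> \<le> B * \<bar>f z\<bar>" for z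
    using mult_left_mono[OF assms(3)[of z], of "\<bar>f z\<bar>"] by (simp add: abs_mult mult.commute)
  show i: "integrable M (\<lambda>z. f z * \<phi> z)"
    by (rule Bochner_Integration.integrable_bound[OF B])
       (use assms le in \<open>auto intro!: borel_measurable_times AE_I2 order.trans[OF le abs_ge_self]\<close>)
  have "\<bar>\<integral>z. f z * \<phi> z \<partial>M\<bar> \<le> (\<integral>z. \<bar>f z * \<phi> z\<bar> \<partial>M)" by (rule integral_abs_bound)
  also have "\<dots> \<le> (\<integral>z. B * \<bar>f z\<bar> \<partial>M)"
    using i B le by (intro integral_mono) auto
  finally show "\<bar>\<integral>z. f z * \<phi> z \<partial>M\<bar> \<le> B * (\<integral>z. \<bar>f z\<bar> \<partial>M)" by simp
qed

text \<open>The time derivative of the class enters the weak integral only as a limit in the mean, and may depend on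
  the test function; the bounded test function turns that limit into a limit of numbers. Afterwards only
  the chosen sequence occurs.\<close>

lemma weak_integral_imp_weak_lhs_tendsto:
  assumes \<Omega>: "open \<Omega>" and W: "W_approx a q \<Omega> u U" and U: "U \<in> X"
    and \<phi>: "compact_smooth \<phi>" and I: "weak_integral a q \<Omega> X u \<phi> I"
  shows "(\<lambda>m. weak_lhs a \<Omega> (U m) \<phi>) \<longlonglongrightarrow> I + (\<integral>z. source q (u z) * \<phi> z \<partial>lebesgue_on \<Omega>)"
proof -
  obtain g l where g: "W_dt \<Omega> X g" and l: "W_flux a \<Omega> X \<phi> l"
    and I_eq: "I = (\<integral>z. g z * \<phi> z \<partial>lebesgue_on \<Omega>) + l - (\<integral>z. source q (u z) * \<phi> z \<partial>lebesgue_on \<Omega>)"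
    using I unfolding weak_integral_def set_integral_lebesgue_on_eq[OF \<Omega>] source_def by blast
  have gi: "integrable (lebesgue_on \<Omega>) g"
    and gl: "(\<lambda>k. \<integral>z. \<bar>dt (U k) z - g z\<bar> \<partial>lebesgue_on \<Omega>) \<longlonglongrightarrow> 0"
    using g U by (auto simp: W_dt_def set_integrable_lebesgue_on_iff[OF \<Omega>] set_integral_lebesgue_on_eq[OF \<Omega>])
  have fl: "(\<lambda>k. \<integral>z. grad_form a \<phi> (U k) z \<partial>lebesgue_on \<Omega>) \<longlonglongrightarrow> l"
    using l U by (auto simp: W_flux_def set_integral_lebesgue_on_eq[OF \<Omega>])
  have di: "integrable (lebesgue_on \<Omega>) (dt (U k))" for k using W by (simp add: W_approx_def)
  obtain B where B: "0 < B" "\<And>z. \<bar>\<phi> z\<bar> \<le> B"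
    using compact_smooth_bounded[OF \<phi>] by metis
  have m: "\<phi> \<in> borel_measurable (lebesgue_on \<Omega>)"
    using \<phi> by (intro continuous_on_measurable_lebesgue_on[OF \<Omega>] Cinf_on_continuous)
      (auto simp: compact_smooth_def intro: Cinf_on_mono)
  have "(\<lambda>k. (\<integral>z. dt (U k) z * \<phi> z \<partial>lebesgue_on \<Omega>) - (\<integral>z. g z * \<phi> z \<partial>lebesgue_on \<Omega>)) \<longlonglongrightarrow> 0"
  proof (rule Lim_null_comparison)
    show "(\<lambda>k. B * (\<integral>z. \<bar>dt (U k) z - g z\<bar> \<partial>lebesgue_on \<Omega>)) \<longlonglongrightarrow> 0"
      using tendsto_mult[OF tendsto_const gl, of B] by simp
    have "\<bar>(\<integral>z. dt (U k) z * \<phi> z \<partial>lebesgue_on \<Omega>) - (\<integral>z. g z * \<phi> z \<partial>lebesgue_on \<Omega>)\<bar>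
        \<le> B * (\<integral>z. \<bar>dt (U k) z - g z\<bar> \<partial>lebesgue_on \<Omega>)" for k
    proof -
      have "(\<integral>z. dt (U k) z * \<phi> z \<partial>lebesgue_on \<Omega>) - (\<integral>z. g z * \<phi> z \<partial>lebesgue_on \<Omega>)
          = (\<integral>z. (dt (U k) z - g z) * \<phi> z \<partial>lebesgue_on \<Omega>)"
        using integral_mult_bounded_le(1)[OF di m B(2)] integral_mult_bounded_le(1)[OF gi m B(2)]
        by (simp add: left_diff_distrib)
      then show ?thesis
        using integral_mult_bounded_le(2)[OF Bochner_Integration.integrable_diff[OF di gi] m B(2)] by simp
    qed
    then show "\<forall>\<^sub>F k in sequentially. norm ((\<integral>z. dt (U k) z * \<phi> z \<partial>lebesgue_on \<Omega>) - (\<integral>z. g z * \<phi> z \<partial>lebesgue_on \<Omega>))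
        \<le> B * (\<integral>z. \<bar>dt (U k) z - g z\<bar> \<partial>lebesgue_on \<Omega>)" by simp
  qed
  then have "(\<lambda>k. \<integral>z. dt (U k) z * \<phi> z \<partial>lebesgue_on \<Omega>) \<longlonglongrightarrow> (\<integral>z. g z * \<phi> z \<partial>lebesgue_on \<Omega>)"
    by (simp add: LIM_zero_iff)
  from tendsto_add[OF this fl] show ?thesis
    unfolding weak_lhs_def I_eq by simp
qed

text \<open>The limit in the weak inequality may be replaced by the value at index \<open>k\<close>, with an error that depends on
  the test function only through its maximum and its energy. This uniformity is what makes a test function
  built from the \<open>k\<close>-th approximation itself admissible. For the flux, Young's inequality with weight \<open>\<epsilon>\<close> is
  used: the energy of the difference is at most \<open>\<epsilon>\<^sup>2\<close>.\<close>

lemma weak_lhs_limit_error: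
  assumes a: "admissible_coefficients a A" and \<Omega>: "open \<Omega>" "bounded \<Omega>"
    and W: "W_approx a q \<Omega> u U" and \<psi>: "compact_smooth \<psi>" "\<And>z. \<bar>\<psi> z\<bar> \<le> P"
    and S: "(\<integral>z. grad_form a \<psi> \<psi> z \<partial>lebesgue_on \<Omega>) \<le> S" and \<epsilon>: "0 < \<epsilon>"
    and near: "\<And>m. m \<ge> k \<Longrightarrow> (\<integral>z. \<bar>dt (U m) z - dt (U k) z\<bar> \<partial>lebesgue_on \<Omega>) \<le> \<epsilon> \<and>
        (\<integral>z. grad_form a (\<lambda>z. U m z - U k z) (\<lambda>z. U m z - U k z) z \<partial>lebesgue_on \<Omega>) \<le> \<epsilon>\<^sup>2"
    and L: "(\<lambda>m. weak_lhs a \<Omega> (U m) \<psi>) \<longlonglongrightarrow> L"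
  shows "\<bar>L - weak_lhs a \<Omega> (U k) \<psi>\<bar> \<le> P * \<epsilon> + \<epsilon> / 2 * S + \<epsilon> / 2"
proof (rule Lim_bounded)
  show "(\<lambda>m. \<bar>weak_lhs a \<Omega> (U m) \<psi> - weak_lhs a \<Omega> (U k) \<psi>\<bar>) \<longlonglongrightarrow> \<bar>L - weak_lhs a \<Omega> (U k) \<psi>\<bar>"
    by (intro tendsto_intros L)
  let ?M = "lebesgue_on \<Omega>"
  have C: "Cinf_on \<Omega> (U m)" and di: "integrable ?M (dt (U m))" and gi: "integrable ?M (grad_form a (U m) (U m))" for m
    using W by (auto simp: W_approx_def)
  have C\<psi>: "Cinf_on \<Omega> \<psi>" using \<psi> by (auto simp: compact_smooth_def intro: Cinf_on_mono)
  have m\<psi>: "\<psi> \<in> borel_measurable ?M"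
    using C\<psi> by (intro continuous_on_measurable_lebesgue_on[OF \<Omega>(1)] Cinf_on_continuous)
  note i\<psi> = integrable_grad_form_compact_smooth[OF a \<Omega> \<psi>(1)]
  have P: "0 \<le> P" using \<psi>(2)[of undefined] by linarith
  show "\<forall>m\<ge>k. \<bar>weak_lhs a \<Omega> (U m) \<psi> - weak_lhs a \<Omega> (U k) \<psi>\<bar> \<le> P * \<epsilon> + \<epsilon> / 2 * S + \<epsilon> / 2"
  proof (intro allI impI)
    fix m assume m: "k \<le> m"
    let ?d = "\<lambda>z. U m z - U k z"
    have Cd: "Cinf_on \<Omega> ?d" by (rule Cinf_on_diff[OF \<Omega>(1) C C])
    note id = integrable_grad_form_diff(1)[OF a \<Omega>(1) C C gi gi, of m k]
    note i\<psi>d = integrable_grad_form[OF a \<Omega>(1) C\<psi> Cd i\<psi> id]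
    have 1: "(\<integral>z. dt (U m) z * \<psi> z \<partial>?M) - (\<integral>z. dt (U k) z * \<psi> z \<partial>?M) = (\<integral>z. (dt (U m) z - dt (U k) z) * \<psi> z \<partial>?M)"
      using integral_mult_bounded_le(1)[OF di m\<psi> \<psi>(2)] by (simp add: left_diff_distrib)
    have "\<bar>\<integral>z. (dt (U m) z - dt (U k) z) * \<psi> z \<partial>?M\<bar> \<le> P * (\<integral>z. \<bar>dt (U m) z - dt (U k) z\<bar> \<partial>?M)"
      by (rule integral_mult_bounded_le(2)[OF Bochner_Integration.integrable_diff[OF di di] m\<psi> \<psi>(2)])
    also have "\<dots> \<le> P * \<epsilon>" using near[OF m] P by (intro mult_left_mono) auto
    finally have 2: "\<bar>\<integral>z. (dt (U m) z - dt (U k) z) * \<psi> z \<partial>?M\<bar> \<le> P * \<epsilon>" .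
    have 3: "(\<integral>z. grad_form a \<psi> (U m) z \<partial>?M) - (\<integral>z. grad_form a \<psi> (U k) z \<partial>?M) = (\<integral>z. grad_form a \<psi> ?d z \<partial>?M)"
    proof -
      have "(\<integral>z. grad_form a \<psi> (U m) z \<partial>?M) - (\<integral>z. grad_form a \<psi> (U k) z \<partial>?M)
          = (\<integral>z. grad_form a \<psi> (U m) z - grad_form a \<psi> (U k) z \<partial>?M)"
        using integrable_grad_form[OF a \<Omega>(1) C\<psi> C i\<psi> gi] by simp
      also have "\<dots> = (\<integral>z. grad_form a \<psi> ?d z \<partial>?M)"
        by (intro Bochner_Integration.integral_cong refl)
           (simp add: space_restrict_space grad_form_eq xgrad_dt_diff(1)[OF C C] coef_form_diff_right)
      finally show ?thesis .
    qed
    have "\<bar>\<integral>z. grad_form a \<psi> ?d z \<partial>?M\<bar> \<le> (\<integral>z. \<bar>grad_form a \<psi> ?d z\<bar> \<partial>?M)" by (rule integral_abs_bound)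
    also have "\<dots> \<le> (\<integral>z. \<epsilon> / 2 * grad_form a \<psi> \<psi> z + grad_form a ?d ?d z / (2 * \<epsilon>) \<partial>?M)"
    proof (rule integral_mono_AE)
      show "AE z in ?M. \<bar>grad_form a \<psi> ?d z\<bar> \<le> \<epsilon> / 2 * grad_form a \<psi> \<psi> z + grad_form a ?d ?d z / (2 * \<epsilon>)"
        using AE_lebesgue_on_sym_psd[OF a \<Omega>(1)]
        by eventually_elim (auto simp only: grad_form_eq intro!: coef_form_Young \<epsilon>)
    qed (use i\<psi>d i\<psi> id in auto)
    also have "\<dots> = \<epsilon> / 2 * (\<integral>z. grad_form a \<psi> \<psi> z \<partial>?M) + (\<integral>z. grad_form a ?d ?d z \<partial>?M) / (2 * \<epsilon>)"
      using i\<psi> id by simp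
    also have "\<dots> \<le> \<epsilon> / 2 * S + \<epsilon>\<^sup>2 / (2 * \<epsilon>)"
      using S near[OF m] \<epsilon> by (intro add_mono mult_left_mono divide_right_mono) auto
    also have "\<epsilon>\<^sup>2 / (2 * \<epsilon>) = \<epsilon> / 2" using \<epsilon> by (simp add: power2_eq_square)
    finally have 4: "\<bar>\<integral>z. grad_form a \<psi> ?d z \<partial>?M\<bar> \<le> \<epsilon> / 2 * S + \<epsilon> / 2" .
    show "\<bar>weak_lhs a \<Omega> (U m) \<psi> - weak_lhs a \<Omega> (U k) \<psi>\<bar> \<le> P * \<epsilon> + \<epsilon> / 2 * S + \<epsilon> / 2"
      unfolding weak_lhs_def using 1 2 3 4 by linarith
  qed
qed

definition supersolution_sequence ::
    "('n::finite \<Rightarrow> 'n \<Rightarrow> 'n spacetime \<Rightarrow> real) \<Rightarrow> real \<Rightarrow> 'n spacetime set \<Rightarrow> ('n spacetime \<Rightarrow> real)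
      \<Rightarrow> (nat \<Rightarrow> 'n spacetime \<Rightarrow> real) \<Rightarrow> bool" where
  "supersolution_sequence a q \<Omega> u U \<longleftrightarrow> W_approx a q \<Omega> u U \<and>
     (\<forall>\<phi>. test_function \<phi> \<longrightarrow> closure {z. \<phi> z \<noteq> 0} \<subseteq> \<Omega> \<longrightarrow>
       (\<exists>L. (\<lambda>m. weak_lhs a \<Omega> (U m) \<phi>) \<longlonglongrightarrow> L \<and> (\<integral>z. source q (u z) * \<phi> z \<partial>lebesgue_on \<Omega>) \<le> L))"

definition subsolution_sequence ::
    "('n::finite \<Rightarrow> 'n \<Rightarrow> 'n spacetime \<Rightarrow> real) \<Rightarrow> real \<Rightarrow> 'n spacetime set \<Rightarrow> ('n spacetime \<Rightarrow> real)
      \<Rightarrow> (nat \<Rightarrow> 'n spacetime \<Rightarrow> real) \<Rightarrow> bool" where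
  "subsolution_sequence a q \<Omega> v V \<longleftrightarrow> W_approx a q \<Omega> v V \<and>
     (\<forall>\<phi>. test_function \<phi> \<longrightarrow> closure {z. \<phi> z \<noteq> 0} \<subseteq> \<Omega> \<longrightarrow>
       (\<exists>L. (\<lambda>m. weak_lhs a \<Omega> (V m) \<phi>) \<longlonglongrightarrow> L \<and> L \<le> (\<integral>z. source q (v z) * \<phi> z \<partial>lebesgue_on \<Omega>)))"

lemma test_function_imp_compact_smooth: "test_function \<phi> \<Longrightarrow> compact_smooth \<phi>"
  by (simp add: test_function_def compact_smooth_def)

lemma weak_supersolution_sequence:
  assumes a: "admissible_coefficients a A" and q: "1 < q" and u: "weak_supersolution a q u"
    and \<Omega>: "domain_set \<Omega>" "bounded \<Omega>"
  obtains U where "supersolution_sequence a q \<Omega> u U"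
proof -
  obtain X where m: "u \<in> borel_measurable lebesgue" and X: "W_loc_by a q X u"
    and I: "\<And>\<phi>. test_function \<phi> \<Longrightarrow> closure {z. \<phi> z \<noteq> 0} \<subseteq> \<Omega> \<Longrightarrow>
      \<exists>I. weak_integral a q \<Omega> (X \<Omega>) u \<phi> I \<and> I \<ge> 0"
    using u \<Omega> unfolding weak_supersolution_def by blast
  obtain U where U: "U \<in> X \<Omega>" and W: "W_approx a q \<Omega> u U"
    using W_loc_by_imp_W_approx[OF a q m X \<Omega>] by blast
  have o: "open \<Omega>" using \<Omega> by (simp add: domain_set_def)
  have "\<exists>L. (\<lambda>m. weak_lhs a \<Omega> (U m) \<phi>) \<longlonglongrightarrow> L \<and> (\<integral>z. source q (u z) * \<phi> z \<partial>lebesgue_on \<Omega>) \<le> L"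
    if \<phi>: "test_function \<phi>" "closure {z. \<phi> z \<noteq> 0} \<subseteq> \<Omega>" for \<phi>
  proof -
    obtain I where I: "weak_integral a q \<Omega> (X \<Omega>) u \<phi> I" "I \<ge> 0" using I \<phi> by blast
    from weak_integral_imp_weak_lhs_tendsto[OF o W U test_function_imp_compact_smooth[OF \<phi>(1)] I(1)] I(2)
    show ?thesis by (intro exI conjI) auto
  qed
  with W show ?thesis using that unfolding supersolution_sequence_def by blast
qed

lemma weak_subsolution_sequence:
  assumes a: "admissible_coefficients a A" and q: "1 < q" and v: "weak_subsolution a q v"
    and \<Omega>: "domain_set \<Omega>" "bounded \<Omega>"
  obtains V where "subsolution_sequence a q \<Omega> v V"
proof -
  obtain X where m: "v \<in> borel_measurable lebesgue" and X: "W_loc_by a q X v"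
    and I: "\<And>\<phi>. test_function \<phi> \<Longrightarrow> closure {z. \<phi> z \<noteq> 0} \<subseteq> \<Omega> \<Longrightarrow>
      \<exists>I. weak_integral a q \<Omega> (X \<Omega>) v \<phi> I \<and> I \<le> 0"
    using v \<Omega> unfolding weak_subsolution_def by blast
  obtain V where V: "V \<in> X \<Omega>" and W: "W_approx a q \<Omega> v V"
    using W_loc_by_imp_W_approx[OF a q m X \<Omega>] by blast
  have o: "open \<Omega>" using \<Omega> by (simp add: domain_set_def)
  have "\<exists>L. (\<lambda>m. weak_lhs a \<Omega> (V m) \<phi>) \<longlonglongrightarrow> L \<and> L \<le> (\<integral>z. source q (v z) * \<phi> z \<partial>lebesgue_on \<Omega>)"
    if \<phi>: "test_function \<phi>" "closure {z. \<phi> z \<noteq> 0} \<subseteq> \<Omega>" for \<phi>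
  proof -
    obtain I where I: "weak_integral a q \<Omega> (X \<Omega>) v \<phi> I" "I \<le> 0" using I \<phi> by blast
    from weak_integral_imp_weak_lhs_tendsto[OF o W V test_function_imp_compact_smooth[OF \<phi>(1)] I(1)] I(2)
    show ?thesis by (intro exI conjI) auto
  qed
  with W show ?thesis using that unfolding subsolution_sequence_def by blast
qed

section \<open>Testing with a decreasing function of the difference\<close>

lemma integral_dt_compact_smooth:
  assumes "compact_smooth G"
  shows "integrable lebesgue (dt G)" "integral\<^sup>L lebesgue (dt G) = 0"
proof -
  let ?K = "closure {z. G z \<noteq> 0}"
  have C: "Cinf_on UNIV G" and K: "compact ?K" using assms by (auto simp: compact_smooth_def)
  have der: "((\<lambda>t. G (t, x)) has_real_derivative dt G (t, x)) (at t)" for t x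
  proof -
    have d: "(G has_derivative frechet_derivative G (at (t, x))) (at (t, x))"
      using Cinf_on_has_derivative[OF C] by simp
    have p: "((\<lambda>t. (t, x)) has_derivative (\<lambda>s. (s, 0))) (at t)"
      by (auto intro!: derivative_eq_intros)
    from diff_chain_at[OF p d]
    have "((\<lambda>t. G (t, x)) has_derivative (\<lambda>s. frechet_derivative G (at (t, x)) (s, 0))) (at t)"
      unfolding o_def .
    moreover have "frechet_derivative G (at (t, x)) (s, 0) = dt G (t, x) * s" for s
      using linear_scale[OF has_derivative_linear[OF d], of s "(1, 0)"] by (simp add: dt_def)
    ultimately show ?thesis unfolding has_field_derivative_def by simp
  qed
  have 0: "G z = 0" "dt G z = 0" if "z \<notin> ?K" for z
    using derivative_outside_support[OF that] closure_subset[of "{z. G z \<noteq> 0}"] that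
    by (auto simp: dt_def)
  show "integrable lebesgue (dt G)" "integral\<^sup>L lebesgue (dt G) = 0"
    using integral_time_derivative_eq_0[OF der Cinf_on_continuous_dt[OF C] compact_imp_bounded[OF K] 0]
    by blast+
qed

text \<open>The approximations are smooth on \<open>\<Omega>\<close> only, but the product with \<open>\<phi>\<close> vanishes outside the support of \<open>\<phi>\<close>,
  and the two open sets \<open>\<Omega>\<close> and the complement of the support cover everything.\<close>

lemma compact_smooth_cut_off:
  fixes h :: "real \<Rightarrow> real"
  assumes \<Omega>: "open \<Omega>" and w: "Cinf_on \<Omega> w" and h: "Cinf_on UNIV h"
    and \<phi>: "compact_smooth \<phi>" and supp: "closure {z. \<phi> z \<noteq> 0} \<subseteq> \<Omega>"
  shows "compact_smooth (\<lambda>z. h (w z / \<omega>) * \<phi> z)"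
    "closure {z. h (w z / \<omega>) * \<phi> z \<noteq> 0} \<subseteq> closure {z. \<phi> z \<noteq> 0}"
proof -
  let ?K = "closure {z. \<phi> z \<noteq> 0}"
  let ?\<psi> = "\<lambda>z. h (w z / \<omega>) * \<phi> z"
  show sub: "closure {z. ?\<psi> z \<noteq> 0} \<subseteq> ?K" by (intro closure_mono) auto
  have C\<phi>: "Cinf_on UNIV \<phi>" and K: "compact ?K" using \<phi> by (auto simp: compact_smooth_def)
  have "Cinf_on \<Omega> (\<lambda>z. w z * (1 / \<omega>))"
    by (intro Cinf_on_mult[OF \<Omega> w] Cinf_on_const)
  then have "Cinf_on \<Omega> (\<lambda>z. w z / \<omega>)" by simp
  then have "Cinf_on \<Omega> (\<lambda>z. h (w z / \<omega>))"
    by (intro Cinf_on_compose[OF \<Omega> open_UNIV _ h]) auto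
  then have 1: "Cinf_on \<Omega> ?\<psi>"
    using Cinf_on_mono[OF C\<phi>, of \<Omega>] by (intro Cinf_on_mult[OF \<Omega>]) auto
  have 2: "Cinf_on (- ?K) ?\<psi>"
  proof (rule Cinf_on_cong[of _ "\<lambda>_. 0"])
    show "0 = ?\<psi> z" if "z \<in> - ?K" for z
      using that closure_subset[of "{z. \<phi> z \<noteq> 0}"] by auto
  qed (auto intro: Cinf_on_const)
  have "Cinf_on (\<Omega> \<union> - ?K) ?\<psi>" by (rule Cinf_on_Un[OF \<Omega> _ 1 2]) auto
  moreover have "\<Omega> \<union> - ?K = UNIV" using supp by auto
  moreover have "compact (closure {z. ?\<psi> z \<noteq> 0})"
    using compact_closure[of "{z. ?\<psi> z \<noteq> 0}"] bounded_subset[OF compact_imp_bounded[OF K]] sub closure_subset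
    by (meson order_trans)
  ultimately show "compact_smooth ?\<psi>" unfolding compact_smooth_def by simp
qed

lemma W_approx_form_bounded:
  assumes a: "admissible_coefficients a A" and \<Omega>: "open \<Omega>" and W: "W_approx a q \<Omega> u U"
  obtains N S where "0 \<le> S" "\<And>k. k \<ge> N \<Longrightarrow> (\<integral>z. grad_form a (U k) (U k) z \<partial>lebesgue_on \<Omega>) \<le> S"
proof -
  have C: "Cinf_on \<Omega> (U m)" and gi: "integrable (lebesgue_on \<Omega>) (grad_form a (U m) (U m))" for m
    using W by (auto simp: W_approx_def)
  obtain N where N: "\<And>k m. k \<ge> N \<Longrightarrow> m \<ge> N \<Longrightarrow>
      (\<integral>z. grad_form a (\<lambda>z. U k z - U m z) (\<lambda>z. U k z - U m z) z \<partial>lebesgue_on \<Omega>) \<le> 1\<^sup>2"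
    using W unfolding W_approx_def by (meson zero_less_one)
  let ?S = "2 * (\<integral>z. grad_form a (U N) (U N) z \<partial>lebesgue_on \<Omega>) + 2"
  have "(\<integral>z. grad_form a (U k) (U k) z \<partial>lebesgue_on \<Omega>) \<le> ?S" if "k \<ge> N" for k
  proof -
    have "(\<integral>z. grad_form a (U k) (U k) z \<partial>lebesgue_on \<Omega>) \<le>
        2 * (\<integral>z. grad_form a (U N) (U N) z \<partial>lebesgue_on \<Omega>) +
        2 * (\<integral>z. grad_form a (\<lambda>z. U N z - U k z) (\<lambda>z. U N z - U k z) z \<partial>lebesgue_on \<Omega>)"
      using integrable_grad_form_diff(2)[OF a \<Omega> C Cinf_on_diff[OF \<Omega> C C] gi
          integrable_grad_form_diff(1)[OF a \<Omega> C C gi gi], of N N k]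
      by simp
    with N[of N k] that show ?thesis by simp
  qed
  moreover have "0 \<le> ?S" using grad_form_integral_nonneg[OF a \<Omega>, of "U N"] by simp
  ultimately show ?thesis using that by blast
qed

text \<open>The bound needed to apply \<open>weak_lhs_limit_error\<close> uniformly along the sequence: \<open>h\<close> and \<open>k\<close> are bounded, so
  the energy of the damped test function is controlled by those of \<open>\<phi>\<close> and \<open>w\<close>.\<close>

lemma damped_test_energy_bound:
  assumes a: "admissible_coefficients a A" and \<Omega>: "open \<Omega>" "bounded \<Omega>"
    and w: "Cinf_on \<Omega> w" "integrable (lebesgue_on \<Omega>) (grad_form a w w)"
    and \<phi>: "compact_smooth \<phi>" "\<And>z. \<bar>\<phi> z\<bar> \<le> 1" and supp: "closure {z. \<phi> z \<noteq> 0} \<subseteq> \<Omega>" and \<omega>: "0 < \<omega>"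
    and h: "Cinf_on UNIV h" "\<And>y. (h has_real_derivative - k y) (at y)" "\<And>y. \<bar>h y\<bar> \<le> B" "\<And>y. \<bar>k y\<bar> \<le> K"
  shows "(\<integral>z. grad_form a (\<lambda>z. h (w z / \<omega>) * \<phi> z) (\<lambda>z. h (w z / \<omega>) * \<phi> z) z \<partial>lebesgue_on \<Omega>) \<le>
    2 * B\<^sup>2 * (\<integral>z. grad_form a \<phi> \<phi> z \<partial>lebesgue_on \<Omega>) + 2 * (K / \<omega>)\<^sup>2 * (\<integral>z. grad_form a w w z \<partial>lebesgue_on \<Omega>)"
proof -
  let ?\<psi> = "\<lambda>z. h (w z / \<omega>) * \<phi> z"
  let ?M = "lebesgue_on \<Omega>"
  have C\<phi>: "Cinf_on \<Omega> \<phi>" using \<phi> by (auto simp: compact_smooth_def intro: Cinf_on_mono)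
  note i\<phi> = integrable_grad_form_compact_smooth[OF a \<Omega> \<phi>(1)]
  have cs: "compact_smooth ?\<psi>" by (rule compact_smooth_cut_off[OF \<Omega>(1) w(1) h(1) \<phi>(1) supp])
  have "(\<integral>z. grad_form a ?\<psi> ?\<psi> z \<partial>?M) \<le>
     (\<integral>z. 2 * B\<^sup>2 * grad_form a \<phi> \<phi> z + 2 * (K / \<omega>)\<^sup>2 * grad_form a w w z \<partial>?M)"
  proof (rule integral_mono_AE)
    show "AE z in ?M. grad_form a ?\<psi> ?\<psi> z \<le> 2 * B\<^sup>2 * grad_form a \<phi> \<phi> z + 2 * (K / \<omega>)\<^sup>2 * grad_form a w w z"
      using AE_lebesgue_on_sym_psd[OF a \<Omega>(1)]
    proof eventually_elim
      case (elim z)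
      then have z: "z \<in> \<Omega>" "sym_psd a A z" by auto
      let ?h = "h (w z / \<omega>)" and ?c = "k (w z / \<omega>) * \<phi> z / \<omega>"
      have grad: "xgrad ?\<psi> z = ?h *\<^sub>R xgrad \<phi> z - ?c *\<^sub>R xgrad w z"
        by (rule damped_test_gradient[OF w(1) C\<phi> z(1) _ h(2)]) (use \<omega> in auto)
      have "grad_form a ?\<psi> ?\<psi> z \<le> 2 * (?h\<^sup>2 * grad_form a \<phi> \<phi> z) + 2 * (?c\<^sup>2 * grad_form a w w z)"
        unfolding grad_form_eq grad
        using coef_form_diff_le[OF z(2), of "?h *\<^sub>R xgrad \<phi> z" "?c *\<^sub>R xgrad w z"]
        by (simp add: coef_form_scale_left coef_form_scale_right power2_eq_square mult.assoc)
      also have "\<dots> \<le> 2 * (B\<^sup>2 * grad_form a \<phi> \<phi> z) + 2 * ((K / \<omega>)\<^sup>2 * grad_form a w w z)"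
      proof (intro add_mono mult_left_mono mult_right_mono)
        show "?h\<^sup>2 \<le> B\<^sup>2" using h(3)[of "w z / \<omega>"] by (simp add: abs_le_square_iff[symmetric])
        have "\<bar>?c\<bar> \<le> K * 1 / \<omega>"
          unfolding abs_divide abs_mult using h(4)[of "w z / \<omega>"] \<phi>(2)[of z] \<omega>
          by (intro divide_mono mult_mono) auto
        then have "\<bar>?c\<bar> \<le> \<bar>K / \<omega>\<bar>" by linarith
        then show "?c\<^sup>2 \<le> (K / \<omega>)\<^sup>2" by (rule abs_le_square_iff[THEN iffD1])
      qed (auto simp: grad_form_eq coef_form_nonneg[OF z(2)])
      finally show ?case by (simp add: mult.assoc)
    qed
  qed (use integrable_grad_form_compact_smooth[OF a \<Omega> cs] i\<phi> w(2) in auto)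
  also have "\<dots> = 2 * B\<^sup>2 * (\<integral>z. grad_form a \<phi> \<phi> z \<partial>?M) + 2 * (K / \<omega>)\<^sup>2 * (\<integral>z. grad_form a w w z \<partial>?M)"
    using i\<phi> w(2) by simp
  finally show ?thesis .
qed

text \<open>The product of the time derivative of \<open>w\<close> with \<open>h(w / \<omega>)\<close> is the time derivative of \<open>\<omega> H(w / \<omega>)\<close>; integrating by
  parts moves it to \<open>\<phi>\<close>.\<close>

lemma damped_time_term:
  assumes \<Omega>: "open \<Omega>" and w: "Cinf_on \<Omega> w" "integrable (lebesgue_on \<Omega>) (dt w)" "integrable (lebesgue_on \<Omega>) w"
    and \<phi>: "compact_smooth \<phi>" and supp: "closure {z. \<phi> z \<noteq> 0} \<subseteq> \<Omega>" and \<omega>: "0 < \<omega>"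
    and h: "Cinf_on UNIV h" "\<And>y. \<bar>h y\<bar> \<le> B"
    and H: "\<And>y. (H has_real_derivative h y) (at y)" "\<And>y. \<bar>H y\<bar> \<le> B * \<bar>y\<bar>"
  shows "(\<integral>z. dt w z * (h (w z / \<omega>) * \<phi> z) \<partial>lebesgue_on \<Omega>) \<le> B * (\<integral>z. \<bar>w z\<bar> * \<bar>dt \<phi> z\<bar> \<partial>lebesgue_on \<Omega>)"
proof -
  let ?M = "lebesgue_on \<Omega>"
  let ?G = "\<lambda>z. H (w z / \<omega>) * \<phi> z"
  have C\<phi>: "Cinf_on UNIV \<phi>" "Cinf_on \<Omega> \<phi>" using \<phi> by (auto simp: compact_smooth_def intro: Cinf_on_mono)
  have CH: "Cinf_on UNIV H" by (rule Cinf_on_antiderivative[OF _ H(1) h(1)]) auto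
  have cs: "compact_smooth ?G" and sG: "closure {z. ?G z \<noteq> 0} \<subseteq> closure {z. \<phi> z \<noteq> 0}"
    using compact_smooth_cut_off[OF \<Omega> w(1) CH \<phi> supp] by auto
  have cs\<psi>: "compact_smooth (\<lambda>z. h (w z / \<omega>) * \<phi> z)"
    by (rule compact_smooth_cut_off[OF \<Omega> w(1) h(1) \<phi> supp])
  have dG: "dt ?G z = H (w z / \<omega>) * dt \<phi> z + dt w z * (h (w z / \<omega>) * \<phi> z) / \<omega>" if z: "z \<in> \<Omega>" for z
  proof -
    note dw = Cinf_on_has_derivative[OF w(1) z]
    have dg: "((\<lambda>x. H (x / \<omega>)) has_real_derivative h (w z / \<omega>) * (1 / \<omega>)) (at (w z))"
      using DERIV_chain2[OF H(1), of "\<lambda>x. x / \<omega>" "1 / \<omega>"] DERIV_cdivide[OF DERIV_ident, of \<omega>] by blast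
    have dh: "((\<lambda>z. H (w z / \<omega>)) has_derivative (\<lambda>b. (h (w z / \<omega>) * (1 / \<omega>)) * frechet_derivative w (at z) b)) (at z)"
      using diff_chain_at[OF dw dg[unfolded has_field_derivative_def]] unfolding o_def .
    show ?thesis
      unfolding xgrad_dt_mult(2)[OF dh Cinf_on_has_derivative[OF C\<phi>(2) z]] xgrad_dt_chain(2)[OF dw dg]
      by simp
  qed
  have dG': "\<omega> * dt ?G z = \<omega> * H (w z / \<omega>) * dt \<phi> z + dt w z * (h (w z / \<omega>) * \<phi> z)" if z: "z \<in> \<Omega>" for z
    using \<omega> by (simp only: dG[OF z] distrib_left) simp
  have out: "dt ?G z = 0" if "z \<notin> \<Omega>" for z
    using derivative_outside_support[of z ?G] that sG supp by (auto simp: dt_def)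
  have "(\<integral>z. dt ?G z \<partial>?M) = integral\<^sup>L lebesgue (\<lambda>z. indicator \<Omega> z *\<^sub>R dt ?G z)"
    by (rule integral_restrict_space) (simp add: open_in_sets_lebesgue[OF \<Omega>])
  also have "(\<lambda>z. indicator \<Omega> z *\<^sub>R dt ?G z) = dt ?G"
    using out by (auto simp: indicator_def fun_eq_iff)
  also have "integral\<^sup>L lebesgue (dt ?G) = 0" by (rule integral_dt_compact_smooth[OF cs])
  finally have 0: "(\<integral>z. dt ?G z \<partial>?M) = 0" .
  obtain B\<psi> where B\<psi>: "\<And>z. \<bar>h (w z / \<omega>) * \<phi> z\<bar> \<le> B\<psi>" using compact_smooth_bounded[OF cs\<psi>] by metis
  have m\<psi>: "(\<lambda>z. h (w z / \<omega>) * \<phi> z) \<in> borel_measurable ?M"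
    using cs\<psi> by (intro continuous_on_measurable_lebesgue_on[OF \<Omega>] Cinf_on_continuous)
      (auto simp: compact_smooth_def intro: Cinf_on_mono)
  have i1: "integrable ?M (\<lambda>z. dt w z * (h (w z / \<omega>) * \<phi> z))"
    by (rule integral_mult_bounded_le(1)[OF w(2) m\<psi> B\<psi>])
  obtain B\<phi> where B\<phi>: "\<And>z. \<bar>dt \<phi> z\<bar> \<le> B\<phi>" using compact_smooth_bounded[OF \<phi>] by metis
  have m\<phi>: "dt \<phi> \<in> borel_measurable ?M"
    by (intro continuous_on_measurable_lebesgue_on[OF \<Omega>] Cinf_on_continuous_dt C\<phi>)
  have i2: "integrable ?M (\<lambda>z. \<bar>w z\<bar> * \<bar>dt \<phi> z\<bar>)"
    by (rule integral_mult_bounded_le(1)[where B = B\<phi>]) (use w(3) m\<phi> B\<phi> in auto)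
  have le: "\<bar>\<omega> * H (w z / \<omega>) * dt \<phi> z\<bar> \<le> B * (\<bar>w z\<bar> * \<bar>dt \<phi> z\<bar>)" for z
  proof -
    have "\<omega> * \<bar>H (w z / \<omega>)\<bar> \<le> \<omega> * (B * \<bar>w z / \<omega>\<bar>)" using \<omega> by (intro mult_left_mono H(2)) auto
    then have "\<omega> * \<bar>H (w z / \<omega>)\<bar> \<le> B * \<bar>w z\<bar>" using \<omega> by simp
    then have "\<omega> * \<bar>H (w z / \<omega>)\<bar> * \<bar>dt \<phi> z\<bar> \<le> B * \<bar>w z\<bar> * \<bar>dt \<phi> z\<bar>" by (intro mult_right_mono) auto
    then show ?thesis using \<omega> by (simp add: abs_mult mult.assoc)
  qed
  have mw: "w \<in> borel_measurable ?M" using w(3) by auto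
  have [measurable]: "H \<in> borel_measurable borel"
    using Cinf_on_continuous[OF CH] by (rule borel_measurable_continuous_onI)
  have i3: "integrable ?M (\<lambda>z. \<omega> * H (w z / \<omega>) * dt \<phi> z)"
  proof (rule Bochner_Integration.integrable_bound)
    show "integrable ?M (\<lambda>z. B * (\<bar>w z\<bar> * \<bar>dt \<phi> z\<bar>))" using i2 by simp
    show "(\<lambda>z. \<omega> * H (w z / \<omega>) * dt \<phi> z) \<in> borel_measurable ?M" using mw m\<phi> by measurable
    show "AE z in ?M. norm (\<omega> * H (w z / \<omega>) * dt \<phi> z) \<le> norm (B * (\<bar>w z\<bar> * \<bar>dt \<phi> z\<bar>))"
      using le by (auto intro!: AE_I2 order.trans[OF le abs_ge_self])
  qed
  have "(\<integral>z. dt w z * (h (w z / \<omega>) * \<phi> z) \<partial>?M) = (\<integral>z. \<omega> * dt ?G z - \<omega> * H (w z / \<omega>) * dt \<phi> z \<partial>?M)"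
    by (intro Bochner_Integration.integral_cong refl)
       (simp add: space_restrict_space dG')
  also have "\<dots> = - (\<integral>z. \<omega> * H (w z / \<omega>) * dt \<phi> z \<partial>?M)"
  proof -
    have "integrable ?M (\<lambda>z. \<omega> * H (w z / \<omega>) * dt \<phi> z + dt w z * (h (w z / \<omega>) * \<phi> z))"
      using i1 i3 by simp
    also have "?this \<longleftrightarrow> integrable ?M (\<lambda>z. \<omega> * dt ?G z)"
      by (intro Bochner_Integration.integrable_cong refl)
         (simp add: space_restrict_space dG')
    finally show ?thesis using i3 0 by simp
  qed
  also have "\<dots> \<le> (\<integral>z. \<bar>\<omega> * H (w z / \<omega>) * dt \<phi> z\<bar> \<partial>?M)"
    using integral_abs_bound[of ?M "\<lambda>z. \<omega> * H (w z / \<omega>) * dt \<phi> z"] by linarith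
  also have "\<dots> \<le> (\<integral>z. B * (\<bar>w z\<bar> * \<bar>dt \<phi> z\<bar>) \<partial>?M)"
    using i2 i3 le by (intro integral_mono) auto
  finally show ?thesis using i2 by simp
qed

lemma source_mult_integrable:
  assumes \<Omega>: "open \<Omega>" and q: "1 < q" and W: "W_approx a q \<Omega> u U"
    and \<phi>: "\<phi> \<in> borel_measurable (lebesgue_on \<Omega>)" "\<And>z. \<bar>\<phi> z\<bar> \<le> B"
  shows "integrable (lebesgue_on \<Omega>) (\<lambda>z. source q (u z) * \<phi> z)"
proof (rule integral_mult_bounded_le(1)[OF _ \<phi>])
  have [measurable]: "u \<in> borel_measurable (lebesgue_on \<Omega>)" using W by (simp add: W_approx_def)
  have iu: "integrable (lebesgue_on \<Omega>) (\<lambda>z. \<bar>u z\<bar> powr q)" using W by (simp add: W_approx_def)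
  have eq: "\<bar>source q y\<bar> = \<bar>y\<bar> powr q" for y
    using powr_add[of "\<bar>y\<bar>" "q - 1" 1] by (simp add: source_def abs_mult)
  show "integrable (lebesgue_on \<Omega>) (\<lambda>z. source q (u z))"
  proof (rule Bochner_Integration.integrable_bound[OF iu])
    show "(\<lambda>z. source q (u z)) \<in> borel_measurable (lebesgue_on \<Omega>)" unfolding source_def by measurable
  qed (simp add: eq)
qed

lemma source_mono:
  assumes "1 < q" "v \<le> u" shows "source q v \<le> source q u"
proof -
  have pos: "source q x \<le> source q y" if "0 \<le> x" "x \<le> y" for x y
    unfolding source_def using that assms by (intro mult_mono powr_mono2) auto
  have neg: "source q x = - source q (- x)" for x by (simp add: source_def)
  have ge: "0 \<le> source q x" if "0 \<le> x" for x using that by (simp add: source_def)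
  show ?thesis
  proof (cases "0 \<le> v")
    case True then show ?thesis using pos assms by auto
  next
    case False
    show ?thesis
    proof (cases "0 \<le> u")
      case True
      then show ?thesis using ge[of u] ge[of "- v"] neg[of v] False by linarith
    next
      case u: False
      then show ?thesis using pos[of "- u" "- v"] neg[of u] neg[of v] assms by linarith
    qed
  qed
qed

lemma W_approx_diff:
  assumes \<Omega>: "open \<Omega>" and q: "1 < q" and U: "W_approx a q \<Omega> u U" and V: "W_approx a q \<Omega> v V"
  shows "\<And>k. integrable (lebesgue_on \<Omega>) (\<lambda>z. \<bar>(U k z - V k z) - (u z - v z)\<bar> powr q)"
    "(\<lambda>k. \<integral>z. \<bar>(U k z - V k z) - (u z - v z)\<bar> powr q \<partial>lebesgue_on \<Omega>) \<longlonglongrightarrow> 0"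
proof -
  let ?M = "lebesgue_on \<Omega>"
  have [measurable]: "u \<in> borel_measurable ?M" "v \<in> borel_measurable ?M"
    using U V by (auto simp: W_approx_def)
  have [measurable]: "U k \<in> borel_measurable ?M" "V k \<in> borel_measurable ?M" for k
    using U V by (auto simp: W_approx_def intro!: continuous_on_measurable_lebesgue_on[OF \<Omega>] Cinf_on_continuous)
  have iU: "integrable ?M (\<lambda>z. \<bar>U k z - u z\<bar> powr q)" for k
    using U q by (intro integrable_powr_diff) (auto simp: W_approx_def)
  have iV: "integrable ?M (\<lambda>z. \<bar>V k z - v z\<bar> powr q)" for k
    using V q by (intro integrable_powr_diff) (auto simp: W_approx_def)
  have i: "integrable ?M (\<lambda>z. \<bar>(U k z - V k z) - (u z - v z)\<bar> powr q)" for k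
    using integrable_powr_diff[OF _ _ _ iU iV, of k k] q by (simp add: algebra_simps)
  then show "\<And>k. integrable ?M (\<lambda>z. \<bar>(U k z - V k z) - (u z - v z)\<bar> powr q)" .
  show "(\<lambda>k. \<integral>z. \<bar>(U k z - V k z) - (u z - v z)\<bar> powr q \<partial>?M) \<longlonglongrightarrow> 0"
  proof (rule Lim_null_comparison)
    show "(\<lambda>k. 2 powr q * ((\<integral>z. \<bar>U k z - u z\<bar> powr q \<partial>?M) + (\<integral>z. \<bar>V k z - v z\<bar> powr q \<partial>?M))) \<longlonglongrightarrow> 0"
      using tendsto_mult[OF tendsto_const tendsto_add, of "\<lambda>k. \<integral>z. \<bar>U k z - u z\<bar> powr q \<partial>?M" 0
          sequentially "\<lambda>k. \<integral>z. \<bar>V k z - v z\<bar> powr q \<partial>?M" 0 "2 powr q"] U V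
      by (simp add: W_approx_def)
    have "(\<integral>z. \<bar>(U k z - V k z) - (u z - v z)\<bar> powr q \<partial>?M) \<le>
      2 powr q * ((\<integral>z. \<bar>U k z - u z\<bar> powr q \<partial>?M) + (\<integral>z. \<bar>V k z - v z\<bar> powr q \<partial>?M))" for k
    proof -
      have "(\<integral>z. \<bar>(U k z - V k z) - (u z - v z)\<bar> powr q \<partial>?M) \<le>
         (\<integral>z. 2 powr q * (\<bar>U k z - u z\<bar> powr q + \<bar>V k z - v z\<bar> powr q) \<partial>?M)"
      proof (rule integral_mono[OF i])
        show "\<bar>(U k z - V k z) - (u z - v z)\<bar> powr q \<le> 2 powr q * (\<bar>U k z - u z\<bar> powr q + \<bar>V k z - v z\<bar> powr q)" for z
          using powr_sum_le[of q "U k z - u z" "- (V k z - v z)"] q abs_minus_commute[of "V k z" "v z"]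
          by (simp add: algebra_simps)
      qed (use iU iV in auto)
      then show ?thesis using iU iV by simp
    qed
    then show "\<forall>\<^sub>F k in sequentially. norm (\<integral>z. \<bar>(U k z - V k z) - (u z - v z)\<bar> powr q \<partial>?M) \<le>
      2 powr q * ((\<integral>z. \<bar>U k z - u z\<bar> powr q \<partial>?M) + (\<integral>z. \<bar>V k z - v z\<bar> powr q \<partial>?M))"
      by (simp add: integral_nonneg_AE)
  qed
qed

text \<open>Both weak inequalities are tested with \<open>\<psi>\<^sub>m = h(w\<^sub>m / \<omega>) \<zeta>\<^sup>s\<close>, where \<open>w\<^sub>m\<close> is the difference of the \<open>m\<close>-th
  approximations, and subtracted. Although \<open>w\<^sub>m\<close> may take negative values, \<open>\<psi>\<^sub>m\<close> is a genuine test function,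
  since \<open>h\<close> is smooth and positive on the whole line, and all products and compositions are differentiated
  classically. As \<open>h \<ge> 1\<close>, the source term only decreases when \<open>\<psi>\<^sub>m\<close> is replaced by \<open>\<zeta>\<^sup>s\<close>.
  In the limit the approximations disappear from the right-hand side, because it contains no derivatives of
  them any more.\<close>

lemma tested_inequality:
  fixes a :: "'n::finite \<Rightarrow> 'n \<Rightarrow> 'n spacetime \<Rightarrow> real" and h k H :: "real \<Rightarrow> real"
  assumes h: "Cinf_on UNIV h" "\<And>y. (h has_real_derivative - k y) (at y)"
    "\<And>y. 1 \<le> h y" "\<And>y. h y \<le> 2" "\<And>y. 0 < k y" "\<And>y. k y \<le> K"
    and hk: "\<And>y. (h y)\<^sup>2 \<le> C * (1 + \<bar>y\<bar> powr p) * k y"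
    and H: "\<And>y. (H has_real_derivative h y) (at y)" "\<And>y. \<bar>H y\<bar> \<le> 2 * \<bar>y\<bar>"
    and C: "0 < C" and p: "1 < p" "p < q" and s: "2 \<le> s"
    and a: "admissible_coefficients a A" and \<Omega>: "domain_set \<Omega>" "bounded \<Omega>"
    and superU: "supersolution_sequence a q \<Omega> u U" and subV: "subsolution_sequence a q \<Omega> v V"
    and uv: "AE z in lebesgue. u z \<ge> v z"
    and \<zeta>: "compact_smooth \<zeta>" "\<And>z. 0 \<le> \<zeta> z" "\<And>z. \<zeta> z \<le> 1" "closure {z. \<zeta> z \<noteq> 0} \<subseteq> \<Omega>"
    and \<omega>: "0 < \<omega>"
  shows "(\<integral>z. (source q (u z) - source q (v z)) * \<zeta> z ^ s \<partial>lebesgue_on \<Omega>) \<le>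
     2 * (\<integral>z. \<bar>u z - v z\<bar> * \<bar>dt (\<lambda>z. \<zeta> z ^ s) z\<bar> \<partial>lebesgue_on \<Omega>) +
     \<omega> * (real s)\<^sup>2 / 4 * C * 2 powr p *
       (\<integral>z. (1 + \<bar>(u z - v z) / \<omega>\<bar> powr p) * (\<zeta> z ^ (s - 2) * grad_form a \<zeta> \<zeta> z) \<partial>lebesgue_on \<Omega>)"
proof -
  let ?M = "lebesgue_on \<Omega>"
  define \<phi> where "\<phi> = (\<lambda>z. \<zeta> z ^ s)"
  define w where "w = (\<lambda>m z. U m z - V m z)"
  define \<psi> where "\<psi> = (\<lambda>m z. h (w m z / \<omega>) * \<phi> z)"
  define \<theta> where "\<theta> = (\<lambda>z. \<zeta> z ^ (s - 2) * grad_form a \<zeta> \<zeta> z)"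
  have U: "W_approx a q \<Omega> u U" using superU by (simp add: supersolution_sequence_def)
  have V: "W_approx a q \<Omega> v V" using subV by (simp add: subsolution_sequence_def)
  have o: "open \<Omega>" using \<Omega> by (simp add: domain_set_def)
  interpret finite_measure ?M by (rule finite_measure_lebesgue_on[OF o \<Omega>(2)])
  have fin: "finite_measure ?M" by (rule finite_measure_lebesgue_on[OF o \<Omega>(2)])
  have s0: "s \<noteq> 0" using s by simp
  have Uf: "Cinf_on \<Omega> (U m)" "integrable ?M (dt (U m))" "integrable ?M (grad_form a (U m) (U m))"
    "integrable ?M (\<lambda>z. \<bar>U m z\<bar> powr q)" for m
    using U by (auto simp: W_approx_def)
  have Vf: "Cinf_on \<Omega> (V m)" "integrable ?M (dt (V m))" "integrable ?M (grad_form a (V m) (V m))"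
    "integrable ?M (\<lambda>z. \<bar>V m z\<bar> powr q)" for m
    using V by (auto simp: W_approx_def)
  have uf: "u \<in> borel_measurable ?M" "integrable ?M (\<lambda>z. \<bar>u z\<bar> powr q)"
    and vf: "v \<in> borel_measurable ?M" "integrable ?M (\<lambda>z. \<bar>v z\<bar> powr q)"
    using U V by (auto simp: W_approx_def)
  note [measurable] = uf(1) vf(1)
  have Cw: "Cinf_on \<Omega> (w m)" for m unfolding w_def by (rule Cinf_on_diff[OF o Uf(1) Vf(1)])
  have mw[measurable]: "w m \<in> borel_measurable ?M" for m
    by (intro continuous_on_measurable_lebesgue_on[OF o] Cinf_on_continuous Cw)
  have gw: "integrable ?M (grad_form a (w m) (w m))" for m
    unfolding w_def by (rule integrable_grad_form_diff(1)[OF a o Uf(1) Vf(1) Uf(3) Vf(3)])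
  have dw: "dt (w m) z = dt (U m) z - dt (V m) z" if "z \<in> \<Omega>" for m z
    unfolding w_def by (rule xgrad_dt_diff(2)[OF Uf(1) Vf(1) that])
  have idw: "integrable ?M (dt (w m))" for m
  proof -
    have "integrable ?M (\<lambda>z. dt (U m) z - dt (V m) z)" using Uf(2) Vf(2) by simp
    also have "?this \<longleftrightarrow> ?thesis"
      by (intro Bochner_Integration.integrable_cong refl) (simp add: space_restrict_space dw)
    finally show ?thesis .
  qed
  have C\<zeta>: "Cinf_on UNIV \<zeta>" "Cinf_on \<Omega> \<zeta>" using \<zeta> by (auto simp: compact_smooth_def intro: Cinf_on_mono)
  have supp\<phi>: "{z. \<phi> z \<noteq> 0} = {z. \<zeta> z \<noteq> 0}" using s0 by (simp add: \<phi>_def)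
  have C\<phi>: "Cinf_on UNIV \<phi>" "Cinf_on \<Omega> \<phi>"
    unfolding \<phi>_def by (auto intro: Cinf_on_power o C\<zeta>)
  have \<phi>: "compact_smooth \<phi>" using C\<phi> \<zeta>(1) unfolding compact_smooth_def supp\<phi> by simp
  have s\<phi>: "closure {z. \<phi> z \<noteq> 0} \<subseteq> \<Omega>" using \<zeta>(4) supp\<phi> by simp
  have \<phi>01: "0 \<le> \<phi> z" "\<phi> z \<le> 1" for z using \<zeta>(2,3)[of z] by (auto simp: \<phi>_def power_le_one)
  have m\<phi>[measurable]: "\<phi> \<in> borel_measurable ?M"
    by (intro continuous_on_measurable_lebesgue_on[OF o] Cinf_on_continuous C\<phi>)
  have m\<zeta>[measurable]: "\<zeta> \<in> borel_measurable ?M"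
    by (intro continuous_on_measurable_lebesgue_on[OF o] Cinf_on_continuous C\<zeta>)
  have \<psi>cs: "compact_smooth (\<psi> m)" and s\<psi>: "closure {z. \<psi> m z \<noteq> 0} \<subseteq> \<Omega>" for m
    using compact_smooth_cut_off[OF o Cw h(1) \<phi> s\<phi>, of m \<omega>] s\<phi> unfolding \<psi>_def by auto
  have hpos: "0 < h y" for y using h(3)[of y] by linarith
  have \<psi>0: "0 \<le> \<psi> m z" for m z unfolding \<psi>_def using \<phi>01(1) hpos by (simp add: less_imp_le)
  have \<psi>2: "\<bar>\<psi> m z\<bar> \<le> 2" for m z
    unfolding \<psi>_def abs_mult using mult_mono[of "\<bar>h (w m z / \<omega>)\<bar>" 2 "\<bar>\<phi> z\<bar>" 1] h(3,4)[of "w m z / \<omega>"] \<phi>01[of z]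
    by simp
  have \<psi>\<phi>: "\<phi> z \<le> \<psi> m z" for m z
    unfolding \<psi>_def using mult_right_mono[OF h(3) \<phi>01(1)] by simp
  have test: "test_function (\<psi> m)" for m
    using \<psi>cs[of m] \<psi>0 by (simp add: test_function_def compact_smooth_def)
  have C\<psi>: "Cinf_on \<Omega> (\<psi> m)" for m using \<psi>cs[of m] by (auto simp: compact_smooth_def intro: Cinf_on_mono)
  have m\<psi>[measurable]: "\<psi> m \<in> borel_measurable ?M" for m
    by (intro continuous_on_measurable_lebesgue_on[OF o] Cinf_on_continuous C\<psi>)
  note i\<psi> = integrable_grad_form_compact_smooth[OF a o \<Omega>(2) \<psi>cs]
  note iu\<psi> = source_mult_integrable[OF o _ U m\<psi> \<psi>2] and iv\<psi> = source_mult_integrable[OF o _ V m\<psi> \<psi>2]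
  have q1: "1 < q" using p by simp
  have \<phi>1: "\<bar>\<phi> z\<bar> \<le> 1" for z using \<phi>01[of z] by simp

  \<comment> \<open>The energy of \<open>\<psi> m\<close> is bounded for all large \<open>m\<close>, as \<open>weak_lhs_limit_error\<close> requires.\<close>
  obtain NU SU where SU: "\<And>m. m \<ge> NU \<Longrightarrow> (\<integral>z. grad_form a (U m) (U m) z \<partial>?M) \<le> SU"
    using W_approx_form_bounded[OF a o U] by metis
  obtain NV SV where SV: "\<And>m. m \<ge> NV \<Longrightarrow> (\<integral>z. grad_form a (V m) (V m) z \<partial>?M) \<le> SV"
    using W_approx_form_bounded[OF a o V] by metis
  define S where "S = \<bar>2 * 2\<^sup>2 * (\<integral>z. grad_form a \<phi> \<phi> z \<partial>?M) + 2 * (K / \<omega>)\<^sup>2 * (2 * SU + 2 * SV)\<bar>"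
  have S0: "0 \<le> S" by (simp add: S_def)
  have S: "(\<integral>z. grad_form a (\<psi> m) (\<psi> m) z \<partial>?M) \<le> S" if m: "m \<ge> max NU NV" for m
  proof -
    have "(\<integral>z. grad_form a (\<psi> m) (\<psi> m) z \<partial>?M) \<le>
       2 * 2\<^sup>2 * (\<integral>z. grad_form a \<phi> \<phi> z \<partial>?M) + 2 * (K / \<omega>)\<^sup>2 * (\<integral>z. grad_form a (w m) (w m) z \<partial>?M)"
      unfolding \<psi>_def
    proof (rule damped_test_energy_bound[OF a o \<Omega>(2) Cw gw \<phi> \<phi>1 s\<phi> \<omega> h(1,2)])
      show "\<bar>h y\<bar> \<le> 2" for y using h(3,4)[of y] by simp
      show "\<bar>k y\<bar> \<le> K" for y using h(5,6)[of y] by simp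
    qed
    also have "\<dots> \<le> 2 * 2\<^sup>2 * (\<integral>z. grad_form a \<phi> \<phi> z \<partial>?M) + 2 * (K / \<omega>)\<^sup>2 * (2 * SU + 2 * SV)"
    proof (intro add_left_mono mult_left_mono)
      show "(\<integral>z. grad_form a (w m) (w m) z \<partial>?M) \<le> 2 * SU + 2 * SV"
        using integrable_grad_form_diff(2)[OF a o Uf(1) Vf(1) Uf(3) Vf(3), of m m] SU[of m] SV[of m] m
        unfolding w_def by simp
    qed auto
    finally show ?thesis by (simp add: S_def)
  qed

  \<comment> \<open>Both errors from replacing the limits by the values at \<open>m\<close> are at most \<open>\<rho>\<close>, and \<open>\<epsilon>\<close> is chosen so that
    \<open>2 \<rho> = e\<close>.\<close>
  have tested: "\<exists>N. \<forall>m\<ge>N. (\<integral>z. (source q (u z) - source q (v z)) * \<phi> z \<partial>?M) \<le>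
      (\<integral>z. dt (w m) z * \<psi> m z \<partial>?M) + (\<integral>z. grad_form a (\<psi> m) (w m) z \<partial>?M) + e" if e: "0 < e" for e
  proof -
    define \<epsilon> where "\<epsilon> = e / (2 * (2 + S / 2 + 1 / 2))"
    have \<epsilon>: "0 < \<epsilon>" using e S0 by (simp add: \<epsilon>_def)
    define \<rho> where "\<rho> = 2 * \<epsilon> + \<epsilon> / 2 * S + \<epsilon> / 2"
    have e_eq: "2 * \<rho> = e"
    proof -
      have "2 * (2 * \<epsilon> + \<epsilon> / 2 * S + \<epsilon> / 2) = \<epsilon> * (2 * (2 + S / 2 + 1 / 2))" by (simp add: algebra_simps)
      also have "\<dots> = e" unfolding \<epsilon>_def using S0 by simp
      finally show ?thesis unfolding \<rho>_def .
    qed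
    obtain N1 where N1: "\<And>m k. m \<ge> N1 \<Longrightarrow> k \<ge> N1 \<Longrightarrow> (\<integral>z. \<bar>dt (U m) z - dt (U k) z\<bar> \<partial>?M) \<le> \<epsilon> \<and>
        (\<integral>z. grad_form a (\<lambda>z. U m z - U k z) (\<lambda>z. U m z - U k z) z \<partial>?M) \<le> \<epsilon>\<^sup>2"
      using U \<epsilon> unfolding W_approx_def by meson
    obtain N2 where N2: "\<And>m k. m \<ge> N2 \<Longrightarrow> k \<ge> N2 \<Longrightarrow> (\<integral>z. \<bar>dt (V m) z - dt (V k) z\<bar> \<partial>?M) \<le> \<epsilon> \<and>
        (\<integral>z. grad_form a (\<lambda>z. V m z - V k z) (\<lambda>z. V m z - V k z) z \<partial>?M) \<le> \<epsilon>\<^sup>2"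
      using V \<epsilon> unfolding W_approx_def by meson
    have "(\<integral>z. (source q (u z) - source q (v z)) * \<phi> z \<partial>?M) \<le>
      (\<integral>z. dt (w m) z * \<psi> m z \<partial>?M) + (\<integral>z. grad_form a (\<psi> m) (w m) z \<partial>?M) + e"
      if m: "m \<ge> max (max NU NV) (max N1 N2)" for m
    proof -
      obtain LU where LU: "(\<lambda>j. weak_lhs a \<Omega> (U j) (\<psi> m)) \<longlonglongrightarrow> LU" "(\<integral>z. source q (u z) * \<psi> m z \<partial>?M) \<le> LU"
        using superU test s\<psi> unfolding supersolution_sequence_def by blast
      obtain LV where LV: "(\<lambda>j. weak_lhs a \<Omega> (V j) (\<psi> m)) \<longlonglongrightarrow> LV" "LV \<le> (\<integral>z. source q (v z) * \<psi> m z \<partial>?M)"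
        using subV test s\<psi> unfolding subsolution_sequence_def by blast
      have Sm: "(\<integral>z. grad_form a (\<psi> m) (\<psi> m) z \<partial>?M) \<le> S" using S m by simp
      have 1: "\<bar>LU - weak_lhs a \<Omega> (U m) (\<psi> m)\<bar> \<le> \<rho>" unfolding \<rho>_def
        by (rule weak_lhs_limit_error[OF a o \<Omega>(2) U \<psi>cs \<psi>2 Sm \<epsilon> _ LU(1)]) (use N1 m in auto)
      have 2: "\<bar>LV - weak_lhs a \<Omega> (V m) (\<psi> m)\<bar> \<le> \<rho>" unfolding \<rho>_def
        by (rule weak_lhs_limit_error[OF a o \<Omega>(2) V \<psi>cs \<psi>2 Sm \<epsilon> _ LV(1)]) (use N2 m in auto)
      have "weak_lhs a \<Omega> (U m) (\<psi> m) - weak_lhs a \<Omega> (V m) (\<psi> m) =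
         (\<integral>z. dt (U m) z * \<psi> m z - dt (V m) z * \<psi> m z \<partial>?M) +
         (\<integral>z. grad_form a (\<psi> m) (U m) z - grad_form a (\<psi> m) (V m) z \<partial>?M)"
        using integral_mult_bounded_le(1)[OF Uf(2) m\<psi> \<psi>2, of m m] integral_mult_bounded_le(1)[OF Vf(2) m\<psi> \<psi>2, of m m]
          integrable_grad_form[OF a o C\<psi> Uf(1) i\<psi> Uf(3), of m m] integrable_grad_form[OF a o C\<psi> Vf(1) i\<psi> Vf(3), of m m]
        unfolding weak_lhs_def by simp
      also have "(\<integral>z. dt (U m) z * \<psi> m z - dt (V m) z * \<psi> m z \<partial>?M) = (\<integral>z. dt (w m) z * \<psi> m z \<partial>?M)"
        by (intro Bochner_Integration.integral_cong refl) (simp add: space_restrict_space dw left_diff_distrib)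
      also have "(\<integral>z. grad_form a (\<psi> m) (U m) z - grad_form a (\<psi> m) (V m) z \<partial>?M) = (\<integral>z. grad_form a (\<psi> m) (w m) z \<partial>?M)"
        by (intro Bochner_Integration.integral_cong refl)
           (simp add: space_restrict_space w_def grad_form_eq xgrad_dt_diff(1)[OF Uf(1) Vf(1)] coef_form_diff_right)
      finally have 3: "weak_lhs a \<Omega> (U m) (\<psi> m) - weak_lhs a \<Omega> (V m) (\<psi> m) =
        (\<integral>z. dt (w m) z * \<psi> m z \<partial>?M) + (\<integral>z. grad_form a (\<psi> m) (w m) z \<partial>?M)" .
      have "(\<integral>z. (source q (u z) - source q (v z)) * \<phi> z \<partial>?M) \<le>
          (\<integral>z. (source q (u z) - source q (v z)) * \<psi> m z \<partial>?M)"
      proof (rule integral_mono_AE)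
        show "integrable ?M (\<lambda>z. (source q (u z) - source q (v z)) * \<phi> z)"
          using source_mult_integrable[OF o q1 U m\<phi> \<phi>1] source_mult_integrable[OF o q1 V m\<phi> \<phi>1]
          by (simp add: left_diff_distrib)
        show "integrable ?M (\<lambda>z. (source q (u z) - source q (v z)) * \<psi> m z)"
          using iu\<psi>[OF q1] iv\<psi>[OF q1] by (simp add: left_diff_distrib)
        show "AE z in ?M. (source q (u z) - source q (v z)) * \<phi> z \<le> (source q (u z) - source q (v z)) * \<psi> m z"
          using AE_lebesgue_on[OF o uv]
          by eventually_elim (intro mult_left_mono \<psi>\<phi>, simp add: source_mono[OF q1])
      qed
      also have "\<dots> = (\<integral>z. source q (u z) * \<psi> m z \<partial>?M) - (\<integral>z. source q (v z) * \<psi> m z \<partial>?M)"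
        using iu\<psi>[OF q1] iv\<psi>[OF q1] by (simp add: left_diff_distrib)
      finally show ?thesis using 1 2 3 LU(2) LV(2) e_eq by linarith
    qed
    then show ?thesis by blast
  qed

  \<comment> \<open>The remainder \<open>r m\<close> of the approximation enters the right-hand side only without derivatives, in the
    powers 1 and \<open>p\<close>, and with factors that do not depend on \<open>m\<close>.\<close>
  obtain B1 where B1: "0 < B1" "\<And>z. \<bar>dt \<phi> z\<bar> \<le> B1" using compact_smooth_bounded[OF \<phi>] by metis
  obtain B2 where B2: "0 < B2" "AE z in lebesgue. 0 \<le> grad_form a \<zeta> \<zeta> z \<and> grad_form a \<zeta> \<zeta> z \<le> B2"
    using grad_form_compact_smooth_bounded[OF a \<zeta>(1)] by metis
  have \<theta>B: "AE z in ?M. 0 \<le> \<theta> z \<and> \<theta> z \<le> B2"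
    using AE_lebesgue_on[OF o B2(2)]
  proof eventually_elim
    case (elim z)
    have "\<zeta> z ^ (s - 2) * grad_form a \<zeta> \<zeta> z \<le> 1 * B2"
      using elim \<zeta>(2,3)[of z] by (intro mult_mono) (auto simp: power_le_one)
    then show ?case using elim \<zeta>(2)[of z] by (simp add: \<theta>_def)
  qed
  have m\<theta>[measurable]: "\<theta> \<in> borel_measurable ?M"
    unfolding \<theta>_def using borel_measurable_grad_form[OF a o C\<zeta>(2) C\<zeta>(2)] by measurable
  have mdt\<phi>[measurable]: "dt \<phi> \<in> borel_measurable ?M"
    by (intro continuous_on_measurable_lebesgue_on[OF o] Cinf_on_continuous_dt C\<phi>)
  define r where "r = (\<lambda>m z. w m z - (u z - v z))"
  have mr[measurable]: "r m \<in> borel_measurable ?M" for m unfolding r_def by measurable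
  have ir: "integrable ?M (\<lambda>z. \<bar>r m z\<bar> powr q)" for m
    using W_approx_diff(1)[OF o q1 U V] unfolding r_def w_def .
  have lr: "(\<lambda>m. \<integral>z. \<bar>r m z\<bar> powr q \<partial>?M) \<longlonglongrightarrow> 0"
    using W_approx_diff(2)[OF o q1 U V] unfolding r_def w_def .
  have ir1: "integrable ?M (\<lambda>z. \<bar>r m z\<bar> powr 1)" and irp: "integrable ?M (\<lambda>z. \<bar>r m z\<bar> powr p)" for m
    by (rule integrable_lower_powr[OF fin _ _ mr ir]; use p in simp)+
  have lr1: "(\<lambda>m. \<integral>z. \<bar>r m z\<bar> powr 1 \<partial>?M) \<longlonglongrightarrow> 0" and lrp: "(\<lambda>m. \<integral>z. \<bar>r m z\<bar> powr p \<partial>?M) \<longlonglongrightarrow> 0"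
    by (rule integral_lower_powr_tendsto_0[OF fin _ _ mr ir lr]; use p in simp)+
  have iuv: "integrable ?M (\<lambda>z. \<bar>u z - v z\<bar> powr q)"
    using q1 by (intro integrable_powr_diff uf vf) auto
  have iuv1: "integrable ?M (\<lambda>z. \<bar>u z - v z\<bar> powr 1)" and iuvp: "integrable ?M (\<lambda>z. \<bar>u z - v z\<bar> powr p)"
    by (rule integrable_lower_powr[OF fin _ _ _ iuv]; use p in simp)+
  have iw: "integrable ?M (w m)" for m
  proof -
    have iwq: "integrable ?M (\<lambda>z. \<bar>w m z\<bar> powr q)"
      unfolding w_def using q1 Uf Vf
      by (intro integrable_powr_diff continuous_on_measurable_lebesgue_on[OF o] Cinf_on_continuous) auto
    have "integrable ?M (\<lambda>z. \<bar>w m z\<bar> powr 1)"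
      by (rule integrable_lower_powr[OF fin _ _ mw iwq]) (use q1 in simp_all)
    then have "integrable ?M (\<lambda>z. \<bar>w m z\<bar>)" by simp
    then show ?thesis by (simp only: integrable_abs_iff[OF mw])
  qed
  have iud: "integrable ?M (\<lambda>z. \<bar>u z - v z\<bar> * \<bar>dt \<phi> z\<bar>)"
    by (rule integral_mult_bounded_le(1)[where B = B1]) (use iuv1 B1 in auto)
  have time: "(\<integral>z. dt (w m) z * \<psi> m z \<partial>?M) \<le>
      2 * (\<integral>z. \<bar>u z - v z\<bar> * \<bar>dt \<phi> z\<bar> \<partial>?M) + 2 * B1 * (\<integral>z. \<bar>r m z\<bar> powr 1 \<partial>?M)" for m
  proof -
    have "(\<integral>z. dt (w m) z * \<psi> m z \<partial>?M) \<le> 2 * (\<integral>z. \<bar>w m z\<bar> * \<bar>dt \<phi> z\<bar> \<partial>?M)"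
      unfolding \<psi>_def
      by (rule damped_time_term[OF o Cw idw iw \<phi> s\<phi> \<omega> h(1) _ H])
         (use h(3,4) hpos in \<open>auto simp: abs_of_pos\<close>)
    also have "(\<integral>z. \<bar>w m z\<bar> * \<bar>dt \<phi> z\<bar> \<partial>?M) \<le> (\<integral>z. \<bar>u z - v z\<bar> * \<bar>dt \<phi> z\<bar> + B1 * \<bar>r m z\<bar> powr 1 \<partial>?M)"
    proof (rule integral_mono)
      show "integrable ?M (\<lambda>z. \<bar>w m z\<bar> * \<bar>dt \<phi> z\<bar>)"
        by (rule integral_mult_bounded_le(1)[where B = B1]) (use iw B1 in auto)
      show "integrable ?M (\<lambda>z. \<bar>u z - v z\<bar> * \<bar>dt \<phi> z\<bar> + B1 * \<bar>r m z\<bar> powr 1)"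
        by (intro Bochner_Integration.integrable_add integrable_mult_right iud ir1)
      fix z
      have "\<bar>w m z\<bar> * \<bar>dt \<phi> z\<bar> \<le> (\<bar>u z - v z\<bar> + \<bar>r m z\<bar>) * \<bar>dt \<phi> z\<bar>"
        by (intro mult_right_mono) (auto simp: r_def)
      also have "\<dots> \<le> \<bar>u z - v z\<bar> * \<bar>dt \<phi> z\<bar> + B1 * \<bar>r m z\<bar>"
        using mult_left_mono[OF B1(2)[of z], of "\<bar>r m z\<bar>"] by (simp add: algebra_simps)
      finally show "\<bar>w m z\<bar> * \<bar>dt \<phi> z\<bar> \<le> \<bar>u z - v z\<bar> * \<bar>dt \<phi> z\<bar> + B1 * \<bar>r m z\<bar> powr 1" by simp
    qed
    also have "\<dots> = (\<integral>z. \<bar>u z - v z\<bar> * \<bar>dt \<phi> z\<bar> \<partial>?M) + B1 * (\<integral>z. \<bar>r m z\<bar> powr 1 \<partial>?M)"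
      using ir1 iud by simp
    finally show ?thesis by simp
  qed
  let ?c = "\<omega> * (real s)\<^sup>2 / 4 * C"
  have c: "0 \<le> ?c" using \<omega> C by simp
  have i\<theta>p: "integrable ?M (\<lambda>z. (1 + \<bar>(u z - v z) / \<omega>\<bar> powr p) * \<theta> z)"
  proof -
    have "integrable ?M (\<lambda>z. (1 + \<bar>(u z - v z) / \<omega>\<bar> powr p) * B2)"
      using iuvp \<omega> by (simp add: powr_divide abs_divide)
    then show ?thesis
    proof (rule Bochner_Integration.integrable_bound)
      show "AE z in ?M. norm ((1 + \<bar>(u z - v z) / \<omega>\<bar> powr p) * \<theta> z) \<le> norm ((1 + \<bar>(u z - v z) / \<omega>\<bar> powr p) * B2)"
        using \<theta>B by eventually_elim (auto simp: abs_mult intro!: mult_left_mono)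
    qed measurable
  qed
  have flux: "(\<integral>z. grad_form a (\<psi> m) (w m) z \<partial>?M) \<le>
      ?c * 2 powr p * (\<integral>z. (1 + \<bar>(u z - v z) / \<omega>\<bar> powr p) * \<theta> z \<partial>?M) +
      ?c * 2 powr p * B2 * \<omega> powr (- p) * (\<integral>z. \<bar>r m z\<bar> powr p \<partial>?M)" for m
  proof -
    let ?R = "\<lambda>z. ?c * 2 powr p * ((1 + \<bar>(u z - v z) / \<omega>\<bar> powr p) * \<theta> z) +
      ?c * 2 powr p * B2 * \<omega> powr (- p) * \<bar>r m z\<bar> powr p"
    have alg: "c' * (t * (X + (o' * r') * B)) = c' * t * X + c' * t * B * o' * r'" for c' t X o' r' B :: real
      by (simp add: algebra_simps)
    have "(\<integral>z. grad_form a (\<psi> m) (w m) z \<partial>?M) \<le> (\<integral>z. ?R z \<partial>?M)"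
    proof (rule integral_mono_AE)
      show "integrable ?M (grad_form a (\<psi> m) (w m))"
        by (rule integrable_grad_form[OF a o C\<psi> Cw i\<psi> gw])
      show "integrable ?M ?R"
        by (intro Bochner_Integration.integrable_add integrable_mult_right i\<theta>p irp)
      show "AE z in ?M. grad_form a (\<psi> m) (w m) z \<le> ?R z"
        using AE_lebesgue_on_sym_psd[OF a o] \<theta>B
      proof eventually_elim
        case (elim z)
        then have z: "z \<in> \<Omega>" "sym_psd a A z" and \<theta>: "0 \<le> \<theta> z" "\<theta> z \<le> B2" by auto
        let ?y = "w m z / \<omega>"
        have g: "xgrad (\<psi> m) z = (h ?y * (real s * \<zeta> z ^ (s - 1))) *\<^sub>R xgrad \<zeta> z - (k ?y * \<zeta> z ^ s / \<omega>) *\<^sub>R xgrad (w m) z"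
          unfolding \<psi>_def damped_test_gradient[OF Cw C\<phi>(2) z(1) less_imp_neq[OF \<omega>, symmetric] h(2)]
          unfolding \<phi>_def xgrad_dt_power(1)[OF C\<zeta>(2) z(1)] by simp
        have "grad_form a (\<psi> m) (w m) z \<le> \<omega> * (real s)\<^sup>2 / 4 * (C * (1 + \<bar>?y\<bar> powr p)) * \<zeta> z ^ (s - 2) * coef_form a z (xgrad \<zeta> z) (xgrad \<zeta> z)"
          unfolding grad_form_eq g
          by (rule damped_form_le[OF z(2) s \<omega> h(5) hpos \<zeta>(2) hk])
        also have "\<dots> = ?c * ((1 + \<bar>?y\<bar> powr p) * \<theta> z)"
          by (simp add: \<theta>_def grad_form_eq)
        also have "\<dots> \<le> ?c * (2 powr p * ((1 + \<bar>(u z - v z) / \<omega>\<bar> powr p) * \<theta> z + \<bar>r m z / \<omega>\<bar> powr p * B2))"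
        proof (rule mult_left_mono[OF _ c])
          have p1: "1 \<le> 2 powr p" using p by (intro ge_one_powr_ge_zero) auto
          have "\<bar>?y\<bar> powr p \<le> 2 powr p * (\<bar>(u z - v z) / \<omega>\<bar> powr p + \<bar>r m z / \<omega>\<bar> powr p)"
            using powr_sum_le[of p "(u z - v z) / \<omega>" "r m z / \<omega>"] p
            by (simp add: r_def diff_divide_distrib)
          then have "1 + \<bar>?y\<bar> powr p \<le> 2 powr p * (1 + \<bar>(u z - v z) / \<omega>\<bar> powr p + \<bar>r m z / \<omega>\<bar> powr p)"
            using p1 by (simp add: algebra_simps)
          then have "(1 + \<bar>?y\<bar> powr p) * \<theta> z \<le> 2 powr p * (1 + \<bar>(u z - v z) / \<omega>\<bar> powr p + \<bar>r m z / \<omega>\<bar> powr p) * \<theta> z"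
            using \<theta> by (intro mult_right_mono)
          also have "\<dots> = 2 powr p * ((1 + \<bar>(u z - v z) / \<omega>\<bar> powr p) * \<theta> z + \<bar>r m z / \<omega>\<bar> powr p * \<theta> z)"
            by (simp add: algebra_simps)
          also have "\<dots> \<le> 2 powr p * ((1 + \<bar>(u z - v z) / \<omega>\<bar> powr p) * \<theta> z + \<bar>r m z / \<omega>\<bar> powr p * B2)"
            using \<theta> by (intro mult_left_mono add_left_mono) auto
          finally show "(1 + \<bar>?y\<bar> powr p) * \<theta> z \<le> 2 powr p * ((1 + \<bar>(u z - v z) / \<omega>\<bar> powr p) * \<theta> z + \<bar>r m z / \<omega>\<bar> powr p * B2)" .
        qed
        also have "\<bar>r m z / \<omega>\<bar> powr p = \<omega> powr (- p) * \<bar>r m z\<bar> powr p"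
          using \<omega> by (simp add: abs_divide powr_divide powr_minus_divide)
        finally show ?case by (simp only: alg)
      qed
    qed
    also have "\<dots> = ?c * 2 powr p * (\<integral>z. (1 + \<bar>(u z - v z) / \<omega>\<bar> powr p) * \<theta> z \<partial>?M) +
      ?c * 2 powr p * B2 * \<omega> powr (- p) * (\<integral>z. \<bar>r m z\<bar> powr p \<partial>?M)"
      using i\<theta>p irp by simp
    finally show ?thesis .
  qed

  have "(\<integral>z. (source q (u z) - source q (v z)) * \<phi> z \<partial>?M) \<le>
     2 * (\<integral>z. \<bar>u z - v z\<bar> * \<bar>dt \<phi> z\<bar> \<partial>?M) +
     ?c * 2 powr p * (\<integral>z. (1 + \<bar>(u z - v z) / \<omega>\<bar> powr p) * \<theta> z \<partial>?M)"
    (is "?L \<le> ?R1 + ?R2")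
  proof (rule field_le_epsilon)
    fix e :: real assume e: "0 < e"
    obtain N where N: "\<And>m. m \<ge> N \<Longrightarrow> ?L \<le> (\<integral>z. dt (w m) z * \<psi> m z \<partial>?M) + (\<integral>z. grad_form a (\<psi> m) (w m) z \<partial>?M) + e / 2"
      using tested[of "e / 2"] e by auto
    let ?E = "\<lambda>m. 2 * B1 * (\<integral>z. \<bar>r m z\<bar> powr 1 \<partial>?M) + ?c * 2 powr p * B2 * \<omega> powr (- p) * (\<integral>z. \<bar>r m z\<bar> powr p \<partial>?M)"
    have "?E \<longlonglongrightarrow> 0"
      using tendsto_add[OF tendsto_mult[OF tendsto_const lr1, of "2 * B1"] tendsto_mult[OF tendsto_const lrp, of "?c * 2 powr p * B2 * \<omega> powr (- p)"]]
      by simp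
    then have "\<forall>\<^sub>F m in sequentially. ?E m < e / 2"
      by (rule order_tendstoD) (use e in simp)
    then obtain N' where N': "\<And>m. m \<ge> N' \<Longrightarrow> ?E m < e / 2" unfolding eventually_sequentially by blast
    let ?m = "max N N'"
    have "?E ?m < e / 2" "?L \<le> (\<integral>z. dt (w ?m) z * \<psi> ?m z \<partial>?M) + (\<integral>z. grad_form a (\<psi> ?m) (w ?m) z \<partial>?M) + e / 2"
      using N' N by auto
    with time[of ?m] flux[of ?m] show "?L \<le> ?R1 + ?R2 + e" by linarith
  qed
  then show ?thesis unfolding \<phi>_def \<theta>_def .
qed

section \<open>The comparison inequality\<close>

lemma powr_superadditive:
  fixes x y q :: real
  assumes "0 \<le> x" "0 \<le> y" "1 \<le> q"
  shows "x powr q + y powr q \<le> (x + y) powr q"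
proof (cases "x + y = 0")
  case False
  then have s: "0 < x + y" using assms by linarith
  have le: "t powr q \<le> (x + y) powr q * (t / (x + y))" if "0 \<le> t" "t \<le> x + y" for t
  proof -
    have "t powr q = (x + y) powr q * (t / (x + y)) powr q"
      using that s by (simp add: powr_divide)
    also have "(t / (x + y)) powr q \<le> (t / (x + y)) powr 1"
      using that s assms by (intro powr_mono') auto
    finally show ?thesis using that s by (simp add: mult_left_mono)
  qed
  have "x powr q + y powr q \<le> (x + y) powr q * (x / (x + y)) + (x + y) powr q * (y / (x + y))"
    using assms by (intro add_mono le) auto
  also have "\<dots> = (x + y) powr q * ((x + y) / (x + y))"
    by (simp only: add_divide_distrib distrib_left)
  finally show ?thesis using s by simp
qed (use assms in \<open>simp add: add_nonneg_eq_0_iff\<close>)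

text \<open>For arguments of equal sign this is superadditivity of the power; for opposite signs both parts of
  \<open>u - v = \<bar>u\<bar> + \<bar>v\<bar>\<close> contribute, and the larger one is at least half of the sum.\<close>

lemma source_diff_ge:
  assumes q: "1 < q" and vu: "v \<le> u"
  shows "2 powr (- q) * \<bar>u - v\<bar> powr q \<le> source q u - source q v"
proof -
  have src: "source q x = x powr q" if "0 \<le> x" for x
    using that powr_add[of x "q - 1" 1] by (cases "x = 0") (auto simp: source_def)
  have neg: "source q x = - source q (- x)" for x by (simp add: source_def)
  have one: "(2::real) powr (- q) \<le> 1" using q powr_mono[of "- q" 0 2] by simp
  have pos: "2 powr (- q) * \<bar>y - x\<bar> powr q \<le> source q y - source q x" if "0 \<le> x" "x \<le> y" for x y
  proof -
    have "2 powr (- q) * \<bar>y - x\<bar> powr q \<le> 1 * \<bar>y - x\<bar> powr q"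
      using one by (intro mult_right_mono) auto
    also have "\<dots> \<le> source q y - source q x"
      using powr_superadditive[of "y - x" x q] that q by (simp add: src)
    finally show ?thesis .
  qed
  consider "0 \<le> v" | "u \<le> 0" | "v < 0" "0 < u" by linarith
  then show ?thesis
  proof cases
    case 1
    then show ?thesis using pos vu by simp
  next
    case 2
    then show ?thesis using pos[of "- u" "- v"] vu neg[of u] neg[of v] by simp
  next
    case 3
    have "2 powr (- q) * \<bar>u - v\<bar> powr q = (\<bar>u - v\<bar> / 2) powr q"
      by (simp add: powr_divide powr_minus_divide)
    also have "\<dots> \<le> (max u (- v)) powr q"
      using 3 q by (intro powr_mono2) auto
    also have "\<dots> \<le> u powr q + (- v) powr q" by (simp add: max_def)
    also have "\<dots> = source q u - source q v" using 3 neg[of v] by (simp add: src)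
    finally show ?thesis .
  qed
qed

text \<open>The constant depends neither on the cutoff nor on \<open>\<omega>\<close>. The freedom in \<open>\<omega>\<close>, which is the size of the
  solution at which the damping sets in, is used in both steps of the final argument.\<close>

lemma comparison_inequality:
  fixes a :: "'n::finite \<Rightarrow> 'n \<Rightarrow> 'n spacetime \<Rightarrow> real" and p q :: real and s :: nat
  assumes p: "1 < p" "p < q" and s: "2 \<le> s" and a: "admissible_coefficients a A"
    and u: "weak_supersolution a q u" and v: "weak_subsolution a q v" and uv: "AE z in lebesgue. u z \<ge> v z"
  obtains D where "0 < D"
    "\<And>\<zeta> \<Omega> \<omega>. \<lbrakk>domain_set \<Omega>; bounded \<Omega>; compact_smooth \<zeta>;
        \<And>z. 0 \<le> \<zeta> z; \<And>z. \<zeta> z \<le> 1; closure {z. \<zeta> z \<noteq> 0} \<subseteq> \<Omega>; 0 < \<omega>\<rbrakk> \<Longrightarrow>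
       (\<integral>z. \<bar>u z - v z\<bar> powr q * \<zeta> z ^ s \<partial>lebesgue_on \<Omega>) \<le>
       D * ((\<integral>z. \<bar>u z - v z\<bar> * \<bar>dt (\<lambda>z. \<zeta> z ^ s) z\<bar> \<partial>lebesgue_on \<Omega>) +
         \<omega> * (\<integral>z. (1 + \<bar>(u z - v z) / \<omega>\<bar> powr p) * (\<zeta> z ^ (s - 2) * grad_form a \<zeta> \<zeta> z) \<partial>lebesgue_on \<Omega>))"
proof -
  obtain h k H :: "real \<Rightarrow> real" and K C :: real
    where h: "Cinf_on UNIV h" "\<And>y. (h has_real_derivative - k y) (at y)"
    "\<And>y. 1 \<le> h y" "\<And>y. h y \<le> 2" "\<And>y. 0 < k y" "\<And>y. k y \<le> K" and C: "0 < C"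
    and hk: "\<And>y. (h y)\<^sup>2 \<le> C * (1 + \<bar>y\<bar> powr p) * k y"
    and H: "\<And>y. (H has_real_derivative h y) (at y)" "\<And>y. \<bar>H y\<bar> \<le> 2 * \<bar>y\<bar>"
    using exists_slowly_decreasing_weight[OF p(1)] by metis
  have q: "1 < q" using p by simp
  define E where "E = 2 + (real s)\<^sup>2 / 4 * C * 2 powr p"
  have E: "0 < E" using C by (simp add: E_def add_pos_nonneg)
  show ?thesis
  proof (rule that[of "2 powr q * E"])
    show "0 < 2 powr q * E" using E by simp
    fix \<zeta> :: "'n spacetime \<Rightarrow> real" and \<Omega> and \<omega> :: real
    assume \<Omega>: "domain_set \<Omega>" "bounded \<Omega>" and \<zeta>cs: "compact_smooth \<zeta>"
      and \<zeta>0: "\<And>z. 0 \<le> \<zeta> z" and \<zeta>1: "\<And>z. \<zeta> z \<le> 1" and \<zeta>s: "closure {z. \<zeta> z \<noteq> 0} \<subseteq> \<Omega>" and \<omega>: "0 < \<omega>"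
    let ?M = "lebesgue_on \<Omega>"
    have o: "open \<Omega>" using \<Omega> by (simp add: domain_set_def)
    obtain U where sU: "supersolution_sequence a q \<Omega> u U"
      using weak_supersolution_sequence[OF a q u \<Omega>] by blast
    then have U: "W_approx a q \<Omega> u U" by (simp add: supersolution_sequence_def)
    obtain V where sV: "subsolution_sequence a q \<Omega> v V"
      using weak_subsolution_sequence[OF a q v \<Omega>] by blast
    then have V: "W_approx a q \<Omega> v V" by (simp add: subsolution_sequence_def)
    let ?T = "\<integral>z. \<bar>u z - v z\<bar> * \<bar>dt (\<lambda>z. \<zeta> z ^ s) z\<bar> \<partial>?M"
    let ?G = "\<omega> * (\<integral>z. (1 + \<bar>(u z - v z) / \<omega>\<bar> powr p) * (\<zeta> z ^ (s - 2) * grad_form a \<zeta> \<zeta> z) \<partial>?M)"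
    have T0: "0 \<le> ?T" by (intro integral_nonneg_AE) simp
    have G0: "0 \<le> ?G"
    proof (intro mult_nonneg_nonneg integral_nonneg_AE)
      show "AE z in ?M. 0 \<le> (1 + \<bar>(u z - v z) / \<omega>\<bar> powr p) * (\<zeta> z ^ (s - 2) * grad_form a \<zeta> \<zeta> z)"
        using AE_lebesgue_on_sym_psd[OF a o]
        by eventually_elim (auto intro!: mult_nonneg_nonneg zero_le_power[OF \<zeta>0] simp: grad_form_eq intro: coef_form_nonneg)
    qed (use \<omega> in auto)
    have meas: "(\<lambda>z. \<zeta> z ^ s) \<in> borel_measurable ?M"
      using \<zeta>cs by (intro borel_measurable_power continuous_on_measurable_lebesgue_on[OF o] Cinf_on_continuous)
        (auto simp: compact_smooth_def intro: Cinf_on_mono)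
    have bd: "\<bar>\<zeta> z ^ s\<bar> \<le> 1" for z using \<zeta>0[of z] \<zeta>1[of z] by (simp add: power_le_one)
    have iuv: "integrable ?M (\<lambda>z. \<bar>u z - v z\<bar> powr q)"
      using U V q by (intro integrable_powr_diff) (auto simp: W_approx_def)
    have "2 powr (- q) * (\<integral>z. \<bar>u z - v z\<bar> powr q * \<zeta> z ^ s \<partial>?M) = (\<integral>z. 2 powr (- q) * (\<bar>u z - v z\<bar> powr q * \<zeta> z ^ s) \<partial>?M)"
      by simp
    also have "\<dots> \<le> (\<integral>z. (source q (u z) - source q (v z)) * \<zeta> z ^ s \<partial>?M)"
    proof (rule integral_mono_AE)
      show "integrable ?M (\<lambda>z. 2 powr (- q) * (\<bar>u z - v z\<bar> powr q * \<zeta> z ^ s))"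
        by (intro integrable_mult_right integral_mult_bounded_le(1)[OF iuv meas bd])
      show "integrable ?M (\<lambda>z. (source q (u z) - source q (v z)) * \<zeta> z ^ s)"
        using source_mult_integrable[OF o q U meas bd] source_mult_integrable[OF o q V meas bd]
        by (simp add: left_diff_distrib)
      show "AE z in ?M. 2 powr (- q) * (\<bar>u z - v z\<bar> powr q * \<zeta> z ^ s) \<le> (source q (u z) - source q (v z)) * \<zeta> z ^ s"
        using AE_lebesgue_on[OF o uv]
      proof eventually_elim
        case (elim z)
        show ?case
          using mult_right_mono[OF source_diff_ge[OF q elim], of "\<zeta> z ^ s"] \<zeta>0[of z] by (simp add: mult.assoc)
      qed
    qed
    also have "\<dots> \<le> 2 * ?T + (real s)\<^sup>2 / 4 * C * 2 powr p * ?G"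
      using tested_inequality[OF h hk H C p s a \<Omega> sU sV uv \<zeta>cs \<zeta>0 \<zeta>1 \<zeta>s \<omega>]
      by (simp add: mult_ac)
    also have "\<dots> \<le> E * ?T + E * ?G"
      using T0 G0 C by (intro add_mono mult_right_mono) (auto simp: E_def)
    finally have "2 powr q * (2 powr (- q) * (\<integral>z. \<bar>u z - v z\<bar> powr q * \<zeta> z ^ s \<partial>?M)) \<le> 2 powr q * (E * ?T + E * ?G)"
      by (intro mult_left_mono) auto
    moreover have "2 powr q * (2 powr (- q) * x) = x" for x :: real
      by (simp add: mult.assoc[symmetric] powr_add[symmetric])
    ultimately show "(\<integral>z. \<bar>u z - v z\<bar> powr q * \<zeta> z ^ s \<partial>?M) \<le> 2 powr q * E * (?T + ?G)"
      by (simp only: distrib_left mult.assoc)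
  qed
qed

section \<open>Cutoffs on cylinders\<close>

text \<open>The constant \<open>B\<close> is to be independent of the scales \<open>T\<close> in time and \<open>R\<close> in space. The spatial gradient is
  confined to \<open>R / 2 < norm x < R\<close>, the only region where the growth condition bounds the coefficients.\<close>

definition space_time_cutoff :: "real \<Rightarrow> real \<Rightarrow> real \<Rightarrow> (('n::finite) spacetime \<Rightarrow> real) \<Rightarrow> bool" where
  "space_time_cutoff B T R \<zeta> \<longleftrightarrow> compact_smooth \<zeta> \<and> (\<forall>z. 0 \<le> \<zeta> z \<and> \<zeta> z \<le> 1) \<and>
     (\<forall>t x. \<zeta> (t, x) \<noteq> 0 \<longrightarrow> \<bar>t\<bar> < 2 * T \<and> norm x < R) \<and>
     (\<forall>t x. \<bar>t\<bar> \<le> T \<and> norm x \<le> R / 2 \<longrightarrow> \<zeta> (t, x) = 1) \<and>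
     (\<forall>t x. \<bar>dt \<zeta> (t, x)\<bar> \<le> B / T \<and> (dt \<zeta> (t, x) \<noteq> 0 \<longrightarrow> T < \<bar>t\<bar> \<and> \<bar>t\<bar> < 2 * T \<and> norm x < R)) \<and>
     (\<forall>t x. norm (xgrad \<zeta> (t, x)) \<le> B / R \<and>
        (xgrad \<zeta> (t, x) \<noteq> 0 \<longrightarrow> \<bar>t\<bar> < 2 * T \<and> R / 2 < norm x \<and> norm x < R))"

text \<open>A product of steps in \<open>(4 - (t / T)\<^sup>2) / 3\<close> and \<open>(4 - (2 norm x / R)\<^sup>2) / 3\<close>. Squares avoid the singularity of the
  absolute value and the norm at the origin; the affine map sends the squared ratios 1 and 4, the inner and
  the outer radius, to the points 1 and 0 of the step.\<close>

lemma exists_space_time_cutoff: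
  obtains B where "0 < B"
    "\<And>T R. 0 < T \<Longrightarrow> 0 < R \<Longrightarrow> \<exists>\<zeta> :: ('n::finite) spacetime \<Rightarrow> real. space_time_cutoff B T R \<zeta>"
proof -
  obtain \<theta> \<theta>' :: "real \<Rightarrow> real" and B0 :: real
    where C\<theta>: "Cinf_on UNIV \<theta>" and d\<theta>: "\<And>x. (\<theta> has_real_derivative \<theta>' x) (at x)"
    and B0: "\<And>x. \<bar>\<theta>' x\<bar> \<le> B0" and \<theta>0: "\<And>x. 0 \<le> \<theta> x" and \<theta>1: "\<And>x. \<theta> x \<le> 1"
    and \<theta>z: "\<And>x. x \<le> 0 \<Longrightarrow> \<theta> x = 0" and \<theta>o: "\<And>x. 1 \<le> x \<Longrightarrow> \<theta> x = 1"
    and \<theta>'z: "\<And>x. x \<le> 0 \<or> 1 \<le> x \<Longrightarrow> \<theta>' x = 0"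
    using exists_smooth_step by metis
  have B0': "0 \<le> B0" using B0[of 0] by linarith
  define B where "B = 3 * B0 + 1"
  have B: "0 < B" using B0' by (simp add: B_def)
  have main: "\<exists>\<zeta> :: 'n spacetime \<Rightarrow> real. space_time_cutoff B T R \<zeta>"
    if T: "0 < T" and R: "0 < R" for T R :: real
  proof -
    define f1 where "f1 = (\<lambda>z :: 'n spacetime. (4 - (fst z / T)\<^sup>2) / 3)"
    define f2 where "f2 = (\<lambda>z :: 'n spacetime. (4 - 4 * (snd z \<bullet> snd z) / R\<^sup>2) / 3)"
    define \<zeta> where "\<zeta> = (\<lambda>z. \<theta> (f1 z) * \<theta> (f2 z))"
    have sq: "x \<bullet> x = (norm x)\<^sup>2" for x :: "real ^ 'n" by (simp add: power2_norm_eq_inner)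
    have als: "\<bar>x\<bar> < \<bar>y\<bar> \<longleftrightarrow> x\<^sup>2 < y\<^sup>2" for x y :: real
      using abs_le_square_iff[of y x] by linarith
    have f1_pos: "0 < f1 (t, x) \<longleftrightarrow> \<bar>t\<bar> < 2 * T" for t and x :: "real ^ 'n"
    proof -
      have "0 < f1 (t, x) \<longleftrightarrow> \<bar>t / T\<bar> < \<bar>2\<bar>"
        unfolding f1_def als by simp
      also have "\<dots> \<longleftrightarrow> \<bar>t\<bar> < 2 * T" using T by (simp add: abs_divide divide_less_eq)
      finally show ?thesis .
    qed
    have f1_one: "1 \<le> f1 (t, x) \<longleftrightarrow> \<bar>t\<bar> \<le> T" for t and x :: "real ^ 'n"
    proof -
      have "1 \<le> f1 (t, x) \<longleftrightarrow> \<bar>t / T\<bar> \<le> \<bar>1\<bar>"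
        unfolding f1_def abs_le_square_iff by simp
      also have "\<dots> \<longleftrightarrow> \<bar>t\<bar> \<le> T" using T by (simp add: abs_divide divide_le_eq)
      finally show ?thesis .
    qed
    have f2_eq: "f2 (t, x) = (4 - (2 * norm x / R)\<^sup>2) / 3" for t x
      by (simp add: f2_def sq power_divide power_mult_distrib)
    have f2_pos: "0 < f2 (t, x) \<longleftrightarrow> norm x < R" for t x
    proof -
      have "0 < f2 (t, x) \<longleftrightarrow> \<bar>2 * norm x / R\<bar> < \<bar>2\<bar>"
        unfolding f2_eq als by simp
      also have "\<dots> \<longleftrightarrow> norm x < R" using R by (simp add: abs_divide divide_less_eq)
      finally show ?thesis .
    qed
    have f2_one: "1 \<le> f2 (t, x) \<longleftrightarrow> norm x \<le> R / 2" for t x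
    proof -
      have "1 \<le> f2 (t, x) \<longleftrightarrow> \<bar>2 * norm x / R\<bar> \<le> \<bar>1\<bar>"
        unfolding f2_eq abs_le_square_iff by simp
      also have "\<dots> \<longleftrightarrow> norm x \<le> R / 2" using R by (simp add: abs_divide divide_le_eq le_divide_eq mult.commute)
      finally show ?thesis .
    qed
    have df1: "(f1 has_derivative (\<lambda>b. - 2 * fst z * fst b / (3 * T\<^sup>2))) (at z)" for z
      unfolding f1_def using T by (auto intro!: derivative_eq_intros simp: power2_eq_square field_simps)
    have df2: "(f2 has_derivative (\<lambda>b. - 8 * (snd z \<bullet> snd b) / (3 * R\<^sup>2))) (at z)" for z
      unfolding f2_def using R by (auto intro!: derivative_eq_intros simp: inner_commute field_simps)
    have Cf1: "Cinf_on UNIV f1"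
    proof -
      have "Cinf_on UNIV (\<lambda>z :: 'n spacetime. (4 - (fst z * (1 / T)) ^ 2) * (1 / 3))"
        by (intro Cinf_on_mult Cinf_on_diff Cinf_on_power Cinf_on_const Cinf_on_bounded_linear bounded_linear_fst) auto
      then show ?thesis by (simp add: f1_def)
    qed
    have Cf2: "Cinf_on UNIV f2"
    proof -
      have "Cinf_on UNIV (\<lambda>z :: 'n spacetime. snd z $ i)" for i
        by (intro Cinf_on_bounded_linear) (auto intro: bounded_linear_compose[OF bounded_linear_vec_nth bounded_linear_snd])
      then have "Cinf_on UNIV (\<lambda>z :: 'n spacetime. (4 - (4 / R\<^sup>2) * (\<Sum>i\<in>UNIV. snd z $ i * snd z $ i)) * (1 / 3))"
        by (intro Cinf_on_mult Cinf_on_diff Cinf_on_sum Cinf_on_const) auto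
      then show ?thesis by (simp add: f2_def inner_vec_def)
    qed
    have C1: "Cinf_on UNIV (\<lambda>z. \<theta> (f1 z))" and C2: "Cinf_on UNIV (\<lambda>z. \<theta> (f2 z))"
      by (intro Cinf_on_compose[OF _ _ _ C\<theta>] Cf1 Cf2; simp)+
    have C\<zeta>: "Cinf_on UNIV \<zeta>" unfolding \<zeta>_def by (intro Cinf_on_mult C1 C2) auto
    have nz: "\<zeta> (t, x) \<noteq> 0 \<longrightarrow> \<bar>t\<bar> < 2 * T \<and> norm x < R" for t x
      using \<theta>z[of "f1 (t, x)"] \<theta>z[of "f2 (t, x)"] f1_pos[of t x] f2_pos[of t x] unfolding \<zeta>_def
      by (metis linorder_not_less mult_zero_left mult_zero_right)
    have "{z. \<zeta> z \<noteq> 0} \<subseteq> {-2*T..2*T} \<times> cball 0 R"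
      using nz by (force simp: abs_less_iff)
    then have "bounded {z. \<zeta> z \<noteq> 0}"
      by (rule bounded_subset[rotated]) (intro bounded_Times bounded_closed_interval bounded_cball)
    then have cs: "compact_smooth \<zeta>" unfolding compact_smooth_def using C\<zeta> by (simp add: compact_closure)
    have one: "\<bar>t\<bar> \<le> T \<and> norm x \<le> R / 2 \<longrightarrow> \<zeta> (t, x) = 1" for t x
      using \<theta>o f1_one[of t x] f2_one[of t x] unfolding \<zeta>_def by simp
    have dfst: "dt f1 z = - 2 * fst z / (3 * T\<^sup>2)" "xgrad f1 z = 0" for z
      unfolding dt_eqI[OF df1] xgrad_eqI[OF df1] by (auto simp: vec_eq_iff)
    have dsnd: "dt f2 z = 0" "xgrad f2 z = (- 8 / (3 * R\<^sup>2)) *\<^sub>R snd z" for z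
      unfolding dt_eqI[OF df2] xgrad_eqI[OF df2] by (auto simp: vec_eq_iff inner_axis)
    note ch1 = xgrad_dt_chain[OF df1 d\<theta>] and ch2 = xgrad_dt_chain[OF df2 d\<theta>]
    note pr = xgrad_dt_mult[OF Cinf_on_has_derivative[OF C1 UNIV_I] Cinf_on_has_derivative[OF C2 UNIV_I]]
    have dt\<zeta>: "dt \<zeta> z = \<theta> (f2 z) * (\<theta>' (f1 z) * (- 2 * fst z / (3 * T\<^sup>2)))" for z
      unfolding \<zeta>_def pr(2) ch1(2) ch2(2) dfst dsnd by simp
    have dx\<zeta>: "xgrad \<zeta> z = (\<theta> (f1 z) * \<theta>' (f2 z) * (- 8 / (3 * R\<^sup>2))) *\<^sub>R snd z" for z
      unfolding \<zeta>_def pr(1) ch1(1) ch2(1) dfst dsnd by simp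
    have tnz: "dt \<zeta> (t, x) \<noteq> 0 \<longrightarrow> T < \<bar>t\<bar> \<and> \<bar>t\<bar> < 2 * T \<and> norm x < R" for t x
      using \<theta>'z[of "f1 (t, x)"] \<theta>z[of "f2 (t, x)"] f1_pos[of t x] f1_one[of t x] f2_pos[of t x]
      unfolding dt\<zeta> by (auto simp: not_le not_less)
    have xnz: "xgrad \<zeta> (t, x) \<noteq> 0 \<longrightarrow> \<bar>t\<bar> < 2 * T \<and> R / 2 < norm x \<and> norm x < R" for t x
      using \<theta>'z[of "f2 (t, x)"] \<theta>z[of "f1 (t, x)"] f1_pos[of t x] f2_one[of t x] f2_pos[of t x]
      unfolding dx\<zeta> by (auto simp: not_le not_less)
    have tb: "\<bar>dt \<zeta> (t, x)\<bar> \<le> B / T" for t x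
    proof (cases "dt \<zeta> (t, x) = 0")
      case False
      then have t: "\<bar>t\<bar> < 2 * T" using tnz by blast
      have "\<bar>dt \<zeta> (t, x)\<bar> = \<bar>\<theta> (f2 (t, x))\<bar> * (\<bar>\<theta>' (f1 (t, x))\<bar> * (2 * \<bar>t\<bar> / (3 * T\<^sup>2)))"
        unfolding dt\<zeta> by (simp add: abs_mult abs_divide)
      also have "\<dots> \<le> 1 * (B0 * (2 * (2 * T) / (3 * T\<^sup>2)))"
        using \<theta>0 \<theta>1 B0 B0' t T by (intro mult_mono divide_right_mono) (auto simp: abs_of_nonneg)
      also have "\<dots> = (4 / 3 * B0) / T" using T by (simp add: power2_eq_square)
      also have "\<dots> \<le> B / T" using T B0' by (intro divide_right_mono) (auto simp: B_def)
      finally show ?thesis .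
    qed (use B T in simp)
    have xb: "norm (xgrad \<zeta> (t, x)) \<le> B / R" for t x
    proof (cases "xgrad \<zeta> (t, x) = 0")
      case False
      then have x: "norm x < R" using xnz by blast
      have "norm (xgrad \<zeta> (t, x)) = \<bar>\<theta> (f1 (t, x))\<bar> * \<bar>\<theta>' (f2 (t, x))\<bar> * (8 / (3 * R\<^sup>2)) * norm x"
        unfolding dx\<zeta> by (simp add: abs_mult abs_divide)
      also have "\<dots> \<le> 1 * B0 * (8 / (3 * R\<^sup>2)) * R"
        using \<theta>0 \<theta>1 B0 B0' x R by (intro mult_mono) (auto simp: abs_of_nonneg)
      also have "\<dots> = (8 / 3 * B0) / R" using R by (simp add: power2_eq_square)
      also have "\<dots> \<le> B / R" using R B0' by (intro divide_right_mono) (auto simp: B_def)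
      finally show ?thesis .
    qed (use B R in simp)
    have b01: "0 \<le> \<zeta> z \<and> \<zeta> z \<le> 1" for z
      unfolding \<zeta>_def using \<theta>0 \<theta>1 by (simp add: mult_le_one)
    show ?thesis using cs b01 nz one tb tnz xb xnz unfolding space_time_cutoff_def by (intro exI[of _ \<zeta>]) blast
  qed
  show ?thesis using that[OF B main] by blast
qed

text \<open>The time scale \<open>R powr \<alpha>\<close> belongs to the length scale \<open>R\<close>: the coefficients are at most of order \<open>R powr (2 - \<alpha>)\<close>, so that
  differentiating a cutoff once in time costs as much as differentiating it twice in space.\<close>

definition outer_cyl :: "real \<Rightarrow> real \<Rightarrow> ('n::finite) spacetime set" where
  "outer_cyl \<alpha> R = {- (2 * R powr \<alpha>)..2 * R powr \<alpha>} \<times> cball 0 R"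

definition inner_cyl :: "real \<Rightarrow> real \<Rightarrow> ('n::finite) spacetime set" where
  "inner_cyl \<alpha> R = {- (R powr \<alpha>)..R powr \<alpha>} \<times> cball 0 (R / 2)"

lemma mem_outer_cyl: "z \<in> outer_cyl \<alpha> R \<longleftrightarrow> \<bar>fst z\<bar> \<le> 2 * R powr \<alpha> \<and> norm (snd z) \<le> R"
  unfolding outer_cyl_def mem_Times_iff by (auto simp: abs_le_iff)

lemma mem_inner_cyl: "z \<in> inner_cyl \<alpha> R \<longleftrightarrow> \<bar>fst z\<bar> \<le> R powr \<alpha> \<and> norm (snd z) \<le> R / 2"
  unfolding inner_cyl_def mem_Times_iff by (auto simp: abs_le_iff)

lemma inner_cyl_subset: "inner_cyl \<alpha> R \<subseteq> outer_cyl \<alpha> R" if "0 < R"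
proof -
  have "0 \<le> R powr \<alpha>" by simp
  then show ?thesis using that unfolding inner_cyl_def outer_cyl_def by (intro Sigma_mono) auto
qed

lemma closed_cyl: "closed (outer_cyl \<alpha> R)" "closed (inner_cyl \<alpha> R)"
  unfolding outer_cyl_def inner_cyl_def by (intro closed_Times closed_atLeastAtMost closed_cball)+

lemma cyl_in_sets_lebesgue [measurable]:
  "outer_cyl \<alpha> R \<in> sets lebesgue" "inner_cyl \<alpha> R \<in> sets lebesgue"
  using closed_cyl by (auto intro!: sets_completionI_sets borel_closed)

lemma measure_outer_cyl_le:
  assumes R: "1 < R"
  shows "outer_cyl \<alpha> R \<in> lmeasurable"
    "measure lebesgue (outer_cyl \<alpha> R :: ('n::finite) spacetime set) \<le> 4 * 2 ^ CARD('n) * (R powr \<alpha> * R ^ CARD('n))"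
proof -
  let ?T = "2 * R powr \<alpha>" and ?B = "cbox (- (R *\<^sub>R One)) (R *\<^sub>R One) :: (real ^ 'n) set"
  have T: "0 < ?T" using R by simp
  have "x \<in> ?B" if "norm x \<le> R" for x :: "real ^ 'n"
    using Basis_le_norm[of _ x] that by (force simp: mem_box abs_le_iff)
  then have sub: "outer_cyl \<alpha> R \<subseteq> cbox (- ?T, - (R *\<^sub>R One)) (?T, R *\<^sub>R One :: real ^ 'n)"
    unfolding outer_cyl_def cbox_Pair_eq by (intro Sigma_mono) auto
  show lm: "outer_cyl \<alpha> R \<in> lmeasurable"
    unfolding outer_cyl_def
    by (intro lmeasurable_compact compact_Times compact_Icc compact_cball)
  have "measure lebesgue (outer_cyl \<alpha> R :: 'n spacetime set) \<le> measure lebesgue (cbox (- ?T, - (R *\<^sub>R One)) (?T, R *\<^sub>R One :: real ^ 'n))"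
    using sub lm by (intro measure_mono_fmeasurable) (auto simp: fmeasurableD)
  also have "\<dots> = (2 * ?T) * (2 * R) ^ CARD('n)"
  proof -
    have "measure lborel ?B = (\<Prod>i\<in>(Basis :: (real ^ 'n) set). 2 * R)"
      using R by (subst content_cbox) (auto simp: inner_minus_left)
    then have "measure lborel ?B = (2 * R) ^ CARD('n)" by simp
    moreover have "measure lborel {- ?T..?T} = 2 * ?T" using T by simp
    ultimately show ?thesis by (simp add: content_Pair)
  qed
  also have "\<dots> = 4 * 2 ^ CARD('n) * (R powr \<alpha> * R ^ CARD('n))"
    by (simp add: power_mult_distrib)
  finally show "measure lebesgue (outer_cyl \<alpha> R :: 'n spacetime set) \<le> 4 * 2 ^ CARD('n) * (R powr \<alpha> * R ^ CARD('n))" .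
qed

lemma integral_lebesgue_on_eq_lebesgue:
  fixes f :: "'a::euclidean_space \<Rightarrow> real"
  assumes "open \<Omega>" "\<And>z. z \<notin> \<Omega> \<Longrightarrow> f z = 0"
  shows "integral\<^sup>L (lebesgue_on \<Omega>) f = integral\<^sup>L lebesgue f"
    "integrable (lebesgue_on \<Omega>) f \<longleftrightarrow> integrable lebesgue f"
proof -
  have "(\<lambda>z. indicator \<Omega> z *\<^sub>R f z) = f" using assms(2) by (auto simp: indicator_def fun_eq_iff)
  then show "integral\<^sup>L (lebesgue_on \<Omega>) f = integral\<^sup>L lebesgue f"
    "integrable (lebesgue_on \<Omega>) f \<longleftrightarrow> integrable lebesgue f"
    using integral_restrict_space[of \<Omega> lebesgue f] integrable_restrict_space[of \<Omega> lebesgue f] assms(1)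
    by (simp_all add: open_in_sets_lebesgue)
qed

lemma ess_bound_imp_AE:
  assumes "ess_bound A R \<le> ereal K"
  shows "AE z in lebesgue. R / 2 < norm (snd z) \<and> norm (snd z) < R \<longrightarrow> A z \<le> K"
proof -
  let ?S = "UNIV \<times> {x :: real ^ 'a. R / 2 < norm x \<and> norm x < R} :: 'a spacetime set"
  have "open ?S" by (intro open_Times open_Collect_conj open_Collect_less continuous_intros) auto
  then have "?S \<in> sets lebesgue" by (rule open_in_sets_lebesgue)
  moreover have "AE z in restrict_space lebesgue ?S. A z \<le> K"
  proof -
    have "AE z in restrict_space lebesgue ?S. ereal (A z) \<le> esssup (restrict_space lebesgue ?S) (\<lambda>z. ereal (A z))"
      by (rule esssup_AE)
    then show ?thesis
    proof eventually_elim
      case (elim z)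
      then have "ereal (A z) \<le> ereal K"
        by (rule order_trans[OF _ assms[unfolded ess_bound_def]])
      then show ?case by simp
    qed
  qed
  ultimately have "AE z in lebesgue. z \<in> ?S \<longrightarrow> A z \<le> K"
    by (subst (asm) AE_restrict_space_iff) auto
  then show ?thesis by eventually_elim auto
qed

lemma domain_set_ball: "0 < r \<Longrightarrow> domain_set (ball (0 :: ('n::finite) spacetime) r)"
  unfolding domain_set_def by (auto simp: convex_connected)

lemma outer_cyl_subset_ball: "outer_cyl \<alpha> R \<subseteq> ball 0 (2 * R powr \<alpha> + R + 1)"
proof
  fix z :: "'a spacetime" assume z: "z \<in> outer_cyl \<alpha> R"
  obtain t x where zt: "z = (t, x)" by (cases z)
  have "norm z \<le> norm t + norm x" unfolding zt by (rule norm_Pair_le)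
  also have "\<dots> \<le> 2 * R powr \<alpha> + R"
    using z unfolding zt outer_cyl_def by (intro add_mono) auto
  finally show "z \<in> ball 0 (2 * R powr \<alpha> + R + 1)" by simp
qed

lemma difference_powr_integrable:
  assumes a: "admissible_coefficients a A" and q: "1 < q"
    and u: "weak_supersolution a q u" and v: "weak_subsolution a q v" and \<Omega>: "domain_set \<Omega>" "bounded \<Omega>"
  shows "integrable (lebesgue_on \<Omega>) (\<lambda>z. \<bar>u z - v z\<bar> powr q)"
proof -
  obtain U V where "supersolution_sequence a q \<Omega> u U" "subsolution_sequence a q \<Omega> v V"
    using weak_supersolution_sequence[OF a q u \<Omega>] weak_subsolution_sequence[OF a q v \<Omega>] by metis
  then show ?thesis
    using q by (intro integrable_powr_diff)
      (auto simp: supersolution_sequence_def subsolution_sequence_def W_approx_def)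
qed

text \<open>The comparison inequality with a cutoff for the cylinders of scale \<open>R\<close>. The right-hand side extends
  only over the region in which the cutoff varies, and the equation itself no longer occurs.\<close>

definition annulus_estimate ::
    "real \<Rightarrow> real \<Rightarrow> real \<Rightarrow> nat \<Rightarrow> real \<Rightarrow> real \<Rightarrow> (('n::finite) spacetime \<Rightarrow> real) \<Rightarrow> bool" where
  "annulus_estimate \<alpha> p q s E R w \<longleftrightarrow> (\<exists>\<zeta>. continuous_on UNIV \<zeta> \<and> (\<forall>z. 0 \<le> \<zeta> z \<and> \<zeta> z \<le> 1) \<and>
      (\<forall>z. z \<notin> outer_cyl \<alpha> R \<longrightarrow> \<zeta> z = 0) \<and> (\<forall>z\<in>inner_cyl \<alpha> R. \<zeta> z = 1) \<and>
      (\<forall>\<omega>>0. (\<integral>z. \<bar>w z\<bar> powr q * \<zeta> z ^ s \<partial>lebesgue) \<le>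
         E * R powr (- \<alpha>) * \<omega> * (\<integral>z. (1 + \<bar>w z / \<omega>\<bar> powr p) *
           (\<zeta> z ^ (s - 2) * indicator (outer_cyl \<alpha> R - inner_cyl \<alpha> R) z) \<partial>lebesgue)))"

text \<open>Both kinds of derivatives of the cutoff cost a factor \<open>R powr (- \<alpha>)\<close>: the time derivative by the choice of the
  cylinder, the energy by \<open>R powr (2 - \<alpha>)\<close> for the coefficients times \<open>R powr (- 2)\<close> for the squared gradient. The term
  linear in the solution, which comes from the time derivative, is absorbed by \<open>y \<le> 1 + y powr p\<close>.\<close>

lemma cylinder_estimate:
  fixes a :: "'n::finite \<Rightarrow> 'n \<Rightarrow> 'n spacetime \<Rightarrow> real" and s :: nat
  assumes p: "1 < p" "p < q" and s: "2 \<le> s" and a: "admissible_coefficients a A" and c: "0 < c"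
    and bound: "\<And>R. R > 1 \<Longrightarrow> ess_bound A R \<le> ereal (c * R powr (2 - \<alpha>))"
    and u: "weak_supersolution a q u" and v: "weak_subsolution a q v" and uv: "AE z in lebesgue. u z \<ge> v z"
  obtains E where "0 < E" "\<And>R. 1 < R \<Longrightarrow> annulus_estimate \<alpha> p q s E R (\<lambda>z. u z - v z)"
proof -
  have q: "1 < q" using p by simp
  obtain D where D: "0 < D" and comp: "\<And>\<zeta> \<Omega> \<omega>. \<lbrakk>domain_set \<Omega>; bounded \<Omega>; compact_smooth \<zeta>;
        \<And>z. 0 \<le> \<zeta> z; \<And>z. \<zeta> z \<le> 1; closure {z. \<zeta> z \<noteq> 0} \<subseteq> \<Omega>; 0 < \<omega>\<rbrakk> \<Longrightarrow>
       (\<integral>z. \<bar>u z - v z\<bar> powr q * \<zeta> z ^ s \<partial>lebesgue_on \<Omega>) \<le>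
       D * ((\<integral>z. \<bar>u z - v z\<bar> * \<bar>dt (\<lambda>z. \<zeta> z ^ s) z\<bar> \<partial>lebesgue_on \<Omega>) +
         \<omega> * (\<integral>z. (1 + \<bar>(u z - v z) / \<omega>\<bar> powr p) * (\<zeta> z ^ (s - 2) * grad_form a \<zeta> \<zeta> z) \<partial>lebesgue_on \<Omega>))"
    by (fact comparison_inequality[OF p s a u v uv])
  obtain B where B: "0 < B"
    and cut: "\<And>T R. 0 < T \<Longrightarrow> 0 < R \<Longrightarrow> \<exists>\<zeta> :: 'n spacetime \<Rightarrow> real. space_time_cutoff B T R \<zeta>"
    by (fact exists_space_time_cutoff)
  define E where "E = D * (real s * B + c * B\<^sup>2)"
  have E: "0 < E" using D B c by (simp add: E_def add_nonneg_pos)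
  show ?thesis
  proof (rule that[OF E])
    fix R :: real assume R: "1 < R"
    define T where "T = R powr \<alpha>"
    have T: "0 < T" using R by (simp add: T_def)
    have R0: "0 < R" using R by simp
    obtain \<zeta> :: "'n spacetime \<Rightarrow> real" where cs: "compact_smooth \<zeta>" and \<zeta>01: "\<And>z. 0 \<le> \<zeta> z \<and> \<zeta> z \<le> 1"
      and nz: "\<And>t x. \<zeta> (t, x) \<noteq> 0 \<Longrightarrow> \<bar>t\<bar> < 2 * T \<and> norm x < R"
      and one: "\<And>t x. \<bar>t\<bar> \<le> T \<and> norm x \<le> R / 2 \<Longrightarrow> \<zeta> (t, x) = 1"
      and tb: "\<And>t x. \<bar>dt \<zeta> (t, x)\<bar> \<le> B / T"
      and tnz: "\<And>t x. dt \<zeta> (t, x) \<noteq> 0 \<Longrightarrow> T < \<bar>t\<bar> \<and> \<bar>t\<bar> < 2 * T \<and> norm x < R"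
      and xb: "\<And>t x. norm (xgrad \<zeta> (t, x)) \<le> B / R"
      and xnz: "\<And>t x. xgrad \<zeta> (t, x) \<noteq> 0 \<Longrightarrow> \<bar>t\<bar> < 2 * T \<and> R / 2 < norm x \<and> norm x < R"
      using cut[OF T R0] unfolding space_time_cutoff_def by metis
    have C: "Cinf_on UNIV \<zeta>" using cs by (simp add: compact_smooth_def)
    have cont: "continuous_on UNIV \<zeta>" by (rule Cinf_on_continuous[OF C])
    have out: "\<zeta> z = 0" if "z \<notin> outer_cyl \<alpha> R" for z
    proof (rule ccontr)
      assume "\<zeta> z \<noteq> 0"
      then have "\<bar>fst z\<bar> < 2 * T \<and> norm (snd z) < R" using nz[of "fst z" "snd z"] by simp
      then have "z \<in> outer_cyl \<alpha> R" unfolding T_def by (auto simp: mem_outer_cyl)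
      with that show False by simp
    qed
    have inn: "\<zeta> z = 1" if "z \<in> inner_cyl \<alpha> R" for z
      using that one[of "fst z" "snd z"] unfolding T_def by (auto simp: mem_inner_cyl)
    let ?An = "outer_cyl \<alpha> R - inner_cyl \<alpha> R :: 'n spacetime set"
    have An_t: "z \<in> ?An" if "dt \<zeta> z \<noteq> 0" for z
      using tnz[of "fst z" "snd z"] that unfolding T_def by (auto simp: mem_outer_cyl mem_inner_cyl)
    have An_x: "z \<in> ?An" "R / 2 < norm (snd z)" "norm (snd z) < R" if "xgrad \<zeta> z \<noteq> 0" for z
      using xnz[of "fst z" "snd z"] that unfolding T_def by (auto simp: mem_outer_cyl mem_inner_cyl)
    define \<Omega> :: "'n spacetime set" where "\<Omega> = ball 0 (2 * R powr \<alpha> + R + 1)"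
    have \<Omega>: "domain_set \<Omega>" "bounded \<Omega>" "open \<Omega>"
      unfolding \<Omega>_def using R T by (auto intro!: domain_set_ball add_pos_pos simp: T_def)
    have Q\<Omega>: "outer_cyl \<alpha> R \<subseteq> \<Omega>" unfolding \<Omega>_def by (rule outer_cyl_subset_ball)
    have "closure {z. \<zeta> z \<noteq> 0} \<subseteq> outer_cyl \<alpha> R"
      by (rule closure_minimal[OF _ closed_cyl(1)]) (use out in blast)
    then have supp: "closure {z. \<zeta> z \<noteq> 0} \<subseteq> \<Omega>" using Q\<Omega> by simp
    let ?M = "lebesgue_on \<Omega>"
    interpret finite_measure ?M by (rule finite_measure_lebesgue_on[OF \<Omega>(3,2)])
    have fin: "finite_measure ?M" by (rule finite_measure_lebesgue_on[OF \<Omega>(3,2)])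
    have muv[measurable]: "u \<in> borel_measurable lebesgue" "v \<in> borel_measurable lebesgue"
      using u v by (auto simp: weak_supersolution_def weak_subsolution_def)
    have [measurable]: "u \<in> borel_measurable ?M" "v \<in> borel_measurable ?M"
      using muv by (auto intro: measurable_restrict_space1)
    have ip: "integrable ?M (\<lambda>z. \<bar>u z - v z\<bar> powr p)"
      by (rule integrable_lower_powr[OF fin _ _ _ difference_powr_integrable[OF a q u v \<Omega>(1,2)]])
         (use p in auto)
    let ?\<chi> = "\<lambda>z. \<zeta> z ^ (s - 2) * indicator ?An z"
    have \<chi>: "0 \<le> ?\<chi> z" "\<bar>?\<chi> z\<bar> \<le> 1" for z
      using \<zeta>01[of z] by (auto simp: indicator_def power_le_one)
    have m\<zeta>: "\<zeta> \<in> borel_measurable ?M"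
      by (intro continuous_on_measurable_lebesgue_on[OF \<Omega>(3)] continuous_on_subset[OF cont]) auto
    have "?An \<in> sets lebesgue" by measurable
    then have mAn: "indicator ?An \<in> borel_measurable ?M"
      by (intro measurable_restrict_space1 borel_measurable_indicator)
    have m\<chi>: "?\<chi> \<in> borel_measurable ?M" using m\<zeta> mAn by measurable
    have est: "(\<integral>z. \<bar>u z - v z\<bar> powr q * \<zeta> z ^ s \<partial>lebesgue) \<le>
         E * R powr (- \<alpha>) * \<omega> * (\<integral>z. (1 + \<bar>(u z - v z) / \<omega>\<bar> powr p) * ?\<chi> z \<partial>lebesgue)" if \<omega>: "0 < \<omega>" for \<omega>
    proof -
      let ?Y = "\<lambda>z. 1 + \<bar>(u z - v z) / \<omega>\<bar> powr p"
      let ?J = "\<integral>z. ?Y z * ?\<chi> z \<partial>?M"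
      have iY: "integrable ?M ?Y"
        using ip \<omega> by (simp add: powr_divide abs_divide)
      have iJ: "integrable ?M (\<lambda>z. ?Y z * ?\<chi> z)"
        by (rule integral_mult_bounded_le(1)[OF iY m\<chi> \<chi>(2)])
      have Y0: "0 \<le> ?Y z" for z by (simp add: add_nonneg_nonneg)
      have time: "(\<integral>z. \<bar>u z - v z\<bar> * \<bar>dt (\<lambda>z. \<zeta> z ^ s) z\<bar> \<partial>?M) \<le> (\<omega> * (real s * B * R powr (- \<alpha>))) * ?J"
      proof -
        have "(\<integral>z. \<bar>u z - v z\<bar> * \<bar>dt (\<lambda>z. \<zeta> z ^ s) z\<bar> \<partial>?M) \<le> (\<integral>z. (\<omega> * (real s * B * R powr (- \<alpha>))) * (?Y z * ?\<chi> z) \<partial>?M)"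
        proof (rule integral_mono')
          show "integrable ?M (\<lambda>z. (\<omega> * (real s * B * R powr (- \<alpha>))) * (?Y z * ?\<chi> z))" using iJ by simp
          show nn: "0 \<le> (\<omega> * (real s * B * R powr (- \<alpha>))) * (?Y z * ?\<chi> z)" for z
            by (rule mult_nonneg_nonneg[OF _ mult_nonneg_nonneg[OF Y0 \<chi>(1)]]) (use \<omega> B in auto)
          fix z
          show "\<bar>u z - v z\<bar> * \<bar>dt (\<lambda>z. \<zeta> z ^ s) z\<bar> \<le> (\<omega> * (real s * B * R powr (- \<alpha>))) * (?Y z * ?\<chi> z)"
          proof (cases "dt \<zeta> z = 0")
            case True
            then show ?thesis unfolding xgrad_dt_power(2)[OF C UNIV_I] using nn[of z] by simp
          next
            case False
            have 1: "\<bar>u z - v z\<bar> \<le> \<omega> * ?Y z"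
            proof -
              define y where "y = \<bar>(u z - v z) / \<omega>\<bar>"
              have "y \<le> 1 + y powr p"
              proof (cases "y \<le> 1")
                case False
                then have "y powr 1 \<le> y powr p" using p by (intro powr_mono) auto
                then show ?thesis using False by simp
              qed (simp add: add_increasing2)
              then have "\<omega> * y \<le> \<omega> * (1 + y powr p)" using \<omega> by (intro mult_left_mono) auto
              moreover have "\<omega> * y = \<bar>u z - v z\<bar>" using \<omega> by (simp add: y_def abs_divide)
              ultimately show ?thesis unfolding y_def by argo
            qed
            have "\<bar>dt (\<lambda>z. \<zeta> z ^ s) z\<bar> = real s * \<zeta> z ^ (s - 1) * \<bar>dt \<zeta> z\<bar>"
              unfolding xgrad_dt_power(2)[OF C UNIV_I] using \<zeta>01[of z] by (simp add: abs_mult)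
            also have "\<dots> \<le> real s * \<zeta> z ^ (s - 2) * (B / T)"
              using \<zeta>01[of z] tb[of "fst z" "snd z"] by (intro mult_mono power_decreasing) auto
            also have "\<dots> = real s * B * R powr (- \<alpha>) * ?\<chi> z"
              using An_t[OF False] by (simp add: T_def powr_minus divide_inverse)
            finally have 2: "\<bar>dt (\<lambda>z. \<zeta> z ^ s) z\<bar> \<le> real s * B * R powr (- \<alpha>) * ?\<chi> z" .
            have "\<bar>u z - v z\<bar> * \<bar>dt (\<lambda>z. \<zeta> z ^ s) z\<bar> \<le> (\<omega> * ?Y z) * (real s * B * R powr (- \<alpha>) * ?\<chi> z)"
              by (rule mult_mono[OF 1 2]) (use \<omega> Y0 in auto)
            then show ?thesis by (simp only: mult_ac)
          qed
        qed
        then show ?thesis by simp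
      qed
      have space: "(\<integral>z. ?Y z * (\<zeta> z ^ (s - 2) * grad_form a \<zeta> \<zeta> z) \<partial>?M) \<le> (c * B\<^sup>2 * R powr (- \<alpha>)) * ?J"
      proof -
        have i: "integrable ?M (\<lambda>z. (c * B\<^sup>2 * R powr (- \<alpha>)) * (?Y z * ?\<chi> z))" using iJ by simp
        have le: "AE z in ?M. 0 \<le> ?Y z * (\<zeta> z ^ (s - 2) * grad_form a \<zeta> \<zeta> z) \<and>
          ?Y z * (\<zeta> z ^ (s - 2) * grad_form a \<zeta> \<zeta> z) \<le> (c * B\<^sup>2 * R powr (- \<alpha>)) * (?Y z * ?\<chi> z)"
          using AE_lebesgue_on_sym_psd[OF a \<Omega>(3)] AE_lebesgue_on[OF \<Omega>(3) ess_bound_imp_AE[OF bound[OF R]]]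
        proof eventually_elim
          case (elim z)
          then have z: "sym_psd a A z" by simp
          have g0: "0 \<le> grad_form a \<zeta> \<zeta> z" unfolding grad_form_eq by (rule coef_form_nonneg[OF z])
          have "grad_form a \<zeta> \<zeta> z \<le> (c * B\<^sup>2 * R powr (- \<alpha>)) * indicator ?An z"
          proof (cases "xgrad \<zeta> z = 0")
            case True
            have "coef_form a z 0 0 = 0" by (simp add: coef_form_def)
            then show ?thesis unfolding grad_form_eq True using c by (simp add: indicator_def)
          next
            case False
            have A: "A z \<le> c * R powr (2 - \<alpha>)" using elim An_x[OF False] by simp
            have "grad_form a \<zeta> \<zeta> z \<le> A z * (norm (xgrad \<zeta> z))\<^sup>2"
              unfolding grad_form_eq using z by (simp add: sym_psd_def)
            also have "\<dots> \<le> (c * R powr (2 - \<alpha>)) * (B / R)\<^sup>2"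
              using A xb[of "fst z" "snd z"] c R by (intro mult_mono power_mono) auto
            also have "\<dots> = c * B\<^sup>2 * (R powr (2 - \<alpha>) / R powr 2)"
              using R by (simp add: power_divide)
            also have "\<dots> = c * B\<^sup>2 * R powr (- \<alpha>)"
              unfolding powr_diff[symmetric] by simp
            finally show ?thesis using An_x(1)[OF False] by simp
          qed
          then have "?Y z * (\<zeta> z ^ (s - 2) * grad_form a \<zeta> \<zeta> z) \<le> ?Y z * (\<zeta> z ^ (s - 2) * ((c * B\<^sup>2 * R powr (- \<alpha>)) * indicator ?An z))"
            using Y0[of z] \<zeta>01[of z] by (intro mult_left_mono) auto
          then show ?case using g0 Y0[of z] \<zeta>01[of z] by (auto simp: mult_ac)
        qed
        have "(\<integral>z. ?Y z * (\<zeta> z ^ (s - 2) * grad_form a \<zeta> \<zeta> z) \<partial>?M) \<le> (\<integral>z. (c * B\<^sup>2 * R powr (- \<alpha>)) * (?Y z * ?\<chi> z) \<partial>?M)"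
        proof (rule integral_mono_AE')
          show "integrable ?M (\<lambda>z. (c * B\<^sup>2 * R powr (- \<alpha>)) * (?Y z * ?\<chi> z))" by (fact i)
          show "AE z in ?M. ?Y z * (\<zeta> z ^ (s - 2) * grad_form a \<zeta> \<zeta> z) \<le> (c * B\<^sup>2 * R powr (- \<alpha>)) * (?Y z * ?\<chi> z)"
            using le by eventually_elim (rule conjunct2)
          show "AE z in ?M. 0 \<le> (c * B\<^sup>2 * R powr (- \<alpha>)) * (?Y z * ?\<chi> z)"
            using le by eventually_elim linarith
        qed
        then show ?thesis by simp
      qed
      have "(\<integral>z. \<bar>u z - v z\<bar> powr q * \<zeta> z ^ s \<partial>lebesgue) = (\<integral>z. \<bar>u z - v z\<bar> powr q * \<zeta> z ^ s \<partial>?M)"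
        by (rule integral_lebesgue_on_eq_lebesgue(1)[OF \<Omega>(3), symmetric]) (use out Q\<Omega> s in \<open>auto simp: subset_iff\<close>)
      also have "\<dots> \<le> D * ((\<integral>z. \<bar>u z - v z\<bar> * \<bar>dt (\<lambda>z. \<zeta> z ^ s) z\<bar> \<partial>?M) +
         \<omega> * (\<integral>z. ?Y z * (\<zeta> z ^ (s - 2) * grad_form a \<zeta> \<zeta> z) \<partial>?M))"
        by (rule comp[OF \<Omega>(1,2) cs _ _ supp \<omega>]) (use \<zeta>01 in auto)
      also have "\<dots> \<le> D * ((\<omega> * (real s * B * R powr (- \<alpha>))) * ?J + \<omega> * ((c * B\<^sup>2 * R powr (- \<alpha>)) * ?J))"
        using time space \<omega> D by (intro mult_left_mono add_mono) auto
      also have "\<dots> = E * R powr (- \<alpha>) * \<omega> * ?J" by (simp add: E_def algebra_simps)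
      also have "?J = (\<integral>z. ?Y z * ?\<chi> z \<partial>lebesgue)"
        by (rule integral_lebesgue_on_eq_lebesgue(1)[OF \<Omega>(3)]) (use Q\<Omega> in \<open>auto simp: indicator_def subset_iff\<close>)
      finally show ?thesis .
    qed
    show "annulus_estimate \<alpha> p q s E R (\<lambda>z. u z - v z)"
      unfolding annulus_estimate_def using cont \<zeta>01 out inn est by (intro exI[of _ \<zeta>]) blast
  qed
qed

section \<open>Vanishing of the difference\<close>

text \<open>The parameter is taken as \<open>\<omega> = \<eta> W\<close>, where \<open>W\<close> is determined by \<open>R powr (- \<alpha>) * W = W powr q\<close>. The upper bound on
  \<open>q\<close> says that \<open>W powr q\<close> times the volume of the cylinder remains bounded as \<open>R\<close> grows. With \<open>\<eta> = 1\<close> the power \<open>p\<close> is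
  absorbed by the left-hand side, because the condition on \<open>s\<close> makes the weights \<open>\<zeta>\<^bsup>s - 2\<^esup>\<close> and \<open>\<zeta>\<^sup>s\<close> comparable in
  Young's inequality; this gives a bound independent of \<open>R\<close>, so that the \<open>q\<close>-th power is integrable over
  space-time. For small \<open>\<eta>\<close> the estimate then splits into a part of order \<open>\<eta>\<close> and a multiple of the integral over
  the region outside the inner cylinder, which tends to 0. In the critical case \<open>q = 1 + \<alpha> / n\<close> the first step alone would
  yield nothing more than integrability.\<close>

lemma scale_estimates_imp_zero:
  fixes w :: "('n::finite) spacetime \<Rightarrow> real" and s :: nat
  assumes \<alpha>: "0 < \<alpha>" and p: "1 < p" "p < q" and q: "q \<le> 1 + \<alpha> / real CARD('n)"
    and s: "2 < s" "real s * (p / q) \<le> real s - 2"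
    and w[measurable]: "w \<in> borel_measurable lebesgue"
    and loc: "\<And>R. 1 < R \<Longrightarrow> integrable lebesgue (\<lambda>z. \<bar>w z\<bar> powr q * indicator (outer_cyl \<alpha> R) z)"
    and E: "0 < E"
    and est: "\<And>R. 1 < R \<Longrightarrow> annulus_estimate \<alpha> p q s E R w"
  shows "AE z in lebesgue. w z = 0"
proof -
  let ?n = "real CARD('n)"
  have q1: "1 < q" using p by simp
  define V where "V = 4 * 2 ^ CARD('n) + (1::real)"
  have V: "0 < V" by (simp add: V_def add_pos_pos)
  \<comment> \<open>The size at which the source term and the cost of the cutoff balance.\<close>
  define W where "W = (\<lambda>R. R powr (- \<alpha> / (q - 1)))"
  have W: "0 < W R" if "1 < R" for R using that by (simp add: W_def)
  have W_scale: "R powr (- \<alpha>) * W R = W R powr q" if "1 < R" for R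
  proof -
    have "- \<alpha> + - \<alpha> / (q - 1) = - \<alpha> / (q - 1) * q" using q1 by (simp add: field_simps)
    then show ?thesis by (simp add: W_def powr_powr powr_add[symmetric])
  qed
  have W_vol: "W R powr q * measure lebesgue (outer_cyl \<alpha> R :: 'n spacetime set) \<le> V" if R: "1 < R" for R
  proof -
    have n: "?n \<le> \<alpha> / (q - 1)"
      using q q1 by (simp add: field_simps)
    have "- \<alpha> / (q - 1) * q + \<alpha> + ?n \<le> 0"
    proof -
      have "- \<alpha> / (q - 1) * q + \<alpha> = - (\<alpha> / (q - 1))" using q1 by (simp add: field_simps)
      then show ?thesis using n by linarith
    qed
    then have e: "R powr (- \<alpha> / (q - 1) * q + \<alpha> + ?n) \<le> R powr 0" using R by (intro powr_mono) auto
    have "W R powr q * measure lebesgue (outer_cyl \<alpha> R :: 'n spacetime set) \<le>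
        W R powr q * (4 * 2 ^ CARD('n) * (R powr \<alpha> * R ^ CARD('n)))"
      by (intro mult_left_mono measure_outer_cyl_le R) auto
    also have "\<dots> = 4 * 2 ^ CARD('n) * R powr (- \<alpha> / (q - 1) * q + \<alpha> + ?n)"
    proof -
      have "R powr (- \<alpha> / (q - 1) * q + \<alpha> + ?n) = W R powr q * R powr \<alpha> * R ^ CARD('n)"
        unfolding powr_add W_def powr_powr using R by (simp only: powr_realpow)
      then show ?thesis by (simp only: mult_ac)
    qed
    also have "\<dots> \<le> 4 * 2 ^ CARD('n) * 1" using e R by (intro mult_left_mono) auto
    finally show ?thesis by (simp add: V_def)
  qed
  let ?N = "\<lambda>R. inner_cyl \<alpha> R :: 'n spacetime set" and ?Q = "\<lambda>R. outer_cyl \<alpha> R :: 'n spacetime set"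
  have Qi: "integrable lebesgue (indicator (?Q R) :: _ \<Rightarrow> real)" and Qm: "integral\<^sup>L lebesgue (indicator (?Q R)) = measure lebesgue (?Q R)"
    if "1 < R" for R
    using measure_outer_cyl_le(1)[OF that, of \<alpha>] by (auto simp: fmeasurable_def)

  \<comment> \<open>Any integrable majorant \<open>g\<close> of the integrand may be used; this spares a separate proof that the integrand
    itself is integrable.\<close>
  have scaled: "\<exists>\<zeta>. integrable lebesgue (\<lambda>z. \<bar>w z\<bar> powr q * \<zeta> z ^ s) \<and> (\<forall>z. 0 \<le> \<zeta> z \<and> \<zeta> z \<le> 1) \<and>
      (\<forall>z. z \<notin> ?Q R \<longrightarrow> \<zeta> z = 0) \<and> (\<forall>z\<in>?N R. \<zeta> z = 1) \<and>
      (\<forall>\<eta>>0. \<forall>g. integrable lebesgue g \<longrightarrow> (\<forall>z. 0 \<le> g z) \<longrightarrow>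
        (\<forall>z. (1 + \<eta> powr (- p) * (\<bar>w z\<bar> / W R) powr p) * (\<zeta> z ^ (s - 2) * indicator (?Q R - ?N R) z) \<le> g z) \<longrightarrow>
        (\<integral>z. \<bar>w z\<bar> powr q * \<zeta> z ^ s \<partial>lebesgue) \<le> E * \<eta> * W R powr q * integral\<^sup>L lebesgue g)"
    if R: "1 < R" for R
  proof -
    obtain \<zeta> where cont: "continuous_on UNIV \<zeta>" and \<zeta>01: "\<forall>z. 0 \<le> \<zeta> z \<and> \<zeta> z \<le> 1"
      and out: "\<forall>z. z \<notin> ?Q R \<longrightarrow> \<zeta> z = 0" and inn: "\<forall>z\<in>?N R. \<zeta> z = 1"
      and est: "\<And>\<omega>. 0 < \<omega> \<Longrightarrow> (\<integral>z. \<bar>w z\<bar> powr q * \<zeta> z ^ s \<partial>lebesgue) \<le>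
         E * R powr (- \<alpha>) * \<omega> * (\<integral>z. (1 + \<bar>w z / \<omega>\<bar> powr p) * (\<zeta> z ^ (s - 2) * indicator (?Q R - ?N R) z) \<partial>lebesgue)"
      using est[OF R] unfolding annulus_estimate_def by blast
    have "\<zeta> \<in> borel_measurable borel" using cont by (rule borel_measurable_continuous_onI)
    then have m\<zeta>[measurable]: "\<zeta> \<in> borel_measurable lebesgue" by (simp add: measurable_completion)
    have i: "integrable lebesgue (\<lambda>z. \<bar>w z\<bar> powr q * \<zeta> z ^ s)"
    proof (rule Bochner_Integration.integrable_bound[OF loc[OF R]])
      show "AE z in lebesgue. norm (\<bar>w z\<bar> powr q * \<zeta> z ^ s) \<le> norm (\<bar>w z\<bar> powr q * indicator (?Q R) z)"
      proof (rule AE_I2)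
        fix z
        show "norm (\<bar>w z\<bar> powr q * \<zeta> z ^ s) \<le> norm (\<bar>w z\<bar> powr q * indicator (?Q R) z)"
          using \<zeta>01[rule_format, of z] out[rule_format, of z] s
          by (cases "z \<in> ?Q R") (auto simp: abs_mult power_le_one mult_left_le zero_power)
      qed
    qed measurable
    have "(\<integral>z. \<bar>w z\<bar> powr q * \<zeta> z ^ s \<partial>lebesgue) \<le> E * \<eta> * W R powr q * integral\<^sup>L lebesgue g"
      if \<eta>: "0 < \<eta>" and g: "integrable lebesgue g" "\<forall>z. 0 \<le> g z"
        and le: "\<forall>z. (1 + \<eta> powr (- p) * (\<bar>w z\<bar> / W R) powr p) * (\<zeta> z ^ (s - 2) * indicator (?Q R - ?N R) z) \<le> g z" for \<eta> g
    proof -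
      have \<omega>: "0 < \<eta> * W R" using \<eta> W[OF R] by simp
      have eq: "\<bar>w z / (\<eta> * W R)\<bar> powr p = \<eta> powr (- p) * (\<bar>w z\<bar> / W R) powr p" for z
        using \<eta> W[OF R] by (simp add: abs_divide abs_mult powr_divide powr_mult powr_minus divide_inverse inverse_powr mult_ac)
      have "(\<integral>z. \<bar>w z\<bar> powr q * \<zeta> z ^ s \<partial>lebesgue) \<le> E * R powr (- \<alpha>) * (\<eta> * W R) *
        (\<integral>z. (1 + \<bar>w z / (\<eta> * W R)\<bar> powr p) * (\<zeta> z ^ (s - 2) * indicator (?Q R - ?N R) z) \<partial>lebesgue)"
        by (rule est[OF \<omega>])
      also have "\<dots> \<le> E * R powr (- \<alpha>) * (\<eta> * W R) * integral\<^sup>L lebesgue g"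
      proof (rule mult_left_mono)
        show "(\<integral>z. (1 + \<bar>w z / (\<eta> * W R)\<bar> powr p) * (\<zeta> z ^ (s - 2) * indicator (?Q R - ?N R) z) \<partial>lebesgue) \<le> integral\<^sup>L lebesgue g"
          unfolding eq by (rule integral_mono') (use g le in auto)
      qed (use E \<omega> in auto)
      also have "\<dots> = E * \<eta> * W R powr q * integral\<^sup>L lebesgue g"
        unfolding W_scale[OF R, symmetric] by (simp only: mult_ac)
      finally show ?thesis .
    qed
    with i \<zeta>01 out inn show ?thesis by (intro exI[of _ \<zeta>] conjI) blast+
  qed

  have y_scale: "W R powr q * (\<bar>y\<bar> / W R) powr q = \<bar>y\<bar> powr q" if "1 < R" for R y
    using W[OF that] by (simp add: powr_divide)

  \<comment> \<open>Step \<open>\<eta> = 1\<close>: the factor \<open>1 / (2 * E)\<close> lets half of the left-hand side absorb the right-hand side.\<close>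
  have "0 < p / q" "p / q < 1" using p by auto
  then obtain C1 where C1: "0 < C1" "\<And>x. 0 \<le> x \<Longrightarrow> x powr (p / q) \<le> 1 / (2 * E) * x + C1"
    using powr_le_eps_times_plus_const[of "p / q" "1 / (2 * E)"] E by auto
  define J where "J = 2 * E * (1 + C1) * V"
  have bounded: "(\<integral>z. \<bar>w z\<bar> powr q * indicator (?N R) z \<partial>lebesgue) \<le> J" if R: "1 < R" for R
  proof -
    obtain \<zeta> where i: "integrable lebesgue (\<lambda>z. \<bar>w z\<bar> powr q * \<zeta> z ^ s)" and Z: "\<forall>z. 0 \<le> \<zeta> z \<and> \<zeta> z \<le> 1"
      and inn: "\<forall>z\<in>?N R. \<zeta> z = 1"
      and F: "\<forall>\<eta>>0. \<forall>g. integrable lebesgue g \<longrightarrow> (\<forall>z. 0 \<le> g z) \<longrightarrow>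
        (\<forall>z. (1 + \<eta> powr (- p) * (\<bar>w z\<bar> / W R) powr p) * (\<zeta> z ^ (s - 2) * indicator (?Q R - ?N R) z) \<le> g z) \<longrightarrow>
        (\<integral>z. \<bar>w z\<bar> powr q * \<zeta> z ^ s \<partial>lebesgue) \<le> E * \<eta> * W R powr q * integral\<^sup>L lebesgue g"
      using scaled[OF R] by (elim exE conjE)
    note \<zeta>01 = Z[rule_format] and est = F[rule_format]
    let ?X = "\<integral>z. \<bar>w z\<bar> powr q * \<zeta> z ^ s \<partial>lebesgue"
    let ?g = "\<lambda>z. (1 + C1) * indicator (?Q R) z + 1 / (2 * E) * W R powr (- q) * (\<bar>w z\<bar> powr q * \<zeta> z ^ s)"
    have "?X \<le> E * 1 * W R powr q * integral\<^sup>L lebesgue ?g"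
    proof (rule est)
      show "integrable lebesgue ?g" using i Qi[OF R] by auto
      show g0: "0 \<le> ?g z" for z using C1 E \<zeta>01[of z] by (intro add_nonneg_nonneg mult_nonneg_nonneg) auto
      show "(1 + 1 powr (- p) * (\<bar>w z\<bar> / W R) powr p) * (\<zeta> z ^ (s - 2) * indicator (?Q R - ?N R) z) \<le> ?g z" for z
      proof (cases "z \<in> ?Q R - ?N R")
        case True
        let ?y = "\<bar>w z\<bar> / W R"
        have y: "0 \<le> ?y" using W[OF R] by simp
        have "?y powr p * \<zeta> z ^ (s - 2) \<le> ?y powr p * (\<zeta> z ^ s) powr (p / q)"
        proof (rule mult_left_mono)
          show "\<zeta> z ^ (s - 2) \<le> (\<zeta> z ^ s) powr (p / q)"
          proof (cases "\<zeta> z = 0")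
            case True
            then show ?thesis using s by (simp add: zero_power)
          next
            case False
            then have z: "0 < \<zeta> z" using \<zeta>01[of z] by linarith
            have "\<zeta> z ^ (s - 2) = \<zeta> z powr (real s - 2)"
              using z s by (simp add: powr_realpow[symmetric] of_nat_diff)
            also have "\<dots> \<le> \<zeta> z powr (real s * (p / q))"
              using z \<zeta>01[of z] s by (intro powr_mono') auto
            also have "\<dots> = (\<zeta> z ^ s) powr (p / q)"
              using z by (simp add: powr_realpow[symmetric] powr_powr)
            finally show ?thesis .
          qed
        qed auto
        also have "\<dots> = (?y powr q * \<zeta> z ^ s) powr (p / q)"
          using q1 \<zeta>01[of z] by (simp add: powr_mult powr_powr)
        also have "\<dots> \<le> 1 / (2 * E) * (?y powr q * \<zeta> z ^ s) + C1"
          using \<zeta>01[of z] by (intro C1) auto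
        also have "?y powr q = W R powr (- q) * \<bar>w z\<bar> powr q"
          using W[OF R] by (simp add: powr_divide powr_minus_divide)
        finally have 1: "?y powr p * \<zeta> z ^ (s - 2) \<le> 1 / (2 * E) * W R powr (- q) * (\<bar>w z\<bar> powr q * \<zeta> z ^ s) + C1"
          by (simp only: mult_ac)
        have "\<zeta> z ^ (s - 2) \<le> 1" using \<zeta>01[of z] by (simp add: power_le_one)
        then show ?thesis using 1 True by (simp add: distrib_right)
      next
        case False
        then show ?thesis using g0[of z] by simp
      qed
    qed simp
    also have "integral\<^sup>L lebesgue ?g = (1 + C1) * measure lebesgue (?Q R) + 1 / (2 * E) * W R powr (- q) * ?X"
      using i Qi[OF R] Qm[OF R] by simp
    also have "E * 1 * W R powr q * \<dots> = E * (1 + C1) * (W R powr q * measure lebesgue (?Q R)) + ?X / 2"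
    proof -
      have "W R powr q * W R powr (- q) = 1" using W[OF R] by (simp add: powr_add[symmetric])
      moreover have "e * 1 * k * (d * M + 1 / (2 * e) * m * X) = e * d * (k * M) + (k * m) * X / 2"
        if "0 < e" for e k d M m X :: real
        using that by (simp add: field_simps)
      ultimately show ?thesis using E by simp
    qed
    also have "\<dots> \<le> E * (1 + C1) * V + ?X / 2"
      using W_vol[OF R] E C1 by (intro add_right_mono mult_left_mono) auto
    finally have "?X \<le> J" by (simp add: J_def)
    moreover have "(\<integral>z. \<bar>w z\<bar> powr q * indicator (?N R) z \<partial>lebesgue) \<le> ?X"
      by (rule integral_mono'[OF i]) (use inn \<zeta>01 in \<open>auto simp: indicator_def\<close>)
    ultimately show ?thesis by linarith
  qed

  \<comment> \<open>The bound on all inner cylinders passes to the whole space by monotone convergence; the shift by 2 keeps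
    the scale above 1.\<close>
  let ?R = "\<lambda>j. real j + 2"
  let ?f = "\<lambda>j z. \<bar>w z\<bar> powr q * indicator (?N (?R j)) z"
  have fi: "integrable lebesgue (?f j)" for j
  proof (rule Bochner_Integration.integrable_bound)
    show "integrable lebesgue (\<lambda>z. \<bar>w z\<bar> powr q * indicator (?Q (?R j)) z)" by (rule loc) simp
    show "AE z in lebesgue. norm (?f j z) \<le> norm (\<bar>w z\<bar> powr q * indicator (?Q (?R j)) z)"
      using inner_cyl_subset[of "?R j" \<alpha>] by (intro AE_I2) (auto simp: indicator_def)
  qed measurable
  have N_mono: "?N (?R i) \<subseteq> ?N (?R j)" if "i \<le> j" for i j
  proof -
    have "?R i powr \<alpha> \<le> ?R j powr \<alpha>" using that \<alpha> by (intro powr_mono2) auto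
    then show ?thesis using that by (auto simp: mem_inner_cyl)
  qed
  have f_mono: "?f i z \<le> ?f j z" if "i \<le> j" for i j z
    using N_mono[OF that] by (auto simp: indicator_def)
  have lim: "(\<lambda>j. ?f j z) \<longlonglongrightarrow> \<bar>w z\<bar> powr q" for z
  proof (rule tendsto_eventually)
    have ev: "\<forall>\<^sub>F j in sequentially. c \<le> ?R j" for c
    proof -
      obtain m :: nat where "c \<le> real m" using real_arch_simple by blast
      then show ?thesis by (intro eventually_sequentiallyI[of m]) simp
    qed
    have "\<forall>\<^sub>F j in sequentially. \<bar>fst z\<bar> \<le> ?R j powr \<alpha>"
      using ev[of "\<bar>fst z\<bar> powr (1 / \<alpha>)"]
    proof eventually_elim
      case (elim j)
      then have "(\<bar>fst z\<bar> powr (1 / \<alpha>)) powr \<alpha> \<le> ?R j powr \<alpha>" using \<alpha> by (intro powr_mono2) auto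
      then show ?case using \<alpha> by (simp add: powr_powr)
    qed
    moreover have "\<forall>\<^sub>F j in sequentially. 2 * norm (snd z) \<le> ?R j" by (rule ev)
    ultimately show "\<forall>\<^sub>F j in sequentially. ?f j z = \<bar>w z\<bar> powr q"
      by eventually_elim (auto simp: mem_inner_cyl)
  qed
  have "convergent (\<lambda>j. integral\<^sup>L lebesgue (?f j))"
  proof (rule Bseq_mono_convergent)
    show "\<forall>i j. i \<le> j \<longrightarrow> integral\<^sup>L lebesgue (?f i) \<le> integral\<^sup>L lebesgue (?f j)"
      by (intro allI impI integral_mono fi f_mono)
    have "norm (integral\<^sup>L lebesgue (?f j)) \<le> J" for j
    proof -
      have "0 \<le> integral\<^sup>L lebesgue (?f j)" by (intro integral_nonneg_AE) simp
      then show ?thesis using bounded[of "?R j"] by simp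
    qed
    then show "Bseq (\<lambda>j. integral\<^sup>L lebesgue (?f j))" by (rule BseqI')
  qed
  then obtain I where I: "(\<lambda>j. integral\<^sup>L lebesgue (?f j)) \<longlonglongrightarrow> I" by (auto simp: convergent_def)
  have mono: "AE z in lebesgue. mono (\<lambda>j. ?f j z)" using f_mono by (intro AE_I2 monoI)
  have AElim: "AE z in lebesgue. (\<lambda>j. ?f j z) \<longlonglongrightarrow> \<bar>w z\<bar> powr q" using lim by (intro AE_I2)
  have mwq: "(\<lambda>z. \<bar>w z\<bar> powr q) \<in> borel_measurable lebesgue" by measurable
  have wi: "integrable lebesgue (\<lambda>z. \<bar>w z\<bar> powr q)"
    by (rule integrable_monotone_convergence[OF fi mono AElim I mwq])
  have I_eq: "integral\<^sup>L lebesgue (\<lambda>z. \<bar>w z\<bar> powr q) = I"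
    by (rule integral_monotone_convergence[OF fi mono AElim I mwq])

  \<comment> \<open>Step \<open>\<eta>\<close> small: the region outside the inner cylinders carries less and less of the integral, so that only
    the part of order \<open>\<eta>\<close> survives in the limit.\<close>
  have small: "I \<le> 2 * E * \<eta> * V" if \<eta>: "0 < \<eta>" for \<eta>
  proof -
    have "0 < \<eta> powr p" using \<eta> by simp
    then obtain C2 where C2: "0 < C2" "\<And>x. 0 \<le> x \<Longrightarrow> x powr p \<le> \<eta> powr p + C2 * x powr q"
      using powr_le_eps_plus_powr[of p q "\<eta> powr p"] p by auto
    define K where "K = E * \<eta> * (\<eta> powr (- p) * C2)"
    have step: "integral\<^sup>L lebesgue (?f j) \<le> 2 * E * \<eta> * V + K * (I - integral\<^sup>L lebesgue (?f j))" for j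
    proof -
      have R: "1 < ?R j" by simp
      obtain \<zeta> where i: "integrable lebesgue (\<lambda>z. \<bar>w z\<bar> powr q * \<zeta> z ^ s)" and Z: "\<forall>z. 0 \<le> \<zeta> z \<and> \<zeta> z \<le> 1"
        and inn: "\<forall>z\<in>?N (?R j). \<zeta> z = 1"
        and F: "\<forall>\<eta>>0. \<forall>g. integrable lebesgue g \<longrightarrow> (\<forall>z. 0 \<le> g z) \<longrightarrow>
          (\<forall>z. (1 + \<eta> powr (- p) * (\<bar>w z\<bar> / W (?R j)) powr p) * (\<zeta> z ^ (s - 2) * indicator (?Q (?R j) - ?N (?R j)) z) \<le> g z) \<longrightarrow>
          (\<integral>z. \<bar>w z\<bar> powr q * \<zeta> z ^ s \<partial>lebesgue) \<le> E * \<eta> * W (?R j) powr q * integral\<^sup>L lebesgue g"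
        using scaled[OF R] by (elim exE conjE)
      note \<zeta>01 = Z[rule_format] and est = F[rule_format, OF \<eta>]
      let ?X = "\<integral>z. \<bar>w z\<bar> powr q * \<zeta> z ^ s \<partial>lebesgue"
      let ?c = "\<eta> powr (- p) * C2 * W (?R j) powr (- q)"
      let ?g = "\<lambda>z. 2 * indicator (?Q (?R j)) z + ?c * (\<bar>w z\<bar> powr q - ?f j z)"
      have diff0: "0 \<le> \<bar>w z\<bar> powr q - ?f j z" for z by (simp add: indicator_def)
      have "integral\<^sup>L lebesgue (?f j) \<le> ?X"
        by (rule integral_mono'[OF i]) (use inn \<zeta>01 in \<open>auto simp: indicator_def\<close>)
      also have "?X \<le> E * \<eta> * W (?R j) powr q * integral\<^sup>L lebesgue ?g"
      proof (rule est)
        show "integrable lebesgue ?g" using Qi[OF R] wi fi[of j] by auto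
        show g0: "0 \<le> ?g z" for z using diff0[of z] C2 by (intro add_nonneg_nonneg mult_nonneg_nonneg) auto
        show "(1 + \<eta> powr (- p) * (\<bar>w z\<bar> / W (?R j)) powr p) * (\<zeta> z ^ (s - 2) * indicator (?Q (?R j) - ?N (?R j)) z) \<le> ?g z" for z
        proof (cases "z \<in> ?Q (?R j) - ?N (?R j)")
          case True
          let ?y = "\<bar>w z\<bar> / W (?R j)"
          have "?y powr p \<le> \<eta> powr p + C2 * ?y powr q" using W[OF R] by (intro C2) auto
          then have "\<eta> powr (- p) * ?y powr p \<le> \<eta> powr (- p) * (\<eta> powr p + C2 * ?y powr q)"
            by (intro mult_left_mono) auto
          also have "\<dots> = 1 + \<eta> powr (- p) * C2 * ?y powr q"
            using \<eta> by (simp add: distrib_left powr_add[symmetric] mult.assoc)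
          also have "?y powr q = W (?R j) powr (- q) * \<bar>w z\<bar> powr q"
            using W[OF R] by (simp add: powr_divide powr_minus_divide)
          finally have 1: "1 + \<eta> powr (- p) * ?y powr p \<le> 2 + ?c * \<bar>w z\<bar> powr q" by (simp add: mult_ac)
          have "(1 + \<eta> powr (- p) * ?y powr p) * \<zeta> z ^ (s - 2) \<le> (1 + \<eta> powr (- p) * ?y powr p) * 1"
            using \<zeta>01[of z] by (intro mult_left_mono) (auto simp: power_le_one add_nonneg_nonneg)
          then show ?thesis using 1 True by simp
        next
          case False
          then show ?thesis using g0[of z] by simp
        qed
      qed
      also have "integral\<^sup>L lebesgue ?g = 2 * measure lebesgue (?Q (?R j)) + ?c * (I - integral\<^sup>L lebesgue (?f j))"
        using Qi[OF R] Qm[OF R] wi fi[of j] by (simp add: I_eq)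
      also have "E * \<eta> * W (?R j) powr q * \<dots> =
         2 * E * \<eta> * (W (?R j) powr q * measure lebesgue (?Q (?R j))) + K * (I - integral\<^sup>L lebesgue (?f j))"
      proof -
        have "W (?R j) powr q * W (?R j) powr (- q) = 1" using W[OF R] by (simp add: powr_add[symmetric])
        moreover have "e * h * k * (2 * M + i * d * m * X) = 2 * e * h * (k * M) + (k * m) * (e * h * (i * d) * X)"
          for e h k M i d m X :: real
          by (simp add: algebra_simps)
        ultimately show ?thesis unfolding K_def by simp
      qed
      also have "\<dots> \<le> 2 * E * \<eta> * V + K * (I - integral\<^sup>L lebesgue (?f j))"
        using W_vol[OF R] E \<eta> by (intro add_right_mono mult_left_mono) auto
      finally show ?thesis .
    qed
    have "(\<lambda>j. 2 * E * \<eta> * V + K * (I - integral\<^sup>L lebesgue (?f j))) \<longlonglongrightarrow> 2 * E * \<eta> * V + K * (I - I)"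
      by (intro tendsto_intros I)
    from LIMSEQ_le[OF I this] step show ?thesis by auto
  qed
  have "I \<le> 0"
  proof (rule field_le_epsilon)
    fix e :: real assume "0 < e"
    then have "I \<le> 2 * E * (e / (2 * E * V)) * V" using E V by (intro small) auto
    also have "\<dots> = e" using E V by simp
    finally show "I \<le> 0 + e" by simp
  qed
  moreover have "0 \<le> I" unfolding I_eq[symmetric] by (intro integral_nonneg_AE) simp
  ultimately have "integral\<^sup>L lebesgue (\<lambda>z. \<bar>w z\<bar> powr q) = 0" using I_eq by simp
  then have "AE z in lebesgue. \<bar>w z\<bar> powr q = 0"
    using integral_nonneg_eq_0_iff_AE[OF wi] by simp
  then show ?thesis by eventually_elim simp
qed

theorem theorem2:
  fixes a :: "'n::finite \<Rightarrow> 'n \<Rightarrow> real \<times> (real ^ 'n) \<Rightarrow> real"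
    and A u v :: "real \<times> (real ^ 'n) \<Rightarrow> real"
    and \<alpha> q c :: real
  assumes "\<alpha> > 0"
    and "1 < q" and "q \<le> 1 + \<alpha> / real CARD('n)"
    and "admissible_coefficients a A"
    and "c > 0"
    and "\<And>R. R > 1 \<Longrightarrow> ess_bound A R \<le> ereal (c * R powr (2 - \<alpha>))"
    and "weak_supersolution a q u"
    and "weak_subsolution a q v"
    and "AE z in lebesgue. u z \<ge> v z"
  shows "AE z in lebesgue. u z = v z"
proof -
  \<comment> \<open>Any exponent strictly between 1 and \<open>q\<close> will do; \<open>s\<close> is then large enough for Young's inequality with the
    exponents \<open>q / p\<close> and its conjugate.\<close>
  define p where "p = (1 + q) / 2"
  have p: "1 < p" "p < q" using assms(2) by (auto simp: p_def)
  obtain s0 :: nat where s0: "2 * q / (q - p) \<le> real s0" using real_arch_simple by blast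
  define s where "s = s0 + 3"
  have s: "2 \<le> s" "2 < s" by (auto simp: s_def)
  have "2 * q / (q - p) \<le> real s" using s0 by (simp add: s_def)
  then have "2 * q \<le> real s * (q - p)" using p by (simp add: pos_divide_le_eq)
  then have sp: "real s * (p / q) \<le> real s - 2" using p by (simp add: field_simps)
  have loc: "integrable lebesgue (\<lambda>z. \<bar>u z - v z\<bar> powr q * indicator (outer_cyl \<alpha> R) z)" if R: "1 < R" for R
  proof -
    define \<Omega> :: "(real \<times> (real ^ 'n)) set" where "\<Omega> = ball 0 (2 * R powr \<alpha> + R + 1)"
    have \<Omega>: "domain_set \<Omega>" "bounded \<Omega>" "open \<Omega>"
      unfolding \<Omega>_def using R by (auto intro!: domain_set_ball add_pos_pos)
    have Q: "outer_cyl \<alpha> R \<subseteq> \<Omega>" unfolding \<Omega>_def by (rule outer_cyl_subset_ball)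
    have "outer_cyl \<alpha> R \<in> sets lebesgue" by measurable
    then have "indicator (outer_cyl \<alpha> R) \<in> borel_measurable (lebesgue_on \<Omega>)"
      by (intro measurable_restrict_space1 borel_measurable_indicator)
    then have "integrable (lebesgue_on \<Omega>) (\<lambda>z. \<bar>u z - v z\<bar> powr q * indicator (outer_cyl \<alpha> R) z)"
      by (rule integral_mult_bounded_le(1)[OF difference_powr_integrable[OF assms(4,2,7,8) \<Omega>(1,2)], of _ 1])
         (simp add: indicator_def)
    then show ?thesis
      using integral_lebesgue_on_eq_lebesgue(2)[OF \<Omega>(3), of "\<lambda>z. \<bar>u z - v z\<bar> powr q * indicator (outer_cyl \<alpha> R) z"] Q
      by (auto simp: indicator_def)
  qed
  have m: "(\<lambda>z. u z - v z) \<in> borel_measurable lebesgue"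
    using assms(7,8) by (auto simp: weak_supersolution_def weak_subsolution_def)
  have "AE z in lebesgue. u z - v z = 0"
  proof (rule cylinder_estimate[where \<alpha> = \<alpha>, OF p s(1) assms(4,5) _ assms(7,8,9)])
    show "ess_bound A R \<le> ereal (c * R powr (2 - \<alpha>))" if "1 < R" for R
      by (rule assms(6)[OF that])
  qed (rule scale_estimates_imp_zero[OF assms(1) p assms(3) s(2) sp m loc])
  then show ?thesis by eventually_elim simp
qed

end
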